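(* Consider the iterates $\{x_k\}$ generated by TR-SQP-STORM (described in the context). Suppose the regularity assumption, the merit-parameter stabilization assumption and the probabilistic accuracy conditions given in the context hold, and let $\nu\in(0,1)$ be a constant satisfying $$\frac{\nu}{1-\nu}\ge\max\left\{\frac{4\gamma^3\max\{1,\Delta_{\max}\}}{\min\{\eta^3\kappa_{fcd},\Upsilon_3\}},\frac{2\gamma}{\eta}\right\}.$$ If $$p_h+p_g+2p_f\le\frac{(1-\nu)^2}{16\nu^2}\left(1-\frac1\gamma\right)^2,$$ then $\lim_{k\to\infty}\|\nabla\mathcal L_k\|=0$ almost surely.
   Context: **Problem and notation.** $\min_{x\in\mathbb R^d} f(x)=\mathbb E[F(x;\xi)]$ subject to $c(x)=0$, where $c=(c^1,\dots,c^m):\mathbb R^d\to\mathbb R^m$ is deterministic. $\|\cdot\|$ is the Euclidean norm (vectors) or operator norm (matrices). $G(x)=\nabla c(x)\in\mathbb R^{m\times d}$ is the Jacobian. Subscript $k$ denotes evaluation at $x_k$: $f_k$, $g_k=\nabla f(x_k)$, $\nabla^2f_k$, $c_k$, $G_k$, $\nabla^2c^i_k$. $Z_k\in\mathbb R^{d\times(d-m)}$ has orthonormal columns spanning $\ker G_k$. True quantities: $\lambda_k=-[G_kG_k^T]^{-1}G_kg_k$, $\nabla\mathcal L_k=(g_k+G_k^T\lambda_k,\,c_k)$, $\nabla_x^2\mathcal L_k=\nabla^2f_k+\sum_{i=1}^m\lambda_k^i\nabla^2c_k^i$. **Algorithm TR-SQP-STORM.** Parameters: $\alpha\in\{0,1\}$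 ($\alpha=0$: aim at first-order stationarity; $\alpha=1$: second-order); $p_h,p_g,p_f,\eta\in(0,1)$; $\kappa_{fcd}\in(0,1]$; $r,\Delta_{\max},\kappa_h,\kappa_g>0$; $0<\kappa_f\le\kappa_{fcd}\eta^3/(16\max\{1,\Delta_{\max}\})$; $\rho,\gamma>1$; initial $x_0$, $\Delta_0\in(0,\Delta_{\max})$, $\bar\epsilon_0,\bar\mu_0>0$. Iteration $k$, given $(x_k,\Delta_k,\bar\epsilon_k,\bar\mu_k)$: (1) Obtain an estimate $\bar g_k$ of $g_k$; set $\bar\lambda_k=-[G_kG_k^T]^{-1}G_k\bar g_k$, $\bar\nabla_x\mathcal L_k=\bar g_k+G_k^T\bar\lambda_k$, $\bar\nabla\mathcal L_k=(\bar\nabla_x\mathcal L_k,c_k)$. If $\alpha=0$, take any matrix $\bar H_k$ approximating $\nabla_x^2\mathcal L_k$ and set $\bar\tau_k^+=0$. If $\alpha=1$, obtain an estimate $\bar\nabla^2f_k$ of $\nabla^2f_k$, set $\bar H_k=\bar\nabla^2f_k+\sum_i\bar\lambda_k^i\nabla^2c_k^i$, let $\bar\tau_k$ be the smallest eigenvalue of $Z_k^T\bar H_kZ_k$ and $\bar\tau_k^+=|\min\{\bar\tau_k,0\}|$. (2) If $\max\{\|\bar\nabla\mathcal L_k\|/\max\{1,\|\bar H_k\|\},\,\bar\tau_k^+\}\ge\eta\Delta_k$ fails, the iteration is *unsuccessful*: $x_{k+1}=x_k$, $\Delta_{k+1}=\Delta_k/\gamma$, $\bar\epsilon_{k+1}=\bar\epsilon_k/\gamma$,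 $\bar\mu_{k+1}=\bar\mu_k$, and the iteration ends. Otherwise compute a trial step $\Delta x_k=w_k+Z_ku_k$, $w_k=\bar\gamma_kv_k$, $v_k=-G_k^T[G_kG_k^T]^{-1}c_k$, $\bar\gamma_k=\min\{\breve\Delta_k/\|v_k\|,1\}$ (its value is immaterial if $v_k=0$). Put $c_k^{RS}=c_k/\|G_k\|$, $\bar\nabla_x\mathcal L_k^{RS}=\bar\nabla_x\mathcal L_k/\|\bar H_k\|$, $\bar\nabla\mathcal L_k^{RS}=(\bar\nabla_x\mathcal L_k^{RS},c_k^{RS})$, $\bar\tau_k^{RS+}=\bar\tau_k^+/\|\bar H_k\|$ (nonzero $\bar H_k$ implicit), and $m(u)=\frac12(Z_ku)^T\bar H_kZ_ku+(\bar g_k+\bar H_kw_k)^TZ_ku$. If $\|\bar\nabla\mathcal L_k\|\min\{\Delta_k,\|\bar\nabla\mathcal L_k\|/\|\bar H_k\|\}\ge\bar\tau_k^+\Delta_k(\Delta_k+\|c_k\|)$, take a *gradient step*: $\breve\Delta_k=\Delta_k\|c_k^{RS}\|/\|\bar\nabla\mathcal L_k^{RS}\|$, $\tilde\Delta_k=\Delta_k\|\bar\nabla_x\mathcal L_k^{RS}\|/\|\bar\nabla\mathcal L_k^{RS}\|$, and $u_k$ is any vector with $\|u_k\|\le\tilde\Delta_k$ and $m(u_k)-m(0)\le-\frac{\kappa_{fcd}}2\|q_k\|\min\{\tilde\Delta_k,\|q_k\|/\|Z_k^T\bar H_kZ_k\|\}$, $q_k=Z_k^T(\bar g_k+\bar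 H_kw_k)$. Otherwise take an *eigen step*: $\breve\Delta_k=\Delta_k\|c_k^{RS}\|/\|(c_k^{RS},\bar\tau_k^{RS+})\|$, $\tilde\Delta_k=\Delta_k\bar\tau_k^{RS+}/\|(c_k^{RS},\bar\tau_k^{RS+})\|$, and $u_k$ is any vector with $(\bar g_k+\bar H_kw_k)^TZ_ku_k\le0$, $\|u_k\|\le\tilde\Delta_k$, $(Z_ku_k)^T\bar H_k(Z_ku_k)\le-\kappa_{fcd}\bar\tau_k^+\tilde\Delta_k^2$. (3) Let $\mathrm{Pred}_k=\bar g_k^T\Delta x_k+\frac12\Delta x_k^T\bar H_k\Delta x_k+\bar\mu_k(\|c_k+G_k\Delta x_k\|-\|c_k\|)$; replace $\bar\mu_k\leftarrow\rho\bar\mu_k$ until $\mathrm{Pred}_k\le-\frac{\kappa_{fcd}}2\max\{\|\bar\nabla\mathcal L_k\|\min\{\Delta_k,\|\bar\nabla\mathcal L_k\|/\|\bar H_k\|\},\,\bar\tau_k^+\Delta_k(\Delta_k+\|c_k\|)\}$. Below $\bar\mu_k$ denotes the value after this update, and $\bar\mu_{k+1}$ is initialized as $\bar\mu_k$. Set $x_{s_k}=x_k+\Delta x_k$, obtain estimates $\bar f_k,\bar f_{s_k}$ of $f_k,f_{s_k}=f(x_{s_k})$, and let $\mathrm{Ared}_k=\bar f_{s_k}-\bar f_k+\bar\mu_k(\|c(x_{s_k})\|-\|c_k\|)$. (4) If $\mathrm{Ared}_k/\mathrm{Pred}_k\ge\eta$, the iteration is *successful*: $x_{k+1}=x_{s_k}$,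 $\Delta_{k+1}=\min\{\gamma\Delta_k,\Delta_{\max}\}$; if moreover $-\mathrm{Pred}_k\ge\bar\epsilon_k$ it is *reliable* and $\bar\epsilon_{k+1}=\gamma\bar\epsilon_k$, otherwise *unreliable* and $\bar\epsilon_{k+1}=\bar\epsilon_k/\gamma$. If $\mathrm{Ared}_k/\mathrm{Pred}_k<\eta$, $\alpha=1$ and $\|c_k\|\le r$, perform the second-order correction (SOC) step: $d_k=-G_k^T[G_kG_k^T]^{-1}\{c(x_k+\Delta x_k)-c_k-G_k\Delta x_k\}$, reset $x_{s_k}=x_k+\Delta x_k+d_k$, re-estimate $\bar f_{s_k}$, recompute $\mathrm{Ared}_k$; if now $\mathrm{Ared}_k/\mathrm{Pred}_k\ge\eta$, the iteration is successful with the updates just described. In all remaining cases it is *unsuccessful*: $x_{k+1}=x_k$, $\Delta_{k+1}=\Delta_k/\gamma$, $\bar\epsilon_{k+1}=\bar\epsilon_k/\gamma$. **Accuracy events.** $\mathcal A_k=\{\|\bar\nabla^2f_k-\nabla^2f_k\|\le\kappa_h\Delta_k\}$ (taken to hold always if $\alpha=0$); $\mathcal B_k=\{\|\bar g_k-g_k\|\le\kappa_g\Delta_k^{\alpha+1}\}$; $\mathcal C_k=\{\max(|\bar f_k-f_k|,|\bar f_{s_k}-f_{s_k}|)\le\kappa_f\Delta_k^{\alpha+2}\}$ for $x_{s_k}=x_k+\Delta x_k$; $\mathcal C_k'$ is the same event for the SOC trial point with its re-estimated value (taken to hold if no SOC step is computed). If no trial step is computed, $\mathcal C_k,\mathcal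 C_k'$ are taken to hold and the function-value errors are taken to be $0$. **Probabilistic accuracy conditions.** $\mathcal F_{k-1}$ is the $\sigma$-algebra of all randomness before iteration $k$ ($x_0,\dots,x_k,\Delta_k,\bar\epsilon_k$ are $\mathcal F_{k-1}$-measurable); $\mathcal F_{k-0.5}$ additionally contains $\bar g_k,\bar\nabla^2f_k$ (so $\Delta x_k,\bar\lambda_k,\bar\mu_k,d_k$ are $\mathcal F_{k-0.5}$-measurable). For all $k$: $P(\mathcal A_k\mid\mathcal F_{k-1})\ge1-p_h$ (for $\alpha=1$), $P(\mathcal B_k\mid\mathcal F_{k-1})\ge1-p_g$, $P(\mathcal C_k\mid\mathcal F_{k-0.5})\ge1-p_f$, $P(\mathcal C_k'\mid\mathcal F_{k-0.5})\ge1-p_f$, and $\max\{\mathbb E[|\bar f_k-f_k|^2\mid\mathcal F_{k-0.5}],\mathbb E[|\bar f_{s_k}-f_{s_k}|^2\mid\mathcal F_{k-0.5}]\}\le\bar\epsilon_k^2$ (also for the re-estimated $\bar f_{s_k}$). **Regularity assumption.** There is an open convex set $\Omega\subseteq\mathbb R^d$ containing all iterates and trial points on which: $f$ is twice continuously differentiable and bounded below by $f_{\inf}$; $\nabla f,\nabla^2f$ are Lipschitz with constants $L_{\nabla f},L_{\nabla^2f}$; $c$ is twice continuously differentiable; $G$ is Lipschitz with constant $L_G$; each $\nabla^2c^i$ is Lipschitz with constant $L_{\nabla^2c}$. There are constants $\kappa_c,\kappa_{\nabla f},\kappa_{1,G},\kappa_{2,G}>0$ with $\|c_k\|\le\kappa_c$,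 $\|g_k\|\le\kappa_{\nabla f}$, $\kappa_{1,G}I\preceq G_kG_k^T\preceq\kappa_{2,G}I$ for all $k\ge0$. If $\alpha=0$, $\|\bar H_k\|\le\kappa_B$ for a constant $\kappa_B\ge1$. If $\alpha=1$, put $\kappa_B=\max\{1,\kappa_h\Delta_{\max}+L_{\nabla f}+\frac{\sqrt m L_G}{\sqrt{\kappa_{1,G}}}(\kappa_g\Delta_{\max}^2+\kappa_{\nabla f})\}$. **Merit-parameter stabilization assumption.** There are a (possibly random) $\bar K<\infty$ and a deterministic constant $\hat\mu$ with $\bar\mu_k=\bar\mu_{\bar K}\le\hat\mu$ for all $k\ge\bar K$. **Constants.** $\Upsilon_1=\kappa_g\max\{1,\Delta_{\max}\}+\frac12(L_{\nabla f}+\kappa_B+\hat\mu L_G)$ and $\Upsilon_3=\frac{3\kappa_{fcd}}8\max\left\{\frac{\kappa_B}{\kappa_g\max\{1,\Delta_{\max}\}+\kappa_B},\frac{4\kappa_f\max\{1,\Delta_{\max}\}+8\Upsilon_1}{\{(1-\eta)\kappa_{fcd}\kappa_g+4\kappa_f\}\max\{1,\Delta_{\max}\}+8\Upsilon_1}\right\}$. *)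

theory Defs
  imports "HOL-Probability.Probability"
begin

text \<open>
  Conventions. The dimensions \<open>d\<close>, \<open>m\<close> and \<open>d - m\<close> are the cardinalities of the index types
  \<open>'d\<close>, \<open>'m\<close> and \<open>'n\<close>. The type \<open>'n\<close> is nonempty, so for \<open>d = m\<close> (where \<open>Z\<close> has no columns) it
  has one element and \<open>Z\<close> consists of one zero column; then \<open>Z u = 0\<close>, and \<open>Z\<^sup>T H Z\<close> and the
  quantities derived from it are zero. The constant \<open>norm\<close> is the Euclidean norm on vectors and, on
  pairs, the Euclidean norm of the stacked vector. On matrices it would be the Frobenius norm, so
  the operator norm is introduced separately.
\<close>

section \<open>Linear algebra and derivatives\<close>

definition opnorm :: "real^'n^'m \<Rightarrow> real" where
  "opnorm A = onorm ((*v) A)"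

definition loewner_le :: "real^'n^'n \<Rightarrow> real^'n^'n \<Rightarrow> bool" where
  "loewner_le A B \<longleftrightarrow> (\<forall>v. v \<bullet> (A *v v) \<le> v \<bullet> (B *v v))"

text \<open>Only used for symmetric matrices, where the set is finite and nonempty.\<close>

definition smallest_eigenvalue :: "real^'n^'n \<Rightarrow> real" where
  "smallest_eigenvalue A = Min {t. \<exists>v. v \<noteq> 0 \<and> A *v v = t *\<^sub>R v}"

definition orthonormal_kernel_basis :: "real^'d^'m \<Rightarrow> real^'n^'d \<Rightarrow> bool" where
  "orthonormal_kernel_basis G Z \<longleftrightarrow>
     span (columns Z) = {v. G *v v = 0} \<and>
     (CARD('m) < CARD('d) \<longrightarrow>
        (\<forall>i j. column i Z \<bullet> column j Z = (if i = j then 1 else 0)))"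

definition grad :: "(real^'d \<Rightarrow> real) \<Rightarrow> real^'d \<Rightarrow> real^'d" where
  "grad f x = (\<chi> j. frechet_derivative f (at x) (axis j 1))"

definition hess :: "(real^'d \<Rightarrow> real) \<Rightarrow> real^'d \<Rightarrow> real^'d^'d" where
  "hess f x = jacobian (grad f) (at x)"

abbreviation Jac :: "(real^'d \<Rightarrow> real^'m) \<Rightarrow> real^'d \<Rightarrow> real^'d^'m" where
  "Jac c x \<equiv> jacobian c (at x)"

definition twice_cont_diff_on :: "(real^'d) set \<Rightarrow> (real^'d \<Rightarrow> real) \<Rightarrow> bool" where
  "twice_cont_diff_on \<Omega> f \<longleftrightarrow>
     (\<forall>x\<in>\<Omega>. f differentiable (at x)) \<and> (\<forall>x\<in>\<Omega>. grad f differentiable (at x)) \<and>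
     continuous_on \<Omega> (hess f)"

definition op_lipschitz_on :: "real \<Rightarrow> (real^'d) set \<Rightarrow> (real^'d \<Rightarrow> real^'n^'m) \<Rightarrow> bool" where
  "op_lipschitz_on L \<Omega> A \<longleftrightarrow>
     0 \<le> L \<and> (\<forall>x\<in>\<Omega>. \<forall>y\<in>\<Omega>. opnorm (A x - A y) \<le> L * dist x y)"

text \<open>\<open>G\<^sup>T (G G\<^sup>T)\<^sup>-\<^sup>1 b\<close>, the minimum-norm solution of \<open>G v = b\<close>.\<close>

definition min_norm_solution :: "real^'d^'m \<Rightarrow> real^'m \<Rightarrow> real^'d" where
  "min_norm_solution G b = transpose G *v (matrix_inv (G ** transpose G) *v b)"

text \<open>
  Multipliers and Lagrangian gradient at \<open>x\<close> for a vector \<open>g\<close>: the true quantities are obtained for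
  \<open>g = grad f x\<close>, the estimated ones for the estimate of the gradient.
\<close>

definition multipliers :: "(real^'d \<Rightarrow> real^'m) \<Rightarrow> real^'d \<Rightarrow> real^'d \<Rightarrow> real^'m" where
  "multipliers c x g = - (matrix_inv (Jac c x ** transpose (Jac c x)) *v (Jac c x *v g))"

definition grad_x_lagr :: "(real^'d \<Rightarrow> real^'m) \<Rightarrow> real^'d \<Rightarrow> real^'d \<Rightarrow> real^'d" where
  "grad_x_lagr c x g = g + transpose (Jac c x) *v multipliers c x g"

definition grad_lagr ::
  "(real^'d \<Rightarrow> real^'m) \<Rightarrow> real^'d \<Rightarrow> real^'d \<Rightarrow> (real^'d) \<times> (real^'m)" where
  "grad_lagr c x g = (grad_x_lagr c x g, c x)"

section \<open>The algorithm TR-SQP-STORM\<close>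

record ('d::finite) params =
  alpha :: nat
  p_h :: real
  p_g :: real
  p_f :: real
  eta :: real
  kappa_fcd :: real
  r_soc :: real
  Delta_max :: real
  kappa_h :: real
  kappa_g :: real
  kappa_f :: real
  rho :: real
  gamma :: real
  x_init :: "real^'d"
  Delta_init :: real
  eps_init :: real
  mu_init :: real

definition valid_params :: "('d::finite) params \<Rightarrow> bool" where
  "valid_params P \<longleftrightarrow>
     alpha P \<in> {0, 1} \<and>
     p_h P \<in> {0<..<1} \<and> p_g P \<in> {0<..<1} \<and> p_f P \<in> {0<..<1} \<and> eta P \<in> {0<..<1} \<and>
     kappa_fcd P \<in> {0<..1} \<and>
     r_soc P > 0 \<and> Delta_max P > 0 \<and> kappa_h P > 0 \<and> kappa_g P > 0 \<and>
     0 < kappa_f P \<and> kappa_f P \<le> kappa_fcd P * eta P ^ 3 / (16 * max 1 (Delta_max P)) \<and>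
     rho P > 1 \<and> gamma P > 1 \<and>
     Delta_init P \<in> {0<..<Delta_max P} \<and> eps_init P > 0 \<and> mu_init P > 0"

text \<open>
  The primary data of one iteration; all other quantities are functions of them.
  \<open>mu_in\<close> and \<open>mu\<close> are the merit parameter before and after its update in this iteration,
  \<open>fbar_soc\<close> is the re-estimated value at the trial point of the second-order correction step.
  Fields that the iteration does not use are arbitrary: \<open>hessbar\<close> if \<open>alpha = 0\<close>; \<open>uk\<close>, \<open>fbar\<close>,
  \<open>fbar_s\<close> if no trial step is computed; \<open>fbar_soc\<close> if no correction step is computed.
\<close>

record ('d::finite, 'n::finite) iter =
  xk :: "real^'d"
  Delta :: real
  eps :: real
  mu_in :: real
  gbar :: "real^'d"
  hessbar :: "real^'d^'d"
  Hbar :: "real^'d^'d"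
  Zk :: "real^'n^'d"
  uk :: "real^'n"
  mu :: real
  fbar :: real
  fbar_s :: real
  fbar_soc :: real

context
  fixes P :: "('d::finite) params" and c :: "real^'d \<Rightarrow> real^'m" and I :: "('d, 'n::finite) iter"
begin

abbreviation (input) Gk where "Gk \<equiv> Jac c (xk I)"

definition lambdabar :: "real^'m" where
  "lambdabar = multipliers c (xk I) (gbar I)"

definition Lbar_x :: "real^'d" where
  "Lbar_x = grad_x_lagr c (xk I) (gbar I)"

definition Lbar :: "(real^'d) \<times> (real^'m)" where
  "Lbar = grad_lagr c (xk I) (gbar I)"

definition red_hess :: "real^'n^'n" where
  "red_hess = transpose (Zk I) ** Hbar I ** Zk I"

definition tau_plus :: real where
  "tau_plus = (if alpha P = 1 then \<bar>min (smallest_eigenvalue red_hess) 0\<bar> else 0)"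

definition has_trial :: bool where
  "has_trial \<longleftrightarrow>
     max (norm Lbar / max 1 (opnorm (Hbar I))) tau_plus \<ge> eta P * Delta I"

definition first_order_term :: real where
  "first_order_term = norm Lbar * min (Delta I) (norm Lbar / opnorm (Hbar I))"

definition second_order_term :: real where
  "second_order_term = tau_plus * Delta I * (Delta I + norm (c (xk I)))"

definition is_gradient_step :: bool where
  "is_gradient_step \<longleftrightarrow> first_order_term \<ge> second_order_term"

definition c_RS :: "real^'m" where
  "c_RS = c (xk I) /\<^sub>R opnorm Gk"

definition Lbar_x_RS :: "real^'d" where
  "Lbar_x_RS = Lbar_x /\<^sub>R opnorm (Hbar I)"

definition tau_RS :: real where
  "tau_RS = tau_plus / opnorm (Hbar I)"

definition radius_normal :: real where
  "radius_normal =
     (if is_gradient_step then Delta I * norm c_RS / norm (Lbar_x_RS, c_RS)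
      else Delta I * norm c_RS / norm (c_RS, tau_RS))"

definition radius_tangential :: real where
  "radius_tangential =
     (if is_gradient_step then Delta I * norm Lbar_x_RS / norm (Lbar_x_RS, c_RS)
      else Delta I * tau_RS / norm (c_RS, tau_RS))"

definition v_step :: "real^'d" where
  "v_step = - min_norm_solution Gk (c (xk I))"

definition w_step :: "real^'d" where
  "w_step = min (radius_normal / norm v_step) 1 *\<^sub>R v_step"

definition q_vec :: "real^'n" where
  "q_vec = transpose (Zk I) *v (gbar I + Hbar I *v w_step)"

definition model :: "real^'n \<Rightarrow> real" where
  "model s = 1/2 * ((Zk I *v s) \<bullet> (Hbar I *v (Zk I *v s))) + (gbar I + Hbar I *v w_step) \<bullet> (Zk I *v s)"

text \<open>If the reduced Hessian is zero, \<open>\<parallel>q\<parallel> / \<parallel>Z\<^sup>T H Z\<parallel>\<close> is read as infinity.\<close>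

definition cauchy_length :: real where
  "cauchy_length =
     (if red_hess = 0 then radius_tangential
      else min radius_tangential (norm q_vec / opnorm red_hess))"

definition gradient_step_ok :: bool where
  "gradient_step_ok \<longleftrightarrow>
     norm (uk I) \<le> radius_tangential \<and>
     model (uk I) - model 0 \<le> - (kappa_fcd P / 2) * norm q_vec * cauchy_length"

definition eigen_step_ok :: bool where
  "eigen_step_ok \<longleftrightarrow>
     (gbar I + Hbar I *v w_step) \<bullet> (Zk I *v uk I) \<le> 0 \<and>
     norm (uk I) \<le> radius_tangential \<and>
     (Zk I *v uk I) \<bullet> (Hbar I *v (Zk I *v uk I)) \<le> - kappa_fcd P * tau_plus * radius_tangential\<^sup>2"

definition dx :: "real^'d" where
  "dx = (if has_trial then w_step + Zk I *v uk I else 0)"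

definition pred_at :: "real \<Rightarrow> real" where
  "pred_at \<mu> = gbar I \<bullet> dx + 1/2 * (dx \<bullet> (Hbar I *v dx))
     + \<mu> * (norm (c (xk I) + Gk *v dx) - norm (c (xk I)))"

definition pred_sufficient :: "real \<Rightarrow> bool" where
  "pred_sufficient \<mu> \<longleftrightarrow>
     pred_at \<mu> \<le> - (kappa_fcd P / 2) * max first_order_term second_order_term"

definition merit_update_ok :: bool where
  "merit_update_ok \<longleftrightarrow>
     (\<exists>j. mu I = rho P ^ j * mu_in I \<and> pred_sufficient (mu I) \<and>
          (\<forall>i<j. \<not> pred_sufficient (rho P ^ i * mu_in I)))"

text \<open>The requirements on the choices made within one iteration.\<close>

definition iteration_ok :: bool where
  "iteration_ok \<longleftrightarrow>
     orthonormal_kernel_basis Gk (Zk I) \<and>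
     (alpha P = 1 \<longrightarrow>
        transpose (hessbar I) = hessbar I \<and>
        Hbar I = hessbar I + (\<Sum>i\<in>UNIV. lambdabar $ i *\<^sub>R hess (\<lambda>y. c y $ i) (xk I))) \<and>
     (if has_trial
      then Hbar I \<noteq> 0 \<and>
           (if is_gradient_step then gradient_step_ok else eigen_step_ok) \<and>
           merit_update_ok
      else mu I = mu_in I)"

definition Pred :: real where
  "Pred = pred_at (mu I)"

definition x_trial :: "real^'d" where
  "x_trial = xk I + dx"

definition d_soc :: "real^'d" where
  "d_soc = - min_norm_solution Gk (c (xk I + dx) - c (xk I) - Gk *v dx)"

definition x_trial_soc :: "real^'d" where
  "x_trial_soc = xk I + dx + d_soc"

definition Ared :: real where
  "Ared = fbar_s I - fbar I + mu I * (norm (c x_trial) - norm (c (xk I)))"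

definition Ared_soc :: real where
  "Ared_soc = fbar_soc I - fbar I + mu I * (norm (c x_trial_soc) - norm (c (xk I)))"

definition accepted_plain :: bool where
  "accepted_plain \<longleftrightarrow> has_trial \<and> Ared / Pred \<ge> eta P"

definition has_soc :: bool where
  "has_soc \<longleftrightarrow>
     has_trial \<and> Ared / Pred < eta P \<and> alpha P = 1 \<and> norm (c (xk I)) \<le> r_soc P"

definition accepted_soc :: bool where
  "accepted_soc \<longleftrightarrow> has_soc \<and> Ared_soc / Pred \<ge> eta P"

definition transition :: "('d, 'n) iter \<Rightarrow> bool" where
  "transition I' \<longleftrightarrow>
     mu_in I' = mu I \<and>
     (if accepted_plain \<or> accepted_soc
      then xk I' = (if accepted_plain then x_trial else x_trial_soc) \<and>
           Delta I' = min (gamma P * Delta I) (Delta_max P) \<and>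
           eps I' = (if - Pred \<ge> eps I then gamma P * eps I else eps I / gamma P)
      else xk I' = xk I \<and> Delta I' = Delta I / gamma P \<and> eps I' = eps I / gamma P)"

end

definition storm_run ::
  "('d::finite) params \<Rightarrow> (real^'d \<Rightarrow> real^'m) \<Rightarrow> (nat \<Rightarrow> ('d, 'n::finite) iter) \<Rightarrow> bool" where
  "storm_run P c S \<longleftrightarrow>
     xk (S 0) = x_init P \<and> Delta (S 0) = Delta_init P \<and> eps (S 0) = eps_init P \<and>
     mu_in (S 0) = mu_init P \<and>
     (\<forall>k. iteration_ok P c (S k) \<and> transition P c (S k) (S (Suc k)))"

section \<open>Probabilistic accuracy conditions\<close>

definition acc_A :: "('d::finite) params \<Rightarrow> (real^'d \<Rightarrow> real) \<Rightarrow> ('d, 'n::finite) iter \<Rightarrow> bool" where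
  "acc_A P f I \<longleftrightarrow>
     alpha P = 0 \<or> opnorm (hessbar I - hess f (xk I)) \<le> kappa_h P * Delta I"

definition acc_B :: "('d::finite) params \<Rightarrow> (real^'d \<Rightarrow> real) \<Rightarrow> ('d, 'n::finite) iter \<Rightarrow> bool" where
  "acc_B P f I \<longleftrightarrow> norm (gbar I - grad f (xk I)) \<le> kappa_g P * Delta I ^ (alpha P + 1)"

text \<open>Function-value errors; they are zero for values that the iteration does not estimate.\<close>

definition err_f where
  "err_f P c f I = (if has_trial P c I then \<bar>fbar I - f (xk I)\<bar> else 0)"

definition err_s where
  "err_s P c f I = (if has_trial P c I then \<bar>fbar_s I - f (x_trial P c I)\<bar> else 0)"

definition err_soc where
  "err_soc P c f I = (if has_soc P c I then \<bar>fbar_soc I - f (x_trial_soc P c I)\<bar> else 0)"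

definition acc_C where
  "acc_C P c f I \<longleftrightarrow>
     \<not> has_trial P c I \<or>
     max (err_f P c f I) (err_s P c f I) \<le> kappa_f P * Delta I ^ (alpha P + 2)"

definition acc_C' where
  "acc_C' P c f I \<longleftrightarrow>
     \<not> has_soc P c I \<or>
     max (err_f P c f I) (err_soc P c f I) \<le> kappa_f P * Delta I ^ (alpha P + 2)"

definition cond_prob_ge :: "'w measure \<Rightarrow> 'w measure \<Rightarrow> ('w \<Rightarrow> bool) \<Rightarrow> real \<Rightarrow> bool" where
  "cond_prob_ge M \<F> Q p \<longleftrightarrow>
     {\<omega> \<in> space M. Q \<omega>} \<in> sets M \<and>
     (AE \<omega> in M. real_cond_exp M \<F> (indicator {\<omega> \<in> space M. Q \<omega>}) \<omega> \<ge> p)"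

text \<open>
  The conditional second moment is taken in \<^typ>\<open>ennreal\<close>, so that the bound includes its finiteness.
\<close>

definition cond_sq_le :: "'w measure \<Rightarrow> 'w measure \<Rightarrow> ('w \<Rightarrow> real) \<Rightarrow> ('w \<Rightarrow> real) \<Rightarrow> bool" where
  "cond_sq_le M \<F> X e \<longleftrightarrow>
     X \<in> borel_measurable M \<and>
     (AE \<omega> in M. nn_cond_exp M \<F> (\<lambda>\<omega>. ennreal ((X \<omega>)\<^sup>2)) \<omega> \<le> ennreal ((e \<omega>)\<^sup>2))"

text \<open>
  \<open>\<F> k\<close> is the sigma-algebra of the past of iteration \<open>k\<close> (index \<open>k - 1\<close> in the usual notation) and
  \<open>\<H> k\<close> the one that also contains the gradient and Hessian estimates (index \<open>k - 0.5\<close>).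
  Any sigma-algebras to which the algorithm is adapted are allowed.
\<close>

definition adapted_run where
  "adapted_run M \<F> \<H> P c S \<longleftrightarrow>
     (\<forall>k. subalgebra M (\<F> k) \<and> subalgebra M (\<H> k) \<and>
          subalgebra (\<H> k) (\<F> k) \<and> subalgebra (\<F> (Suc k)) (\<H> k) \<and>
          (\<lambda>\<omega>. xk (S k \<omega>)) \<in> borel_measurable (\<F> k) \<and>
          (\<lambda>\<omega>. Delta (S k \<omega>)) \<in> borel_measurable (\<F> k) \<and>
          (\<lambda>\<omega>. eps (S k \<omega>)) \<in> borel_measurable (\<F> k) \<and>
          (\<lambda>\<omega>. gbar (S k \<omega>)) \<in> borel_measurable (\<H> k) \<and>
          (\<lambda>\<omega>. hessbar (S k \<omega>)) \<in> borel_measurable (\<H> k) \<and>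
          (\<lambda>\<omega>. Hbar (S k \<omega>)) \<in> borel_measurable (\<H> k) \<and>
          (\<lambda>\<omega>. tau_plus P (S k \<omega>)) \<in> borel_measurable (\<H> k) \<and>
          (\<lambda>\<omega>. lambdabar c (S k \<omega>)) \<in> borel_measurable (\<H> k) \<and>
          (\<lambda>\<omega>. dx P c (S k \<omega>)) \<in> borel_measurable (\<H> k) \<and>
          (\<lambda>\<omega>. mu (S k \<omega>)) \<in> borel_measurable (\<H> k) \<and>
          (\<lambda>\<omega>. d_soc P c (S k \<omega>)) \<in> borel_measurable (\<H> k) \<and>
          (\<lambda>\<omega>. fbar (S k \<omega>)) \<in> borel_measurable (\<F> (Suc k)) \<and>
          (\<lambda>\<omega>. fbar_s (S k \<omega>)) \<in> borel_measurable (\<F> (Suc k)) \<and>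
          (\<lambda>\<omega>. fbar_soc (S k \<omega>)) \<in> borel_measurable (\<F> (Suc k)))"

definition probabilistic_accuracy where
  "probabilistic_accuracy M \<F> \<H> P f c S \<longleftrightarrow>
     (\<forall>k. (alpha P = 1 \<longrightarrow> cond_prob_ge M (\<F> k) (\<lambda>\<omega>. acc_A P f (S k \<omega>)) (1 - p_h P)) \<and>
          cond_prob_ge M (\<F> k) (\<lambda>\<omega>. acc_B P f (S k \<omega>)) (1 - p_g P) \<and>
          cond_prob_ge M (\<H> k) (\<lambda>\<omega>. acc_C P c f (S k \<omega>)) (1 - p_f P) \<and>
          cond_prob_ge M (\<H> k) (\<lambda>\<omega>. acc_C' P c f (S k \<omega>)) (1 - p_f P) \<and>
          cond_sq_le M (\<H> k) (\<lambda>\<omega>. err_f P c f (S k \<omega>)) (\<lambda>\<omega>. eps (S k \<omega>)) \<and>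
          cond_sq_le M (\<H> k) (\<lambda>\<omega>. err_s P c f (S k \<omega>)) (\<lambda>\<omega>. eps (S k \<omega>)) \<and>
          cond_sq_le M (\<H> k) (\<lambda>\<omega>. err_soc P c f (S k \<omega>)) (\<lambda>\<omega>. eps (S k \<omega>)))"

section \<open>Regularity and merit-parameter stabilization\<close>

record reg_consts =
  f_inf :: real
  L_grad :: real
  L_hess :: real
  L_G :: real
  L_hess_c :: real
  kappa_c :: real
  kappa_grad :: real
  kappa_1G :: real
  kappa_2G :: real
  kappa_B :: real

definition problem_regular ::
  "(real^'d \<Rightarrow> real) \<Rightarrow> (real^'d \<Rightarrow> real^'m) \<Rightarrow> (real^'d) set \<Rightarrow> reg_consts \<Rightarrow> bool" where
  "problem_regular f c \<Omega> K \<longleftrightarrow>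
     open \<Omega> \<and> convex \<Omega> \<and>
     twice_cont_diff_on \<Omega> f \<and> (\<forall>x\<in>\<Omega>. f_inf K \<le> f x) \<and>
     lipschitz_on (L_grad K) \<Omega> (grad f) \<and> op_lipschitz_on (L_hess K) \<Omega> (hess f) \<and>
     (\<forall>i. twice_cont_diff_on \<Omega> (\<lambda>x. c x $ i)) \<and>
     op_lipschitz_on (L_G K) \<Omega> (\<lambda>x. Jac c x) \<and>
     (\<forall>i. op_lipschitz_on (L_hess_c K) \<Omega> (hess (\<lambda>x. c x $ i))) \<and>
     kappa_c K > 0 \<and> kappa_grad K > 0 \<and> kappa_1G K > 0 \<and> kappa_2G K > 0"

definition iterates_regular where
  "iterates_regular P f c \<Omega> K S \<longleftrightarrow>
     (\<forall>k. xk (S k) \<in> \<Omega> \<and>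
          (has_trial P c (S k) \<longrightarrow> x_trial P c (S k) \<in> \<Omega>) \<and>
          (has_soc P c (S k) \<longrightarrow> x_trial_soc P c (S k) \<in> \<Omega>) \<and>
          norm (c (xk (S k))) \<le> kappa_c K \<and>
          norm (grad f (xk (S k))) \<le> kappa_grad K \<and>
          loewner_le (kappa_1G K *\<^sub>R mat 1) (Jac c (xk (S k)) ** transpose (Jac c (xk (S k)))) \<and>
          loewner_le (Jac c (xk (S k)) ** transpose (Jac c (xk (S k)))) (kappa_2G K *\<^sub>R mat 1) \<and>
          (alpha P = 0 \<longrightarrow> opnorm (Hbar (S k)) \<le> kappa_B K))"

text \<open>The argument \<open>m\<close> is the number of constraints.\<close>

definition kappa_B_ok :: "nat \<Rightarrow> ('d::finite) params \<Rightarrow> reg_consts \<Rightarrow> bool" where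
  "kappa_B_ok m P K \<longleftrightarrow>
     (alpha P = 0 \<longrightarrow> kappa_B K \<ge> 1) \<and>
     (alpha P = 1 \<longrightarrow> kappa_B K =
        max 1 (kappa_h P * Delta_max P + L_grad K +
               sqrt (real m) * L_G K / sqrt (kappa_1G K) *
                 (kappa_g P * (Delta_max P)\<^sup>2 + kappa_grad K)))"

definition merit_stabilizes :: "'w measure \<Rightarrow> (nat \<Rightarrow> 'w \<Rightarrow> ('d::finite, 'n::finite) iter) \<Rightarrow>
    ('w \<Rightarrow> nat) \<Rightarrow> real \<Rightarrow> bool" where
  "merit_stabilizes M S Kbar mu_hat \<longleftrightarrow>
     (AE \<omega> in M. \<forall>k\<ge>Kbar \<omega>. mu (S k \<omega>) = mu (S (Kbar \<omega>) \<omega>)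
                              \<and> mu (S (Kbar \<omega>) \<omega>) \<le> mu_hat)"

definition Upsilon1 :: "('d::finite) params \<Rightarrow> reg_consts \<Rightarrow> real \<Rightarrow> real" where
  "Upsilon1 P K mu_hat =
     kappa_g P * max 1 (Delta_max P) + 1/2 * (L_grad K + kappa_B K + mu_hat * L_G K)"

definition Upsilon3 :: "('d::finite) params \<Rightarrow> reg_consts \<Rightarrow> real \<Rightarrow> real" where
  "Upsilon3 P K mu_hat =
     3 * kappa_fcd P / 8 *
     max (kappa_B K / (kappa_g P * max 1 (Delta_max P) + kappa_B K))
         ((4 * kappa_f P * max 1 (Delta_max P) + 8 * Upsilon1 P K mu_hat) /
          (((1 - eta P) * kappa_fcd P * kappa_g P + 4 * kappa_f P) * max 1 (Delta_max P)
             + 8 * Upsilon1 P K mu_hat))"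

end

theory Submission
  imports Defs
begin

text \<open>
  The proof follows the Lyapunov function
  \<open>\<nu> (f(x) - f_inf + \<mu> \<parallel>c(x)\<parallel>) + (1 - \<nu>) / 4 \<Delta>^(\<alpha> + 2) + (1 - \<nu>) \<epsilon>\<close> along the run. A successful
  iteration lowers the merit function by a fixed fraction of the predicted reduction, and this
  pays for the growth of \<open>\<Delta>\<close> and \<open>\<epsilon>\<close>; an unsuccessful iteration shrinks both. Errors of
  the function values matter only if an accuracy event fails. By a conditional Cauchy--Schwarz
  inequality (\<open>cond_error_expectation\<close>) their expectation is at most \<open>4 sqrt p_f\<close> times that of
  \<open>\<epsilon>\<close>, which the bound on the failure probabilities makes at most the loss in the term
  \<open>(1 - \<nu>) \<epsilon>\<close>. The growth of the merit parameter telescopes. Summation shows that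
  \<open>\<Delta>^(\<alpha> + 2)\<close> is summable almost surely, so the radii tend to zero.

  Fix a level \<open>e > 0\<close>. Where the stationarity residual is at least \<open>e\<close>, the predicted reduction
  is linear in the radius, but its error is only quadratic. An accurate iteration with a small
  radius is thus accepted (\<open>accurate_step_accepted\<close>). This has two consequences.
  First, accurate iterations have conditional probability at least one half, and the Lyapunov
  decrease shows that the radii are even summable over the iterations with residual at least \<open>e\<close>
  (\<open>AE_summable_active_radius\<close>). Second, the residual cannot stay above \<open>e\<close> forever: as long as
  it does, the inverse radius contracts in expectation by the factor \<open>1 / \<gamma> + p \<gamma> < 1\<close>, where
  \<open>p\<close> is the total failure probability, although it is at least \<open>1 / Delta_max\<close>
  (\<open>AE_not_always_active\<close>).

  One iteration raises the residual by at most a constant times the radius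
  (\<open>residual_step\<close>). A residual that returns below every level and whose rise above a level is
  controlled by a convergent sum tends to zero (\<open>recurrent_controlled_tendsto_zero\<close>).

  The Lipschitz estimate for the residual rests on a variational description: the norm of the
  Lagrangian gradient is the distance of the gradient from the row space of the Jacobian, so the
  multiplier of one point gives an upper bound at the other. The same estimate yields
  continuity on the set of regular points, and hence measurability along the run.
\<close>


section \<open>Linear algebra\<close>

lemma opnorm_bound: "norm (A *v x) \<le> opnorm A * norm x"
  unfolding opnorm_def by (rule onorm[OF matrix_vector_mul_bounded_linear])

lemma opnorm_nonneg: "0 \<le> opnorm A"
  unfolding opnorm_def by (rule onorm_pos_le[OF matrix_vector_mul_bounded_linear])

lemma opnorm_le: "(\<And>x. norm (A *v x) \<le> b * norm x) \<Longrightarrow> opnorm A \<le> b"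
  unfolding opnorm_def by (rule onorm_le)

lemma opnorm_add_le: "opnorm (A + B) \<le> opnorm A + opnorm B"
proof (rule opnorm_le)
  fix x
  have "norm ((A + B) *v x) \<le> norm (A *v x) + norm (B *v x)"
    by (simp add: matrix_vector_mult_add_rdistrib norm_triangle_ineq)
  also have "\<dots> \<le> (opnorm A + opnorm B) * norm x"
    using opnorm_bound[of A x] opnorm_bound[of B x] by (simp add: algebra_simps)
  finally show "norm ((A + B) *v x) \<le> (opnorm A + opnorm B) * norm x" .
qed

lemma opnorm_scaleR_le: "opnorm (a *\<^sub>R A) \<le> \<bar>a\<bar> * opnorm A"
proof (rule opnorm_le)
  fix x
  have "norm ((a *\<^sub>R A) *v x) = \<bar>a\<bar> * norm (A *v x)"
    by (simp add: scaleR_matrix_vector_assoc[symmetric])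
  also have "\<dots> \<le> \<bar>a\<bar> * (opnorm A * norm x)"
    by (intro mult_left_mono opnorm_bound) auto
  finally show "norm ((a *\<^sub>R A) *v x) \<le> \<bar>a\<bar> * opnorm A * norm x" by simp
qed

lemma opnorm_zero: "opnorm (0::real^'n^'m) = 0"
  using opnorm_le[of "0::real^'n^'m" 0] opnorm_nonneg[of "0::real^'n^'m"] by simp

lemma opnorm_sum_le: "finite I \<Longrightarrow> opnorm (\<Sum>i\<in>I. A i) \<le> (\<Sum>i\<in>I. opnorm (A i))"
  by (induction I rule: finite_induct) (auto simp: opnorm_zero intro: order_trans[OF opnorm_add_le])

lemma opnorm_eq_0_iff: "opnorm A = 0 \<longleftrightarrow> A = 0"
proof
  assume "opnorm A = 0"
  then have "A *v x = 0 *v x" for x using opnorm_bound[of A x] by simp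
  then show "A = 0" by (simp add: matrix_eq)
qed (simp add: opnorm_zero)

lemma inner_transpose_mult: "(transpose A *v y) \<bullet> x = y \<bullet> (A *v x)"
  for A :: "real^'n^'m"
  by (simp add: dot_lmul_matrix)

lemma norm_transpose_mult_le: "norm (transpose A *v y) \<le> opnorm A * norm y"
proof (cases "transpose A *v y = 0")
  case False
  let ?z = "transpose A *v y"
  have "norm ?z * norm ?z = (A *v ?z) \<bullet> y"
    by (metis inner_transpose_mult inner_commute power2_norm_eq_inner power2_eq_square)
  also have "\<dots> \<le> norm (A *v ?z) * norm y" by (rule norm_cauchy_schwarz)
  also have "\<dots> \<le> opnorm A * norm ?z * norm y" by (intro mult_right_mono opnorm_bound) auto
  finally show ?thesis using False by (simp add: mult.assoc mult.left_commute)
qed (use opnorm_nonneg[of A] in auto)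

lemma norm_row_le: "norm (row i A) \<le> opnorm A"
proof -
  have "row i A = transpose A *v axis i 1"
    by (simp add: matrix_vector_mul_component row_def vec_eq_iff transpose_def matrix_vector_mult_def axis_def if_distrib cong: if_cong)
  then show ?thesis using norm_transpose_mult_le[of A "axis i 1"] by simp
qed

locale gram_bounded =
  fixes G :: "real^'d^'m" and \<kappa> :: real
  assumes pos: "\<kappa> > 0" and lower: "loewner_le (\<kappa> *\<^sub>R mat 1) (G ** transpose G)"
begin

lemma gram_lower: "\<kappa> * (norm y)\<^sup>2 \<le> (norm (transpose G *v y))\<^sup>2"
proof -
  have "y \<bullet> ((\<kappa> *\<^sub>R mat 1) *v y) \<le> y \<bullet> ((G ** transpose G) *v y)"
    using lower unfolding loewner_le_def by blast
  moreover have "y \<bullet> ((G ** transpose G) *v y) = (norm (transpose G *v y))\<^sup>2"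
    by (metis inner_transpose_mult power2_norm_eq_inner matrix_vector_mul_assoc)
  ultimately show ?thesis
    by (simp add: scaleR_matrix_vector_assoc[symmetric] power2_norm_eq_inner)
qed

lemma sqrt_gram_lower: "sqrt \<kappa> * norm y \<le> norm (transpose G *v y)"
  using gram_lower[of y] pos
  by (metis norm_ge_zero real_sqrt_le_iff real_sqrt_mult real_sqrt_pow2_iff real_sqrt_power abs_of_nonneg real_sqrt_abs)

lemma invertible_gram: "invertible (G ** transpose G)"
proof -
  have "inj ((*v) (G ** transpose G))"
  proof (rule linear_injective_0[THEN iffD2, rule_format])
    fix y assume "(G ** transpose G) *v y = 0"
    then have "y \<bullet> ((\<kappa> *\<^sub>R mat 1) *v y) \<le> 0"
      using lower unfolding loewner_le_def by (metis inner_zero_right)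
    then show "y = 0"
      using pos by (simp add: scaleR_matrix_vector_assoc[symmetric] mult_le_0_iff)
        (metis inner_eq_zero_iff inner_ge_zero order_antisym)
  qed (simp add: matrix_vector_mul_linear)
  then show ?thesis
    by (simp add: invertible_left_inverse matrix_left_invertible_injective inj_def)
qed

lemma gram_inverse: "G *v (transpose G *v (matrix_inv (G ** transpose G) *v b)) = b"
proof -
  have "(G ** transpose G) ** matrix_inv (G ** transpose G) = mat 1"
    using invertible_gram unfolding invertible_def matrix_inv_def by (rule someI2_ex) simp
  then show ?thesis by (simp add: matrix_vector_mul_assoc matrix_mul_assoc)
qed

lemma norm_min_norm_solution_le: "norm (min_norm_solution G b) \<le> norm b / sqrt \<kappa>"
proof (cases "min_norm_solution G b = 0")
  case False
  define y where "y = matrix_inv (G ** transpose G) *v b"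
  define v where "v = transpose G *v y"
  have v: "min_norm_solution G b = v" by (simp add: min_norm_solution_def v_def y_def)
  have "G *v v = b" unfolding v_def y_def by (rule gram_inverse)
  then have "norm v * norm v = y \<bullet> b"
    by (metis v_def inner_transpose_mult power2_norm_eq_inner power2_eq_square)
  also have "\<dots> \<le> norm y * norm b" by (rule norm_cauchy_schwarz)
  also have "\<dots> \<le> norm v / sqrt \<kappa> * norm b"
    using sqrt_gram_lower[of y] pos by (intro mult_right_mono) (auto simp: v_def field_simps)
  finally have "norm v * norm v \<le> norm v * (norm b / sqrt \<kappa>)" by simp
  then show ?thesis using False v by (metis mult_le_cancel_left_pos zero_less_norm_iff)
qed (use pos in auto)

lemma norm_gram_multiplier_le:
  "norm (matrix_inv (G ** transpose G) *v (G *v g)) \<le> norm g / sqrt \<kappa>"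
proof -
  define y where "y = matrix_inv (G ** transpose G) *v (G *v g)"
  define v where "v = transpose G *v y"
  have "G *v v = G *v g" unfolding v_def y_def by (rule gram_inverse)
  then have "v \<bullet> v = v \<bullet> g" by (metis v_def inner_transpose_mult)
  then have "norm v * norm v = v \<bullet> g" by (simp add: power2_norm_eq_inner flip: power2_eq_square)
  also have "\<dots> \<le> norm v * norm g" by (rule norm_cauchy_schwarz)
  finally have "norm v \<le> norm g"
    by (cases "v = 0") (auto simp: mult_le_cancel_left_pos)
  then have "sqrt \<kappa> * norm y \<le> norm g"
    using sqrt_gram_lower[of y] by (simp add: v_def)
  then show ?thesis using pos by (simp add: field_simps flip: y_def)
qed

text \<open>
  Subtracting the least-squares combination of the rows of \<open>G\<close> projects onto the kernel of
  \<open>G\<close>, so that no other combination leaves a shorter remainder.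
\<close>
lemma kernel_projection_minimal:
  "norm (g - transpose G *v (matrix_inv (G ** transpose G) *v (G *v g)))
     \<le> norm (g + transpose G *v l)"
proof -
  define y where "y = matrix_inv (G ** transpose G) *v (G *v g)"
  define p where "p = g - transpose G *v y"
  have "G *v p = 0"
    unfolding p_def y_def by (simp only: matrix_vector_mult_diff_distrib gram_inverse) simp
  then have orth: "p \<bullet> (transpose G *v (l + y)) = 0"
    by (metis inner_commute inner_transpose_mult inner_zero_right)
  have "g + transpose G *v l = p + transpose G *v (l + y)"
    by (simp add: p_def matrix_vector_right_distrib)
  then have "(norm (g + transpose G *v l))\<^sup>2 = (norm p)\<^sup>2 + (norm (transpose G *v (l + y)))\<^sup>2"
    using orth by (simp add: power2_norm_eq_inner inner_add_left inner_add_right inner_commute)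
  then have "(norm p)\<^sup>2 \<le> (norm (g + transpose G *v l))\<^sup>2" by simp
  then show ?thesis unfolding p_def y_def by (rule power2_le_imp_le) simp
qed

text \<open>
  The range of \<open>Z\<close> is the kernel of \<open>G\<close>. If \<open>G\<close> is square, this kernel is trivial because
  \<open>G\<close> has full row rank, which covers the degenerate case of the definition.
\<close>
lemma norm_kernel_basis_le:
  fixes Z :: "real^'n^'d"
  assumes Z: "orthonormal_kernel_basis G Z"
  shows "norm (Z *v u) \<le> norm u"
proof (cases "CARD('m) < CARD('d)")
  case True
  then have orth: "column i Z \<bullet> column j Z = (if i = j then 1 else 0)" for i j
    using Z unfolding orthonormal_kernel_basis_def by blast
  have "transpose Z ** Z = mat 1"
    using orth by (simp add: matrix_matrix_mult_def transpose_def mat_def vec_eq_iff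
        column_def inner_vec_def)
  then have "(Z *v u) \<bullet> (Z *v u) = u \<bullet> u"
    by (metis inner_transpose_mult inner_commute matrix_vector_mul_assoc matrix_vector_mul_lid)
  then show ?thesis by (simp add: norm_eq_sqrt_inner)
next
  case False
  have surj: "surj ((*v) G)" by (rule surjI) (rule gram_inverse)
  have "dim (UNIV :: (real^'m) set) \<le> dim (UNIV :: (real^'d) set)"
    using dim_image_le[OF matrix_vector_mul_linear[of G], of UNIV] surj by simp
  then have "CARD('d) = CARD('m)" using False by (simp)
  then have "inj ((*v) G)"
    using surj linear_surjective_imp_injective[OF matrix_vector_mul_linear[of G] surj] by simp
  then have ker: "{v. G *v v = 0} = {0}"
    using linear_injective_0[OF matrix_vector_mul_linear[of G]] by auto
  have "Z *v u \<in> span (columns Z)"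
    by (rule matrix_vector_mult_in_columnspace)
  then have "Z *v u = 0" using Z ker unfolding orthonormal_kernel_basis_def by auto
  then show ?thesis by simp
qed

end

section \<open>Taylor estimates\<close>

lemma has_derivative_grad:
  assumes "f differentiable (at x)"
  shows "(f has_derivative (\<lambda>h. grad f x \<bullet> h)) (at x)"
proof -
  let ?D = "frechet_derivative f (at x)"
  have D: "(f has_derivative ?D) (at x)" using assms by (simp add: frechet_derivative_works)
  then interpret bounded_linear ?D by (rule has_derivative_bounded_linear)
  have "?D h = grad f x \<bullet> h" for h
  proof -
    have "?D h = ?D (\<Sum>j\<in>UNIV. h $ j *\<^sub>R axis j 1)"
      using basis_expansion[of h] by (simp add: scalar_mult_eq_scaleR)
    also have "\<dots> = grad f x \<bullet> h"
      by (simp add: sum scaleR grad_def inner_vec_def mult.commute)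
    finally show ?thesis .
  qed
  then have "?D = (\<lambda>h. grad f x \<bullet> h)" by auto
  with D show ?thesis by simp
qed

lemma has_derivative_Jac:
  fixes c :: "real^'d \<Rightarrow> real^'m"
  assumes "\<And>i. (\<lambda>y. c y $ i) differentiable (at x)"
  shows "(c has_derivative (\<lambda>h. Jac c x *v h)) (at x)"
proof -
  have "c differentiable (at x)"
  proof (subst differentiable_componentwise_within, safe)
    fix b :: "real^'m" assume "b \<in> Basis"
    then obtain i where "b = axis i 1" by (auto simp: Basis_vec_def)
    then show "(\<lambda>y. c y \<bullet> b) differentiable (at x)"
      using assms[of i] by (simp add: inner_axis)
  qed
  then show ?thesis by (simp add: jacobian_works)
qed

lemma grad_component:
  fixes c :: "real^'d \<Rightarrow> real^'m"
  assumes "(c has_derivative (\<lambda>h. Jac c x *v h)) (at x)"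
  shows "grad (\<lambda>y. c y $ i) x = row i (Jac c x)"
proof -
  have "((\<lambda>y. c y $ i) has_derivative (\<lambda>h. (Jac c x *v h) $ i)) (at x)"
    using bounded_linear.has_derivative[OF bounded_linear_vec_nth assms] .
  then have "frechet_derivative (\<lambda>y. c y $ i) (at x) = (\<lambda>h. (Jac c x *v h) $ i)"
    by (metis frechet_derivative_at)
  then show ?thesis
    by (simp add: grad_def vec_eq_iff row_def matrix_vector_mult_basis column_def)
qed

text \<open>
  The mean value inequality on the segment from \<open>x\<close> to \<open>y\<close>, applied to \<open>h\<close> minus its
  linearization at \<open>x\<close>.
\<close>
lemma first_order_remainder:
  fixes h :: "'a::real_normed_vector \<Rightarrow> 'b::real_normed_vector"
  assumes cvx: "convex \<Omega>" and x: "x \<in> \<Omega>" and y: "y \<in> \<Omega>"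
    and deriv: "\<And>z. z \<in> \<Omega> \<Longrightarrow> (h has_derivative D z) (at z)"
    and lip: "\<And>z. z \<in> \<Omega> \<Longrightarrow> onorm (\<lambda>v. D z v - D x v) \<le> L * norm (z - x)"
    and L: "0 \<le> L"
  shows "norm (h y - h x - D x (y - x)) \<le> L * (norm (y - x))\<^sup>2"
proof -
  interpret D: bounded_linear "D x" by (rule has_derivative_bounded_linear[OF deriv[OF x]])
  let ?S = "closed_segment x y"
  have sub: "?S \<subseteq> \<Omega>" using cvx x y by (simp add: closed_segment_subset)
  have "norm ((\<lambda>z. h z - D x z) y - (\<lambda>z. h z - D x z) x) \<le> (L * norm (y - x)) * norm (y - x)"
  proof (rule differentiable_bound[where S = ?S and f' = "\<lambda>z v. D z v - D x v"])
    fix z assume z: "z \<in> ?S"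
    then have zO: "z \<in> \<Omega>" using sub by blast
    show "((\<lambda>z. h z - D x z) has_derivative (\<lambda>v. D z v - D x v)) (at z within ?S)"
      using has_derivative_at_withinI[OF has_derivative_diff[OF deriv[OF zO] D.has_derivative[OF has_derivative_ident]]] .
    have "norm (z - x) \<le> norm (y - x)" using segment_bound1[OF z] by (simp add: norm_minus_commute)
    then have "L * norm (z - x) \<le> L * norm (y - x)" using L by (rule mult_left_mono)
    then show "onorm (\<lambda>v. D z v - D x v) \<le> L * norm (y - x)"
      using lip[OF zO] by linarith
  qed auto
  then show ?thesis by (simp add: D.diff algebra_simps power2_eq_square)
qed

text \<open>Directional derivatives are limits of difference quotients, which inherit the bound.\<close>
lemma opnorm_jacobian_le_lipschitz:
  fixes h :: "real^'d \<Rightarrow> real^'m"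
  assumes opn: "open \<Omega>" and x: "x \<in> \<Omega>" and diff: "h differentiable (at x)"
    and lip: "\<And>y. y \<in> \<Omega> \<Longrightarrow> norm (h y - h x) \<le> L * norm (y - x)"
  shows "opnorm (Jac h x) \<le> L"
proof (rule opnorm_le)
  fix v
  have der: "(h has_derivative (\<lambda>v. Jac h x *v v)) (at x)" using diff by (simp add: jacobian_works)
  have "((\<lambda>t. x + t *\<^sub>R v) has_derivative (\<lambda>t. t *\<^sub>R v)) (at 0)"
    by (auto intro!: derivative_eq_intros)
  then have "((\<lambda>t. h (x + t *\<^sub>R v)) has_derivative (\<lambda>t. Jac h x *v (t *\<^sub>R v))) (at 0)"
    using has_derivative_compose[of "\<lambda>t. x + t *\<^sub>R v" "\<lambda>t. t *\<^sub>R v" 0 UNIV h "\<lambda>v. Jac h x *v v"] der by simp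
  then have "((\<lambda>t. norm (h (x + t *\<^sub>R v) - h x - t *\<^sub>R (Jac h x *v v)) / norm t) \<longlongrightarrow> 0) (at 0)"
    by (simp add: has_derivative_at matrix_vector_mult_scaleR)
  moreover have "\<forall>\<^sub>F t in at (0::real). norm (h (x + t *\<^sub>R v) - h x - t *\<^sub>R (Jac h x *v v)) / norm t
      = norm ((h (x + t *\<^sub>R v) - h x) /\<^sub>R t - Jac h x *v v)"
  proof (unfold eventually_at_filter, rule always_eventually, safe)
    fix t :: real assume t: "t \<noteq> 0"
    then have "h (x + t *\<^sub>R v) - h x - t *\<^sub>R (Jac h x *v v)
      = t *\<^sub>R ((h (x + t *\<^sub>R v) - h x) /\<^sub>R t - Jac h x *v v)"
      by (simp add: scaleR_diff_right)
    then show "norm (h (x + t *\<^sub>R v) - h x - t *\<^sub>R (Jac h x *v v)) / norm t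
      = norm ((h (x + t *\<^sub>R v) - h x) /\<^sub>R t - Jac h x *v v)"
      using t by simp
  qed
  ultimately have "((\<lambda>t. norm ((h (x + t *\<^sub>R v) - h x) /\<^sub>R t - Jac h x *v v)) \<longlongrightarrow> 0) (at 0)"
    by (rule Lim_transform_eventually)
  then have lim: "((\<lambda>t. (h (x + t *\<^sub>R v) - h x) /\<^sub>R t) \<longlongrightarrow> Jac h x *v v) (at 0)"
    by (simp add: tendsto_norm_zero_iff LIM_zero_cancel)
  show "norm (Jac h x *v v) \<le> L * norm v"
  proof (rule tendsto_upperbound[OF tendsto_norm[OF lim]])
    have "((\<lambda>t. x + t *\<^sub>R v) \<longlongrightarrow> x + 0 *\<^sub>R v) (at 0)" by (intro tendsto_intros)
    then have "\<forall>\<^sub>F t in at 0. x + t *\<^sub>R v \<in> \<Omega>" using opn x by (auto dest: topological_tendstoD)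
    moreover have "\<forall>\<^sub>F t in at (0::real). t \<noteq> 0" by (simp add: eventually_at_filter)
    ultimately show "\<forall>\<^sub>F t in at 0. norm ((h (x + t *\<^sub>R v) - h x) /\<^sub>R t) \<le> L * norm v"
    proof eventually_elim
      case (elim t)
      have "norm (h (x + t *\<^sub>R v) - h x) \<le> L * (\<bar>t\<bar> * norm v)" using lip[OF elim(1)] by simp
      then have "norm (h (x + t *\<^sub>R v) - h x) / \<bar>t\<bar> \<le> L * norm v"
        using elim(2) by (simp add: pos_divide_le_eq mult_ac)
      then show ?case by (simp add: divide_inverse mult.commute)
    qed
  qed simp
qed

lemma matrix_vector_mult_minus: "A *v (- x) = - (A *v x)" for A :: "real^'n^'m"
  by (simp add: matrix_vector_mult_def vec_eq_iff sum_negf)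

section \<open>The stationarity measure on the set of regular points\<close>

definition regular_points ::
  "(real^'d \<Rightarrow> real) \<Rightarrow> (real^'d \<Rightarrow> real^'m) \<Rightarrow> (real^'d) set \<Rightarrow> reg_consts \<Rightarrow> (real^'d) set" where
  "regular_points f c \<Omega> K =
     {x \<in> \<Omega>. norm (c x) \<le> kappa_c K \<and> norm (grad f x) \<le> kappa_grad K \<and>
       loewner_le (kappa_1G K *\<^sub>R mat 1) (Jac c x ** transpose (Jac c x)) \<and>
       loewner_le (Jac c x ** transpose (Jac c x)) (kappa_2G K *\<^sub>R mat 1)}"

definition kkt_residual :: "(real^'d \<Rightarrow> real) \<Rightarrow> (real^'d \<Rightarrow> real^'m) \<Rightarrow> real^'d \<Rightarrow> real" where
  "kkt_residual f c x = norm (grad_lagr c x (grad f x))"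

locale regular_problem =
  fixes f :: "real^'d \<Rightarrow> real" and c :: "real^'d \<Rightarrow> real^'m"
    and \<Omega> :: "(real^'d) set" and K :: reg_consts
  assumes regular: "problem_regular f c \<Omega> K"
begin

lemma open_dom: "open \<Omega>" and convex_dom: "convex \<Omega>"
  and f_lower: "x \<in> \<Omega> \<Longrightarrow> f_inf K \<le> f x"
  and L_grad_nonneg: "0 \<le> L_grad K" and L_G_nonneg: "0 \<le> L_G K"
  and consts_pos: "kappa_c K > 0" "kappa_grad K > 0" "kappa_1G K > 0" "kappa_2G K > 0"
  using regular unfolding problem_regular_def op_lipschitz_on_def lipschitz_on_def by auto

lemma grad_lipschitz: "x \<in> \<Omega> \<Longrightarrow> y \<in> \<Omega> \<Longrightarrow> norm (grad f y - grad f x) \<le> L_grad K * norm (y - x)"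
  using regular unfolding problem_regular_def lipschitz_on_def dist_norm by blast

lemma Jac_lipschitz: "x \<in> \<Omega> \<Longrightarrow> y \<in> \<Omega> \<Longrightarrow> opnorm (Jac c y - Jac c x) \<le> L_G K * norm (y - x)"
  using regular unfolding problem_regular_def op_lipschitz_on_def dist_norm by blast

lemma f_deriv: "x \<in> \<Omega> \<Longrightarrow> (f has_derivative (\<lambda>h. grad f x \<bullet> h)) (at x)"
  using regular unfolding problem_regular_def twice_cont_diff_on_def
  by (blast intro: has_derivative_grad)

lemma c_deriv: "x \<in> \<Omega> \<Longrightarrow> (c has_derivative (\<lambda>h. Jac c x *v h)) (at x)"
  using regular unfolding problem_regular_def twice_cont_diff_on_def
  by (blast intro: has_derivative_Jac)

lemma f_remainder:
  assumes x: "x \<in> \<Omega>" and y: "y \<in> \<Omega>"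
  shows "\<bar>f y - f x - grad f x \<bullet> (y - x)\<bar> \<le> L_grad K * (norm (y - x))\<^sup>2"
proof -
  have "norm (f y - f x - grad f x \<bullet> (y - x)) \<le> L_grad K * (norm (y - x))\<^sup>2"
  proof (rule first_order_remainder[OF convex_dom x y f_deriv])
    fix z assume z: "z \<in> \<Omega>"
    have "onorm (\<lambda>v. grad f z \<bullet> v - grad f x \<bullet> v) \<le> norm (grad f z - grad f x)"
      by (rule onorm_le) (simp add: Cauchy_Schwarz_ineq2 flip: inner_diff_left)
    also have "\<dots> \<le> L_grad K * norm (z - x)" by (rule grad_lipschitz[OF x z])
    finally show "onorm (\<lambda>v. grad f z \<bullet> v - grad f x \<bullet> v) \<le> L_grad K * norm (z - x)" .
  qed (use L_grad_nonneg in auto)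
  then show ?thesis by simp
qed

lemma c_remainder:
  assumes x: "x \<in> \<Omega>" and y: "y \<in> \<Omega>"
  shows "norm (c y - c x - Jac c x *v (y - x)) \<le> L_G K * (norm (y - x))\<^sup>2"
proof (rule first_order_remainder[OF convex_dom x y c_deriv])
  fix z assume z: "z \<in> \<Omega>"
  have "(\<lambda>v. Jac c z *v v - Jac c x *v v) = (*v) (Jac c z - Jac c x)"
    by (simp add: matrix_vector_mult_diff_rdistrib fun_eq_iff)
  then show "onorm (\<lambda>v. Jac c z *v v - Jac c x *v v) \<le> L_G K * norm (z - x)"
    using Jac_lipschitz[OF x z] by (simp add: opnorm_def)
qed (use L_G_nonneg in auto)

lemma opnorm_hess_f_le: "x \<in> \<Omega> \<Longrightarrow> opnorm (hess f x) \<le> L_grad K"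
  unfolding hess_def
  using regular unfolding problem_regular_def twice_cont_diff_on_def
  by (intro opnorm_jacobian_le_lipschitz[OF open_dom] grad_lipschitz) auto

lemma opnorm_hess_c_le:
  assumes x: "x \<in> \<Omega>"
  shows "opnorm (hess (\<lambda>y. c y $ i) x) \<le> L_G K"
  unfolding hess_def
proof (rule opnorm_jacobian_le_lipschitz[OF open_dom x])
  show "grad (\<lambda>y. c y $ i) differentiable (at x)"
    using regular x unfolding problem_regular_def twice_cont_diff_on_def by blast
  fix y assume y: "y \<in> \<Omega>"
  have "grad (\<lambda>y. c y $ i) y - grad (\<lambda>y. c y $ i) x = row i (Jac c y - Jac c x)"
    by (simp add: grad_component[OF c_deriv[OF x]] grad_component[OF c_deriv[OF y]] row_def vec_eq_iff)
  then show "norm (grad (\<lambda>y. c y $ i) y - grad (\<lambda>y. c y $ i) x) \<le> L_G K * norm (y - x)"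
    using norm_row_le[of i "Jac c y - Jac c x"] Jac_lipschitz[OF x y] by simp
qed

lemma continuous_f: "continuous_on \<Omega> f"
  by (rule has_derivative_continuous_on[OF has_derivative_at_withinI[OF f_deriv]])

lemma continuous_c: "continuous_on \<Omega> c"
  by (rule has_derivative_continuous_on[OF has_derivative_at_withinI[OF c_deriv]])

context
  fixes x assumes x: "x \<in> regular_points f c \<Omega> K"
begin

interpretation gram_bounded "Jac c x" "kappa_1G K"
  using x consts_pos by unfold_locales (auto simp: regular_points_def)

lemma opnorm_Jac_le: "opnorm (Jac c x) \<le> sqrt (kappa_2G K)"
proof -
  let ?G = "Jac c x"
  have "norm (transpose ?G *v y) \<le> sqrt (kappa_2G K) * norm y" for y
  proof (rule power2_le_imp_le)
    have "y \<bullet> ((?G ** transpose ?G) *v y) \<le> y \<bullet> ((kappa_2G K *\<^sub>R mat 1) *v y)"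
      using x by (auto simp: regular_points_def loewner_le_def)
    moreover have "y \<bullet> ((?G ** transpose ?G) *v y) = (norm (transpose ?G *v y))\<^sup>2"
      by (metis inner_transpose_mult power2_norm_eq_inner matrix_vector_mul_assoc)
    ultimately show "(norm (transpose ?G *v y))\<^sup>2 \<le> (sqrt (kappa_2G K) * norm y)\<^sup>2"
      using consts_pos
      by (simp add: scaleR_matrix_vector_assoc[symmetric] power2_norm_eq_inner power_mult_distrib)
  qed (use consts_pos in simp)
  then have T: "opnorm (transpose ?G) \<le> sqrt (kappa_2G K)" by (rule opnorm_le)
  show ?thesis
  proof (rule opnorm_le)
    fix v
    have "norm (?G *v v) \<le> opnorm (transpose ?G) * norm v"
      using norm_transpose_mult_le[of "transpose ?G" v] by (simp add: transpose_transpose)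
    also have "\<dots> \<le> sqrt (kappa_2G K) * norm v" using T by (rule mult_right_mono) simp
    finally show "norm (?G *v v) \<le> sqrt (kappa_2G K) * norm v" .
  qed
qed

lemma norm_multipliers_le: "norm (multipliers c x g) \<le> norm g / sqrt (kappa_1G K)"
  using norm_gram_multiplier_le by (simp add: multipliers_def)

lemma grad_x_lagr_minimal: "norm (grad_x_lagr c x g) \<le> norm (g + transpose (Jac c x) *v l)"
proof -
  have "grad_x_lagr c x g =
      g - transpose (Jac c x) *v (matrix_inv (Jac c x ** transpose (Jac c x)) *v (Jac c x *v g))"
    unfolding grad_x_lagr_def multipliers_def by (simp add: matrix_vector_mult_minus)
  then show ?thesis using kernel_projection_minimal[of g l] by simp
qed

lemma norm_correction_le: "norm (min_norm_solution (Jac c x) b) \<le> norm b / sqrt (kappa_1G K)"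
  by (rule norm_min_norm_solution_le)

lemma norm_kernel_step_le: "orthonormal_kernel_basis (Jac c x) Z \<Longrightarrow> norm (Z *v u) \<le> norm u"
  by (rule norm_kernel_basis_le)

end

text \<open>
  The multiplier of the second point is feasible for the minimization that defines the norm at
  the first point. This avoids any differentiation of the inverse Gram matrix.
\<close>
lemma grad_x_lagr_perturb:
  assumes x: "x \<in> regular_points f c \<Omega> K" and y: "y \<in> regular_points f c \<Omega> K"
  shows "norm (grad_x_lagr c x g) \<le> norm (grad_x_lagr c y h) + norm (g - h)
    + opnorm (Jac c x - Jac c y) * (norm h / sqrt (kappa_1G K))"
proof -
  let ?l = "multipliers c y h"
  have "norm (grad_x_lagr c x g) \<le> norm (g + transpose (Jac c x) *v ?l)"
    by (rule grad_x_lagr_minimal[OF x])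
  also have "g + transpose (Jac c x) *v ?l
    = grad_x_lagr c y h + (g - h) + transpose (Jac c x - Jac c y) *v ?l"
  proof -
    have "transpose (Jac c x - Jac c y) = transpose (Jac c x) - transpose (Jac c y)"
      by (simp add: transpose_def vec_eq_iff)
    then show ?thesis by (simp add: grad_x_lagr_def matrix_vector_mult_diff_rdistrib)
  qed
  also have "norm \<dots> \<le> norm (grad_x_lagr c y h) + norm (g - h) + norm (transpose (Jac c x - Jac c y) *v ?l)"
    by (meson add_right_mono norm_triangle_ineq order_trans)
  also have "norm (transpose (Jac c x - Jac c y) *v ?l) \<le> opnorm (Jac c x - Jac c y) * (norm h / sqrt (kappa_1G K))"
    using norm_transpose_mult_le[of "Jac c x - Jac c y" ?l] norm_multipliers_le[OF y, of h]
    by (meson mult_left_mono opnorm_nonneg order_trans)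
  finally show ?thesis by simp
qed

lemma grad_lagr_gradient_error:
  assumes x: "x \<in> regular_points f c \<Omega> K"
  shows "norm (grad_lagr c x g) \<le> norm (grad_lagr c x h) + norm (g - h)"
proof -
  have "norm (grad_x_lagr c x g) \<le> norm (grad_x_lagr c x h) + norm (g - h)"
    using grad_x_lagr_perturb[OF x x, of g h] by (simp add: opnorm_zero)
  then have "norm (grad_lagr c x g) \<le> norm (norm (grad_x_lagr c x h) + norm (g - h), norm (c x))"
    by (simp add: grad_lagr_def norm_Pair power_mono)
  also have "\<dots> = norm ((norm (grad_x_lagr c x h), norm (c x)) + (norm (g - h), 0))" by simp
  also have "\<dots> \<le> norm (grad_lagr c x h) + norm (g - h)"
    by (rule order_trans[OF norm_triangle_ineq]) (simp add: grad_lagr_def norm_Pair)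
  finally show ?thesis .
qed

text \<open>Linear coefficient in the modulus of continuity of the residual between regular points.\<close>
definition res_lip :: real where
  "res_lip = L_grad K + L_G K * (kappa_grad K / sqrt (kappa_1G K)) + sqrt (kappa_2G K)"

lemma res_lip_nonneg: "0 \<le> res_lip"
  using L_grad_nonneg L_G_nonneg consts_pos by (simp add: res_lip_def)

lemma kkt_residual_le:
  assumes x: "x \<in> regular_points f c \<Omega> K" and y: "y \<in> regular_points f c \<Omega> K"
  shows "kkt_residual f c y \<le> kkt_residual f c x + res_lip * norm (y - x) + L_G K * (norm (y - x))\<^sup>2"
proof -
  have xO: "x \<in> \<Omega>" and yO: "y \<in> \<Omega>" using x y by (auto simp: regular_points_def)
  let ?a = "norm (grad_x_lagr c x (grad f x))" and ?n = "norm (y - x)"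
  let ?s = "(L_grad K + L_G K * (kappa_grad K / sqrt (kappa_1G K))) * ?n"
  let ?t = "sqrt (kappa_2G K) * ?n + L_G K * ?n\<^sup>2"
  have "opnorm (Jac c y - Jac c x) * (norm (grad f x) / sqrt (kappa_1G K))
      \<le> (L_G K * ?n) * (kappa_grad K / sqrt (kappa_1G K))"
    using x consts_pos L_G_nonneg
    by (intro mult_mono Jac_lipschitz xO yO divide_right_mono) (auto simp: regular_points_def)
  then have 1: "norm (grad_x_lagr c y (grad f y)) \<le> ?a + ?s"
    using grad_x_lagr_perturb[OF y x, of "grad f y" "grad f x"] grad_lipschitz[OF xO yO]
    by (simp add: algebra_simps)
  have "norm (Jac c x *v (y - x)) \<le> sqrt (kappa_2G K) * ?n"
    using opnorm_bound[of "Jac c x" "y - x"] opnorm_Jac_le[OF x]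
    by (meson mult_right_mono norm_ge_zero order_trans)
  then have 2: "norm (c y) \<le> norm (c x) + ?t"
    using c_remainder[OF xO yO] norm_triangle_ineq[of "c x" "c y - c x - Jac c x *v (y - x) + Jac c x *v (y - x)"]
      norm_triangle_ineq[of "c y - c x - Jac c x *v (y - x)" "Jac c x *v (y - x)"] by simp
  have "kkt_residual f c y \<le> norm (?a + ?s, norm (c x) + ?t)"
    unfolding kkt_residual_def grad_lagr_def norm_Pair
    using 1 2 by (simp add: add_mono power_mono)
  also have "\<dots> = norm ((?a, norm (c x)) + (?s, ?t))" by simp
  also have "\<dots> \<le> norm (?a, norm (c x)) + (norm ?s + norm ?t)"
    by (rule order_trans[OF norm_triangle_ineq]) (intro add_left_mono norm_Pair_le)
  also have "norm ?s + norm ?t = ?s + ?t" using consts_pos L_grad_nonneg L_G_nonneg by simp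
  finally show ?thesis
    by (simp add: kkt_residual_def grad_lagr_def norm_Pair res_lip_def algebra_simps)
qed

lemma continuous_kkt_residual: "continuous_on (regular_points f c \<Omega> K) (kkt_residual f c)"
  unfolding continuous_on_def
proof
  fix x assume x: "x \<in> regular_points f c \<Omega> K"
  let ?F = "at x within regular_points f c \<Omega> K"
  let ?b = "\<lambda>y. res_lip * norm (y - x) + L_G K * (norm (y - x))\<^sup>2"
  have "(?b \<longlongrightarrow> res_lip * norm (x - x) + L_G K * (norm (x - x))\<^sup>2) ?F" by (intro tendsto_intros)
  then have b: "(?b \<longlongrightarrow> 0) ?F" by simp
  have "\<forall>\<^sub>F y in ?F. norm (kkt_residual f c y - kkt_residual f c x) \<le> ?b y"
    unfolding eventually_at_filter
  proof (rule always_eventually, safe)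
    fix y assume "y \<in> regular_points f c \<Omega> K"
    from kkt_residual_le[OF x this] kkt_residual_le[OF this x]
    show "norm (kkt_residual f c y - kkt_residual f c x) \<le> ?b y"
      by (simp add: norm_minus_commute)
  qed
  then have "((\<lambda>y. kkt_residual f c y - kkt_residual f c x) \<longlongrightarrow> 0) ?F"
    using b by (rule Lim_null_comparison)
  then show "(kkt_residual f c \<longlongrightarrow> kkt_residual f c x) ?F"
    by (rule LIM_zero_cancel)
qed

end

section \<open>Constants of the analysis\<close>

locale storm_problem = regular_problem f c \<Omega> K
  for f :: "real^'d \<Rightarrow> real" and c :: "real^'d \<Rightarrow> real^'m" and \<Omega> K +
  fixes P :: "'d params" and \<nu> :: real
  assumes params: "valid_params P"
    and nu01: "0 < \<nu>" "\<nu> < 1"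
    and nu_radius: "4 * gamma P ^ 3 * max 1 (Delta_max P) * (1 - \<nu>) \<le> \<nu> * (eta P ^ 3 * kappa_fcd P)"
    and nu_eps: "2 * gamma P * (1 - \<nu>) \<le> \<nu> * eta P"
begin

lemma param_bounds:
  "alpha P = 0 \<or> alpha P = 1" "0 < eta P" "eta P < 1" "0 < kappa_fcd P" "kappa_fcd P \<le> 1"
  "0 < Delta_max P" "0 < kappa_h P" "0 < kappa_g P" "0 < kappa_f P"
  "kappa_f P \<le> kappa_fcd P * eta P ^ 3 / (16 * max 1 (Delta_max P))"
  "1 < rho P" "1 < gamma P" "0 < Delta_init P" "Delta_init P < Delta_max P" "0 < eps_init P"
  "0 < mu_init P"
  using params by (auto simp: valid_params_def)

definition step_const :: real where
  "step_const = 2 + 4 * L_G K * Delta_max P / sqrt (kappa_1G K)"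

lemma step_const_nonneg: "0 \<le> step_const"
  using L_G_nonneg param_bounds consts_pos by (simp add: step_const_def)

definition residual_const :: real where
  "residual_const = res_lip * step_const + L_G K * (step_const\<^sup>2 * Delta_max P)"

lemma residual_const_nonneg: "0 \<le> residual_const"
  using res_lip_nonneg step_const_nonneg L_G_nonneg param_bounds by (simp add: residual_const_def)

definition pred_coef :: real where
  "pred_coef = kappa_fcd P * (eta P)\<^sup>2 / (2 * max 1 (Delta_max P))"

lemma pred_coef_pos: "0 < pred_coef"
  using param_bounds by (simp add: pred_coef_def)

definition grad_err :: real where
  "grad_err = kappa_g P * max 1 (Delta_max P)"

definition hess_bound :: real where
  "hess_bound = max 1 (if alpha P = 0 then kappa_B K
     else kappa_h P * Delta_max P + L_grad K +
       real CARD('m) * ((kappa_grad K + grad_err * Delta_max P) / sqrt (kappa_1G K)) * L_G K)"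

text \<open>
  Constant of the quadratic bound on the difference between predicted and actual reduction. It
  collects the errors of function values, Taylor expansion, gradient, Hessian and constraints.
\<close>
definition model_err :: "real \<Rightarrow> real" where
  "model_err \<mu> = 2 * kappa_f P * max 1 (Delta_max P) + 4 * L_grad K + 2 * grad_err + 2 * hess_bound
     + 4 * \<mu> * L_G K"

text \<open>
  The first two entries keep the estimated residual above \<open>e / 2\<close> and make the criterion for
  a trial step true, the third keeps the model error below the fraction \<open>1 - \<eta>\<close> of the
  predicted reduction, and the last lets the radius grow by the full factor \<open>\<gamma>\<close>.
\<close>
definition radius_threshold :: "real \<Rightarrow> real \<Rightarrow> real" where
  "radius_threshold \<mu> e =
     min (min (e / (2 * grad_err)) (e / (2 * hess_bound)))
         (min ((1 - eta P) * kappa_fcd P * e / (4 * model_err \<mu>)) (Delta_max P / gamma P))"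

lemma grad_err_pos: "0 < grad_err"
  using param_bounds by (simp add: grad_err_def)

lemma hess_bound_ge: "1 \<le> hess_bound" by (simp add: hess_bound_def)

lemma model_err_pos: "0 \<le> \<mu> \<Longrightarrow> 0 < model_err \<mu>"
proof -
  assume "0 \<le> \<mu>"
  then have "0 \<le> \<mu> * L_G K" using L_G_nonneg by simp
  moreover have "0 < 2 * kappa_f P * max 1 (Delta_max P)" using param_bounds by simp
  ultimately show ?thesis
    using L_grad_nonneg grad_err_pos hess_bound_ge by (simp add: model_err_def)
qed

lemma radius_threshold_pos: "0 \<le> \<mu> \<Longrightarrow> 0 < e \<Longrightarrow> 0 < radius_threshold \<mu> e"
  using grad_err_pos hess_bound_ge model_err_pos[of \<mu>] param_bounds
  by (simp add: radius_threshold_def)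

text \<open>
  Where the accuracy events hold, the predicted reduction dominates the errors, so only the
  remaining ones are counted. Both trial points contribute, since which of them is accepted
  depends on the estimates themselves.
\<close>
definition excess_error :: "('d, 'n::finite) iter \<Rightarrow> real" where
  "excess_error I =
     (if acc_C P c f I then 0 else err_f P c f I + err_s P c f I) +
     (if acc_C' P c f I then 0 else err_f P c f I + err_soc P c f I)"

lemma err_nonneg: "0 \<le> err_f P c f I" "0 \<le> err_s P c f I" "0 \<le> err_soc P c f I"
  by (auto simp: err_f_def err_s_def err_soc_def)

lemma excess_error_nonneg: "0 \<le> excess_error I"
  using err_nonneg[of I] by (simp add: excess_error_def)

text \<open>
  The merit parameter is taken before its update, so that its growth appears as a separate
  telescoping term. The weight of \<open>eps\<close> is what absorbs the errors counted by
  \<open>excess_error\<close>; the power of the radius is the order of the accuracy demanded from the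
  function values.
\<close>
definition lyap :: "('d, 'n::finite) iter \<Rightarrow> real" where
  "lyap I = \<nu> * (f (xk I) - f_inf K + mu_in I * norm (c (xk I)))
     + (1 - \<nu>) / 4 * Delta I ^ (alpha P + 2) + (1 - \<nu>) * eps I"

end

section \<open>A single run of the algorithm\<close>

locale storm_path = storm_problem f c \<Omega> K P \<nu>
  for f :: "real^'d \<Rightarrow> real" and c :: "real^'d \<Rightarrow> real^'m" and \<Omega> K
    and P :: "'d params" and \<nu> +
  fixes S :: "nat \<Rightarrow> ('d, 'n::finite) iter"
  assumes run: "storm_run P c S"
    and iterates: "iterates_regular P f c \<Omega> K S"
begin

abbreviation "success k \<equiv> accepted_plain P c (S k) \<or> accepted_soc P c (S k)"

lemma start: "xk (S 0) = x_init P" "Delta (S 0) = Delta_init P" "eps (S 0) = eps_init P"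
    "mu_in (S 0) = mu_init P"
  and iter_ok: "iteration_ok P c (S k)"
  and step: "transition P c (S k) (S (Suc k))"
  using run by (auto simp: storm_run_def)

lemma regular_iterate: "xk (S k) \<in> regular_points f c \<Omega> K"
  using iterates by (auto simp: iterates_regular_def regular_points_def)

lemma iterate_dom: "xk (S k) \<in> \<Omega>"
  using regular_iterate by (simp add: regular_points_def)

lemma x_trial_dom: "has_trial P c (S k) \<Longrightarrow> x_trial P c (S k) \<in> \<Omega>"
  using iterates by (auto simp: iterates_regular_def)

lemma Delta_bounds: "0 < Delta (S k) \<and> Delta (S k) \<le> Delta_max P"
proof (induction k)
  case (Suc k)
  then show ?case
    using step[of k] param_bounds
    by (auto simp: transition_def min_def split: if_splits) 
       (smt (verit) divide_le_eq mult_le_cancel_left1 mult_left_le mult_less_cancel_left2)+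
qed (use start param_bounds in auto)

lemma Delta_pos: "0 < Delta (S k)" and Delta_le_max: "Delta (S k) \<le> Delta_max P"
  using Delta_bounds by auto

lemma Delta_Suc_success: "success k \<Longrightarrow> Delta (S (Suc k)) = min (gamma P * Delta (S k)) (Delta_max P)"
  and Delta_Suc_failure: "\<not> success k \<Longrightarrow> Delta (S (Suc k)) = Delta (S k) / gamma P"
  using step[of k] by (auto simp: transition_def)

lemma Delta_Suc_ge: "Delta (S k) / gamma P \<le> Delta (S (Suc k))"
proof (cases "success k")
  case True
  have "Delta (S k) / gamma P \<le> Delta (S k)"
    using Delta_pos[of k] param_bounds(12) by (simp add: divide_le_eq)
  moreover have "Delta (S k) \<le> gamma P * Delta (S k)"
    using Delta_pos[of k] param_bounds(12) by simp
  ultimately show ?thesis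
    using Delta_Suc_success[OF True] Delta_le_max[of k] by auto
qed (simp add: Delta_Suc_failure)

lemma Delta_ge: "Delta_init P / gamma P ^ k \<le> Delta (S k)"
proof (induction k)
  case (Suc k)
  have "Delta_init P / gamma P ^ Suc k = (Delta_init P / gamma P ^ k) / gamma P" by simp
  also have "\<dots> \<le> Delta (S k) / gamma P" using Suc param_bounds(12) by (intro divide_right_mono) auto
  also have "\<dots> \<le> Delta (S (Suc k))" by (rule Delta_Suc_ge)
  finally show ?case .
qed (simp add: start)

lemma eps_bounds: "0 < eps (S k) \<and> eps (S k) \<le> eps_init P * gamma P ^ k"
proof (induction k)
  case (Suc k)
  have g: "1 < gamma P" by (rule param_bounds)
  have "eps (S (Suc k)) = gamma P * eps (S k) \<or> eps (S (Suc k)) = eps (S k) / gamma P"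
    using step[of k] by (auto simp: transition_def split: if_splits)
  moreover have "eps (S k) / gamma P \<le> gamma P * eps (S k)"
  proof -
    have "eps (S k) / gamma P \<le> eps (S k)" using Suc g by (simp add: divide_le_eq)
    also have "\<dots> \<le> gamma P * eps (S k)" using Suc g by simp
    finally show ?thesis .
  qed
  moreover have "0 < eps (S k) / gamma P" using Suc g by simp
  moreover have "gamma P * eps (S k) \<le> eps_init P * gamma P ^ Suc k"
    using Suc g by (simp add: mult.left_commute)
  ultimately show ?case by linarith
qed (use start param_bounds in auto)

lemma eps_pos: "0 < eps (S k)" using eps_bounds by auto

lemma mu_in_Suc: "mu_in (S (Suc k)) = mu (S k)"
  using step[of k] by (simp add: transition_def)

lemma mu_increasing: "0 < mu_in (S k) \<Longrightarrow> mu_in (S k) \<le> mu (S k)"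
proof -
  assume pos: "0 < mu_in (S k)"
  have "mu (S k) = mu_in (S k) \<or> (\<exists>j. mu (S k) = rho P ^ j * mu_in (S k))"
    using iter_ok[of k] by (auto simp: iteration_ok_def merit_update_ok_def split: if_splits)
  moreover have "1 \<le> rho P ^ j" for j using param_bounds(11) by simp
  ultimately show ?thesis using pos by (metis less_imp_le mult_le_cancel_right1 order.refl not_less)
qed

lemma mu_in_pos: "0 < mu_in (S k)"
  by (induction k) (use start param_bounds mu_increasing in \<open>fastforce simp: mu_in_Suc\<close>)+

lemma mu_ge: "mu_in (S k) \<le> mu (S k)" and mu_pos: "0 < mu (S k)"
  using mu_increasing[OF mu_in_pos] mu_in_pos[of k] by (auto intro: less_le_trans)

lemma mu_mono: "j \<le> k \<Longrightarrow> mu (S j) \<le> mu (S k)"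
proof (rule lift_Suc_mono_le)
  fix n show "mu (S n) \<le> mu (S (Suc n))" using mu_ge[of "Suc n"] by (simp add: mu_in_Suc)
qed

lemma Delta_power_le: "Delta (S k) ^ (alpha P + 2) \<le> max 1 (Delta_max P) * (Delta (S k))\<^sup>2"
proof -
  have "Delta (S k) ^ alpha P \<le> max 1 (Delta_max P)"
    using param_bounds(1) Delta_le_max[of k] by auto
  then show ?thesis
    using Delta_pos[of k] by (simp only: power_add) (intro mult_right_mono, auto)
qed

lemma Delta_power1_le: "Delta (S k) ^ (alpha P + 1) \<le> max 1 (Delta_max P) * Delta (S k)"
proof -
  have "Delta (S k) ^ alpha P \<le> max 1 (Delta_max P)"
    using param_bounds(1) Delta_le_max[of k] by auto
  then show ?thesis
    using Delta_pos[of k] by (simp only: power_add power_one_right) (intro mult_right_mono, auto)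
qed

subsection \<open>Length of the steps\<close>

text \<open>
  The normal and the tangential radius are the legs of a right triangle with hypotenuse
  \<open>Delta\<close>. If their common denominator vanishes, both are zero.
\<close>
lemma norm_dx_le: "norm (dx P c (S k)) \<le> 2 * Delta (S k)"
proof (cases "has_trial P c (S k)")
  case True
  let ?I = "S k"
  have le1: "a / n \<le> 1" if "a \<le> n" "0 \<le> a" for a n :: real
    using that by (cases "n = 0") (auto simp: divide_le_eq_1)
  have scale: "Delta ?I * a / n \<le> Delta ?I" if "a \<le> n" "0 \<le> a" for a n
    using mult_left_mono[OF le1[OF that], of "Delta ?I"] Delta_pos[of k] by simp
  have tau: "0 \<le> tau_RS P ?I"
    using opnorm_nonneg[of "Hbar ?I"] by (simp add: tau_RS_def tau_plus_def)
  have n: "radius_normal P c ?I \<le> Delta ?I"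
    unfolding radius_normal_def
    by (auto intro!: scale simp: norm_Pair intro: real_sqrt_sum_squares_ge1 real_sqrt_sum_squares_ge2)
  have t: "radius_tangential P c ?I \<le> Delta ?I"
    unfolding radius_tangential_def using tau
    by (auto intro!: scale simp: norm_Pair intro: real_sqrt_sum_squares_ge1 real_sqrt_sum_squares_ge2)
  have n0: "0 \<le> radius_normal P c ?I"
    unfolding radius_normal_def using Delta_pos[of k] by auto
  have "norm (w_step P c ?I) \<le> radius_normal P c ?I"
  proof (cases "v_step c ?I = 0")
    case False
    have "norm (w_step P c ?I) = min (radius_normal P c ?I / norm (v_step c ?I)) 1 * norm (v_step c ?I)"
      using n0 by (simp add: w_step_def)
    also have "\<dots> \<le> radius_normal P c ?I / norm (v_step c ?I) * norm (v_step c ?I)"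
      by (intro mult_right_mono) auto
    finally show ?thesis using False by simp
  qed (use n0 in \<open>simp add: w_step_def\<close>)
  moreover have "norm (Zk ?I *v uk ?I) \<le> radius_tangential P c ?I"
  proof -
    have "norm (uk ?I) \<le> radius_tangential P c ?I"
      using iter_ok[of k] True
      by (auto simp: iteration_ok_def gradient_step_ok_def eigen_step_ok_def split: if_splits)
    moreover have "norm (Zk ?I *v uk ?I) \<le> norm (uk ?I)"
      using iter_ok[of k] by (intro norm_kernel_step_le[OF regular_iterate[of k]]) (simp add: iteration_ok_def)
    ultimately show ?thesis by linarith
  qed
  ultimately show ?thesis
    using n t norm_triangle_ineq[of "w_step P c ?I" "Zk ?I *v uk ?I"] True by (simp add: dx_def)
qed (use Delta_pos[of k] in \<open>simp add: dx_def\<close>)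

lemma norm_dx_sq_le: "(norm (dx P c (S k)))\<^sup>2 \<le> 4 * (Delta (S k))\<^sup>2"
  using power_mono[OF norm_dx_le[of k], of 2] by (simp add: power_mult_distrib)

text \<open>
  The correction step solves a linear system whose right-hand side is a Taylor remainder. It is
  of second order in the radius, and the radius is bounded.
\<close>
lemma step_length: "norm (xk (S (Suc k)) - xk (S k)) \<le> step_const * Delta (S k)"
proof -
  let ?I = "S k"
  have base: "2 * Delta ?I \<le> step_const * Delta ?I"
    using L_G_nonneg param_bounds consts_pos Delta_pos[of k]
    by (intro mult_right_mono) (auto simp: step_const_def)
  have cases: "xk (S (Suc k)) = xk ?I \<or>
      has_trial P c ?I \<and> xk (S (Suc k)) = xk ?I + dx P c ?I \<or>
      has_trial P c ?I \<and> xk (S (Suc k)) = xk ?I + dx P c ?I + d_soc P c ?I"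
    using step[of k]
    by (auto simp: transition_def x_trial_def x_trial_soc_def accepted_plain_def accepted_soc_def
        has_soc_def split: if_splits)
  have soc: "norm (dx P c ?I + d_soc P c ?I) \<le> step_const * Delta ?I" if "has_trial P c ?I"
  proof -
    have "norm (c (xk ?I + dx P c ?I) - c (xk ?I) - Jac c (xk ?I) *v dx P c ?I)
        \<le> L_G K * (norm (dx P c ?I))\<^sup>2"
      using c_remainder[OF iterate_dom[of k] x_trial_dom[OF that]] by (simp add: x_trial_def)
    also have "\<dots> \<le> L_G K * (4 * (Delta ?I)\<^sup>2)"
      by (intro mult_left_mono norm_dx_sq_le L_G_nonneg)
    also have "\<dots> \<le> L_G K * (4 * (Delta_max P * Delta ?I))"
      using Delta_pos[of k] Delta_le_max[of k] L_G_nonneg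
      by (intro mult_left_mono) (auto simp: power2_eq_square)
    finally have "norm (d_soc P c ?I) \<le> L_G K * (4 * (Delta_max P * Delta ?I)) / sqrt (kappa_1G K)"
      using norm_correction_le[OF regular_iterate, of k] consts_pos
      by (simp add: d_soc_def) (meson divide_right_mono order_trans real_sqrt_ge_zero less_imp_le)
    then show ?thesis
      using norm_dx_le[of k] norm_triangle_ineq[of "dx P c ?I" "d_soc P c ?I"]
      by (simp add: step_const_def algebra_simps)
  qed
  show ?thesis
    using cases base soc norm_dx_le[of k] Delta_pos[of k]
    by (elim disjE) (auto simp: add.assoc intro: order_trans)
qed

lemma residual_step:
  "kkt_residual f c (xk (S (Suc k))) \<le> kkt_residual f c (xk (S k)) + residual_const * Delta (S k)"
proof -
  let ?n = "norm (xk (S (Suc k)) - xk (S k))"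
  have "?n\<^sup>2 \<le> (step_const * Delta (S k))\<^sup>2" by (intro power_mono step_length) simp
  also have "\<dots> = step_const\<^sup>2 * (Delta (S k) * Delta (S k))"
    by (simp add: power2_eq_square)
  also have "\<dots> \<le> step_const\<^sup>2 * (Delta_max P * Delta (S k))"
    using Delta_pos[of k] Delta_le_max[of k] by (intro mult_left_mono mult_right_mono) auto
  finally have "L_G K * ?n\<^sup>2 \<le> L_G K * (step_const\<^sup>2 * (Delta_max P * Delta (S k)))"
    by (intro mult_left_mono L_G_nonneg)
  moreover have "res_lip * ?n \<le> res_lip * (step_const * Delta (S k))"
    by (intro mult_left_mono step_length res_lip_nonneg)
  ultimately show ?thesis
    using kkt_residual_le[OF regular_iterate regular_iterate, of "Suc k" k]
    by (simp add: residual_const_def algebra_simps)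
qed

section \<open>Predicted and actual reduction\<close>

lemma trial_pred: 
  assumes "has_trial P c (S k)"
  shows "Pred P c (S k) \<le> - (kappa_fcd P / 2) * max (first_order_term c (S k)) (second_order_term P c (S k))"
    and "Hbar (S k) \<noteq> 0"
  using iter_ok[of k] assms
  by (auto simp: iteration_ok_def merit_update_ok_def pred_sufficient_def Pred_def)

text \<open>
  Whichever of the two criteria triggers the trial step, the corresponding reduction term is
  at least of the order that enters the Lyapunov function.
\<close>
lemma pred_power_bound:
  assumes trial: "has_trial P c (S k)"
  shows "pred_coef * Delta (S k) ^ (alpha P + 2) \<le> - Pred P c (S k)"
proof -
  let ?I = "S k" and ?D = "Delta (S k)" and ?M = "max 1 (Delta_max P)"
  have e: "0 < eta P" "eta P < 1" and kf: "0 < kappa_fcd P" using param_bounds by auto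
  have D: "0 < ?D" "?D \<le> Delta_max P" by (rule Delta_pos Delta_le_max)+
  have key: "(eta P)\<^sup>2 * ?D ^ (alpha P + 2) \<le> ?M * max (first_order_term c ?I) (second_order_term P c ?I)"
  proof (cases "eta P * ?D \<le> norm (Lbar c ?I) / max 1 (opnorm (Hbar ?I))")
    case True
    let ?L = "norm (Lbar c ?I)" and ?H = "opnorm (Hbar ?I)"
    have H: "0 < ?H"
      using trial_pred(2)[OF trial] opnorm_nonneg[of "Hbar ?I"] opnorm_eq_0_iff[of "Hbar ?I"] by linarith
    have "eta P * ?D * max 1 ?H \<le> ?L" using True by (simp add: pos_le_divide_eq)
    moreover have "eta P * ?D * 1 \<le> eta P * ?D * max 1 ?H" "eta P * ?D * ?H \<le> eta P * ?D * max 1 ?H"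
      using e D by (intro mult_left_mono; simp)+
    ultimately have L: "eta P * ?D \<le> ?L" "eta P * ?D \<le> ?L / ?H"
      using H by (auto simp: pos_le_divide_eq)
    have "eta P * ?D \<le> ?D" using e D by simp
    then have "(eta P * ?D) * (eta P * ?D) \<le> ?L * min ?D (?L / ?H)"
      using L e D by (intro mult_mono) auto
    then have fo: "(eta P)\<^sup>2 * ?D\<^sup>2 \<le> first_order_term c ?I"
      by (simp add: first_order_term_def power2_eq_square mult_ac)
    have "(eta P)\<^sup>2 * ?D ^ (alpha P + 2) \<le> (eta P)\<^sup>2 * (?M * ?D\<^sup>2)"
      by (intro mult_left_mono Delta_power_le) simp
    also have "\<dots> = ?M * ((eta P)\<^sup>2 * ?D\<^sup>2)" by simp
    also have "\<dots> \<le> ?M * max (first_order_term c ?I) (second_order_term P c ?I)"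
      using fo by (intro mult_left_mono) auto
    finally show ?thesis .
  next
    case False
    then have tau: "eta P * ?D \<le> tau_plus P ?I" using trial by (auto simp: has_trial_def)
    moreover have "0 < eta P * ?D" using e D by simp
    ultimately have a: "alpha P = 1"
      using param_bounds(1) by (auto simp: tau_plus_def)
    have "(eta P)\<^sup>2 * ?D ^ 3 \<le> eta P * ?D ^ 3"
      using e D by (intro mult_right_mono) (auto simp: power2_eq_square)
    also have "\<dots> = (eta P * ?D) * ?D * ?D" by (simp add: power3_eq_cube)
    also have "\<dots> \<le> tau_plus P ?I * ?D * (?D + norm (c (xk ?I)))"
      using tau e D by (intro mult_mono) (auto simp: tau_plus_def)
    also have "\<dots> \<le> max (first_order_term c ?I) (second_order_term P c ?I)"
      by (simp add: second_order_term_def)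
    finally have 1: "(eta P)\<^sup>2 * ?D ^ 3 \<le> max (first_order_term c ?I) (second_order_term P c ?I)" .
    moreover have "0 \<le> (eta P)\<^sup>2 * ?D ^ 3" using D by simp
    ultimately have "1 * max (first_order_term c ?I) (second_order_term P c ?I)
        \<le> ?M * max (first_order_term c ?I) (second_order_term P c ?I)"
      by (intro mult_right_mono) auto
    moreover have "alpha P + 2 = 3" using a by simp
    ultimately show ?thesis using order_trans[OF 1] by (simp only: mult_1)
  qed
  have "pred_coef * ?D ^ (alpha P + 2) = (kappa_fcd P / 2) * ((eta P)\<^sup>2 * ?D ^ (alpha P + 2) / ?M)"
    by (simp add: pred_coef_def)
  also have "\<dots> \<le> (kappa_fcd P / 2) * max (first_order_term c ?I) (second_order_term P c ?I)"
    using key kf by (intro mult_left_mono) (auto simp: pos_divide_le_eq mult.commute)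
  finally show ?thesis using trial_pred(1)[OF trial] by simp
qed

lemma pred_neg: "has_trial P c (S k) \<Longrightarrow> Pred P c (S k) < 0"
  using pred_power_bound[of k] pred_coef_pos Delta_pos[of k]
  by (smt (verit) mult_pos_pos zero_less_power)

lemma success_trial: "success k \<Longrightarrow> has_trial P c (S k)"
  by (auto simp: accepted_plain_def accepted_soc_def has_soc_def)

lemma error_small:
  assumes "has_trial P c (S k)"
  shows "2 * (kappa_f P * Delta (S k) ^ (alpha P + 2)) \<le> eta P / 4 * - Pred P c (S k)"
proof -
  let ?q = "Delta (S k) ^ (alpha P + 2)"
  have q: "0 \<le> ?q" using Delta_pos[of k] by simp
  have "2 * kappa_f P \<le> eta P / 4 * pred_coef"
    using param_bounds(10) by (simp add: pred_coef_def power3_eq_cube power2_eq_square field_simps)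
  then have "2 * kappa_f P * ?q \<le> eta P / 4 * pred_coef * ?q" using q by (rule mult_right_mono)
  also have "\<dots> \<le> eta P / 4 * - Pred P c (S k)"
    unfolding mult.assoc using param_bounds by (intro mult_left_mono pred_power_bound assms) auto
  finally show ?thesis by simp
qed

text \<open>
  Acceptance compares estimates. Replacing them by true values costs at most a quarter of the
  guaranteed reduction if the estimates are accurate.
\<close>
lemma merit_decrease:
  assumes s: "success k"
  defines "x' \<equiv> xk (S (Suc k))"
  shows "f x' - f (xk (S k)) + mu (S k) * (norm (c x') - norm (c (xk (S k))))
    \<le> 3 * eta P / 4 * Pred P c (S k) + excess_error (S k)"
proof -
  let ?I = "S k"
  have t: "has_trial P c ?I" by (rule success_trial[OF s])
  have pn: "Pred P c ?I < 0" by (rule pred_neg[OF t])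
  have es: "2 * (kappa_f P * Delta ?I ^ (alpha P + 2)) \<le> eta P / 4 * - Pred P c ?I"
    by (rule error_small[OF t])
  have ef: "\<bar>fbar ?I - f (xk ?I)\<bar> = err_f P c f ?I" using t by (simp add: err_f_def)
  show ?thesis
  proof (cases "accepted_plain P c ?I")
    case True
    have x': "x' = x_trial P c ?I" using step[of k] True by (simp add: transition_def x'_def)
    have "Ared P c ?I \<le> eta P * Pred P c ?I"
      using True pn by (simp add: accepted_plain_def neg_le_divide_eq)
    moreover have "\<bar>fbar_s ?I - f x'\<bar> = err_s P c f ?I" using t x' by (simp add: err_s_def)
    moreover have "err_f P c f ?I + err_s P c f ?I \<le> eta P / 4 * - Pred P c ?I + excess_error (S k)"
      using es t pn param_bounds(2) err_nonneg[of ?I] mult_pos_neg[OF param_bounds(2) pn]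
      by (auto simp: excess_error_def acc_C_def)
    ultimately show ?thesis using ef unfolding Ared_def x' by argo
  next
    case False
    then have soc: "accepted_soc P c ?I" using s by simp
    have x': "x' = x_trial_soc P c ?I" using step[of k] soc False by (simp add: transition_def x'_def)
    have "Ared_soc P c ?I \<le> eta P * Pred P c ?I"
      using soc pn by (simp add: accepted_soc_def neg_le_divide_eq)
    moreover have hs: "has_soc P c ?I" using soc by (simp add: accepted_soc_def)
    moreover have "\<bar>fbar_soc ?I - f x'\<bar> = err_soc P c f ?I" using hs x' by (simp add: err_soc_def)
    moreover have "err_f P c f ?I + err_soc P c f ?I \<le> eta P / 4 * - Pred P c ?I + excess_error (S k)"
      using es hs pn param_bounds(2) err_nonneg[of ?I] mult_pos_neg[OF param_bounds(2) pn]
      by (auto simp: excess_error_def acc_C'_def)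
    ultimately show ?thesis using ef unfolding Ared_soc_def x' by argo
  qed
qed

section \<open>The Lyapunov function\<close>

lemma lyap_nonneg: "0 \<le> lyap (S k)"
  using f_lower[OF iterate_dom[of k]] mu_in_pos[of k] Delta_pos[of k] eps_pos[of k] nu01
  by (simp add: lyap_def)

text \<open>
  An unsuccessful iteration shrinks both the radius and \<open>eps\<close>. Up to the excess error and
  the growth of the merit parameter, a successful one releases \<open>3 / 4\<close> of \<open>\<nu> \<eta>\<close> times the
  predicted reduction: one half pays for the growth of \<open>eps\<close>, which happens only if the
  predicted reduction is at least \<open>eps\<close>, one eighth for the growth of the radius, and one
  eighth remains as a gain.
\<close>
lemma lyapunov_decrease:
  "lyap (S (Suc k)) + (1 - \<nu>) * (1 - 1 / gamma P) * eps (S k)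
     + (1 - \<nu>) / 4 * (1 - 1 / gamma P) * Delta (S k) ^ (alpha P + 2)
     + (if success k then \<nu> * eta P / 8 * - Pred P c (S k) else 0)
   \<le> lyap (S k) + \<nu> * excess_error (S k) + \<nu> * kappa_c K * (mu (S k) - mu_in (S k))"
proof -
  let ?I = "S k" and ?I' = "S (Suc k)"
  define n where "n = alpha P + 2"
  define D where "D = Delta ?I ^ n"
  define e where "e = eps ?I"
  define g where "g = gamma P"
  define h where "h = 1 - 1 / g"
  define q where "q = (1 - \<nu>) / 4"
  define p where "p = - Pred P c ?I"
  have g: "1 < g" using param_bounds by (simp add: g_def)
  then have gi: "1 / g < 1" "0 < 1 / g" by auto
  have D: "0 < D" using Delta_pos[of k] by (simp add: D_def)
  have e: "0 < e" using eps_pos by (simp add: e_def)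
  have "(mu ?I - mu_in ?I) * norm (c (xk ?I)) \<le> (mu ?I - mu_in ?I) * kappa_c K"
    using mu_ge[of k] regular_iterate[of k] by (intro mult_left_mono) (auto simp: regular_points_def)
  then have mu: "\<nu> * ((mu ?I - mu_in ?I) * norm (c (xk ?I))) \<le> \<nu> * kappa_c K * (mu ?I - mu_in ?I)"
    using nu01 by (simp add: mult_ac)
  show ?thesis
  proof (cases "success k")
    case False
    then have next_state: "xk ?I' = xk ?I" "Delta ?I' = Delta ?I / g" "eps ?I' = e / g"
      using step[of k] by (auto simp: transition_def g_def e_def)
    have "Delta ?I' ^ n = D / g ^ n" by (simp add: next_state D_def power_divide)
    also have "\<dots> \<le> D / g"
    proof -
      have "g ^ 1 \<le> g ^ n" using g by (intro power_increasing) (auto simp: n_def)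
      then show ?thesis using g D by (intro divide_left_mono) auto
    qed
    finally have radius: "Delta ?I' ^ n + h * D \<le> D" by (simp add: h_def algebra_simps)
    have "q * (Delta ?I' ^ n + h * D) \<le> q * D"
      using radius nu01 by (intro mult_left_mono) (auto simp: q_def)
    moreover have "e / g = e - h * e" by (simp add: h_def algebra_simps)
    moreover have "0 \<le> \<nu> * excess_error (S k)" using nu01 excess_error_nonneg[of "S k"] by simp
    ultimately show ?thesis
      using mu False unfolding lyap_def mu_in_Suc next_state(1,3)
      by (simp only: if_False n_def[symmetric] D_def[symmetric] e_def[symmetric] g_def[symmetric]
            h_def[symmetric] q_def[symmetric])
        (simp add: algebra_simps)
  next
    case True
    have t: "has_trial P c ?I" by (rule success_trial[OF True])
    have p: "0 < p" and pD: "pred_coef * D \<le> p"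
      using pred_neg[OF t] pred_power_bound[OF t] by (auto simp: p_def D_def n_def)
    have merit: "f (xk ?I') - f (xk ?I) + mu ?I * (norm (c (xk ?I')) - norm (c (xk ?I)))
        \<le> - (3 * eta P / 4 * p) + excess_error (S k)"
      using merit_decrease[OF True] by (simp add: p_def)
    have "Delta ?I' ^ n \<le> (g * Delta ?I) ^ n"
      using Delta_Suc_success[OF True] Delta_pos[of "Suc k"] by (intro power_mono) (auto simp: g_def)
    also have "\<dots> = g ^ n * D" by (simp add: power_mult_distrib D_def)
    also have "\<dots> \<le> g ^ 3 * D"
      using g D param_bounds(1) by (intro mult_right_mono power_increasing) (auto simp: n_def)
    finally have D': "Delta ?I' ^ n \<le> g ^ 3 * D" .
    have "2 * g ^ 3 * (1 - \<nu>) \<le> \<nu> * eta P * pred_coef"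
      using nu_radius
      by (simp add: pred_coef_def g_def power2_eq_square power3_eq_cube field_simps)
    then have "2 * g ^ 3 * (1 - \<nu>) * D \<le> \<nu> * eta P * pred_coef * D"
      using D by (intro mult_right_mono) auto
    also have "\<dots> \<le> \<nu> * eta P * p"
      unfolding mult.assoc using pD nu01 param_bounds by (intro mult_left_mono) auto
    finally have radius: "(1 - \<nu>) * (g ^ 3 * D) \<le> \<nu> * eta P / 2 * p" by (simp add: mult_ac)
    have q: "0 < q" using nu01 by (simp add: q_def)
    have "q * (Delta ?I' ^ n + h * D) \<le> q * (g ^ 3 * D + 1 * D)"
      using D' g D q gi by (intro mult_left_mono add_mono mult_right_mono) (auto simp: h_def)
    also have "\<dots> = (1 - \<nu>) * (g ^ 3 * D) / 4 + q * D" by (simp add: q_def algebra_simps)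
    also have "\<dots> \<le> q * D + \<nu> * eta P / 8 * p" using radius by (simp add: mult_ac)
    finally have part_radius: "q * (Delta ?I' ^ n + h * D) \<le> q * D + \<nu> * eta P / 8 * p" .
    have part_eps: "(1 - \<nu>) * (eps ?I' + h * e) \<le> (1 - \<nu>) * e + \<nu> * eta P / 2 * p"
    proof (cases "e \<le> p")
      case True
      have "eps ?I' = g * e" using step[of k] \<open>success k\<close> True
        by (auto simp: transition_def g_def e_def p_def)
      then have "eps ?I' + h * e \<le> g * e + e" using e gi by (simp add: h_def algebra_simps)
      also have "g * e \<le> g * p" using True g by simp
      finally have "(1 - \<nu>) * (eps ?I' + h * e) \<le> (1 - \<nu>) * (g * p + e)"
        using nu01 by (intro mult_left_mono) auto
      moreover have "2 * g * (1 - \<nu>) * p \<le> \<nu> * eta P * p"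
        using nu_eps p by (intro mult_right_mono) (auto simp: g_def)
      ultimately show ?thesis by (simp add: algebra_simps)
    next
      case False
      have "eps ?I' = e / g" using step[of k] \<open>success k\<close> False
        by (auto simp: transition_def g_def e_def p_def)
      then have "eps ?I' + h * e = e" by (simp add: h_def algebra_simps)
      moreover have "0 \<le> \<nu> * eta P / 2 * p" using nu01 param_bounds p by simp
      ultimately show ?thesis by simp
    qed
    have "\<nu> * (f (xk ?I') - f (xk ?I) + mu ?I * (norm (c (xk ?I')) - norm (c (xk ?I))))
        \<le> \<nu> * (- (3 * eta P / 4 * p) + excess_error (S k))"
      using merit nu01 by (intro mult_left_mono) auto
    then show ?thesis
      using part_radius part_eps mu True
      unfolding lyap_def mu_in_Suc
      by (simp only: if_True n_def[symmetric] D_def[symmetric] e_def[symmetric] g_def[symmetric]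
            h_def[symmetric] q_def[symmetric] p_def[symmetric])
        (simp add: algebra_simps)
  qed
qed

section \<open>Acceptance of accurate steps\<close>

lemma grad_error_le:
  assumes "acc_B P f (S k)"
  shows "norm (gbar (S k) - grad f (xk (S k))) \<le> grad_err * Delta (S k)"
proof -
  have "norm (gbar (S k) - grad f (xk (S k))) \<le> kappa_g P * Delta (S k) ^ (alpha P + 1)"
    using assms by (simp add: acc_B_def)
  also have "\<dots> \<le> kappa_g P * (max 1 (Delta_max P) * Delta (S k))"
    using param_bounds by (intro mult_left_mono Delta_power1_le) auto
  finally show ?thesis by (simp add: grad_err_def mult.assoc)
qed

text \<open>
  For \<open>\<alpha> = 1\<close> the Lipschitz constants of the first derivatives bound the second derivatives
  of which the true Lagrangian Hessian consists, and accuracy bounds the estimated multipliers.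
\<close>
lemma opnorm_Hbar_le:
  assumes A: "acc_A P f (S k)" and B: "acc_B P f (S k)"
  shows "opnorm (Hbar (S k)) \<le> hess_bound"
proof (cases "alpha P = 0")
  case True
  then have "opnorm (Hbar (S k)) \<le> kappa_B K"
    using iterates by (simp add: iterates_regular_def)
  then show ?thesis using True by (simp add: hess_bound_def)
next
  case False
  then have a: "alpha P = 1" using param_bounds(1) by simp
  let ?I = "S k" and ?hc = "\<lambda>i. hess (\<lambda>y. c y $ i) (xk (S k))"
  let ?b = "(kappa_grad K + grad_err * Delta_max P) / sqrt (kappa_1G K)"
  have H: "Hbar ?I = (hessbar ?I - hess f (xk ?I)) + hess f (xk ?I)
      + (\<Sum>i\<in>UNIV. lambdabar c ?I $ i *\<^sub>R ?hc i)"
    using iter_ok[of k] a by (simp add: iteration_ok_def)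
  have "norm (gbar ?I) \<le> norm (grad f (xk ?I)) + norm (gbar ?I - grad f (xk ?I))"
    using norm_triangle_ineq[of "grad f (xk ?I)" "gbar ?I - grad f (xk ?I)"] by simp
  also have "\<dots> \<le> kappa_grad K + grad_err * Delta_max P"
    using regular_iterate[of k] grad_error_le[OF B]
      mult_left_mono[OF Delta_le_max[of k] less_imp_le[OF grad_err_pos]]
    by (auto simp: regular_points_def)
  finally have "norm (lambdabar c ?I) \<le> ?b"
    using norm_multipliers_le[OF regular_iterate, of k "gbar ?I"] consts_pos
    by (simp add: lambdabar_def) (meson divide_right_mono order_trans real_sqrt_ge_zero less_imp_le)
  then have lam: "\<bar>lambdabar c ?I $ i\<bar> \<le> ?b" for i
    using component_le_norm_cart[of "lambdabar c ?I" i] by linarith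
  have "opnorm (lambdabar c ?I $ i *\<^sub>R ?hc i) \<le> ?b * L_G K" for i
  proof -
    have "opnorm (lambdabar c ?I $ i *\<^sub>R ?hc i) \<le> \<bar>lambdabar c ?I $ i\<bar> * opnorm (?hc i)"
      by (rule opnorm_scaleR_le)
    also have "\<dots> \<le> ?b * L_G K"
      using lam[of i] by (intro mult_mono opnorm_hess_c_le iterate_dom opnorm_nonneg) auto
    finally show ?thesis .
  qed
  then have "(\<Sum>i\<in>UNIV. opnorm (lambdabar c ?I $ i *\<^sub>R ?hc i)) \<le> real CARD('m) * (?b * L_G K)"
    by (rule sum_bounded_above)
  then have s: "opnorm (\<Sum>i\<in>UNIV. lambdabar c ?I $ i *\<^sub>R ?hc i) \<le> real CARD('m) * (?b * L_G K)"
    using opnorm_sum_le[of UNIV "\<lambda>i. lambdabar c ?I $ i *\<^sub>R ?hc i"] by simp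
  have "opnorm (hessbar ?I - hess f (xk ?I)) \<le> kappa_h P * Delta ?I"
    using A a by (simp add: acc_A_def)
  also have "\<dots> \<le> kappa_h P * Delta_max P"
    using param_bounds Delta_le_max[of k] by (intro mult_left_mono) auto
  finally have "opnorm (Hbar ?I) \<le> kappa_h P * Delta_max P + L_grad K + real CARD('m) * (?b * L_G K)"
    using s opnorm_hess_f_le[OF iterate_dom[of k]] unfolding H
    by (smt (verit) opnorm_add_le)
  then show ?thesis using False by (simp add: hess_bound_def mult.assoc)
qed

text \<open>
  Away from stationarity the predicted reduction is linear in the radius, whereas its error is
  quadratic. Hence an accurate iteration with a small radius is accepted.
\<close>
lemma accurate_step_accepted:
  assumes mu: "mu (S k) \<le> \<mu>" and e: "0 < e" "e \<le> kkt_residual f c (xk (S k))"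
    and small: "Delta (S k) \<le> radius_threshold \<mu> e"
    and acc: "acc_A P f (S k)" "acc_B P f (S k)" "acc_C P c f (S k)"
  shows "accepted_plain P c (S k)" "kappa_fcd P * e / 4 * Delta (S k) \<le> - Pred P c (S k)"
proof -
  let ?I = "S k"
  define D L H dx' x p where "D = Delta ?I" and "L = norm (Lbar c ?I)" and "H = opnorm (Hbar ?I)"
    and "dx' = dx P c ?I" and "x = xk ?I" and "p = - Pred P c ?I"
  have mu0: "0 \<le> \<mu>" using mu mu_pos[of k] by linarith
  have D: "0 < D" using Delta_pos by (simp add: D_def)
  have D1: "D \<le> e / (2 * grad_err)" and D2: "D \<le> e / (2 * hess_bound)"
    and D3: "D \<le> (1 - eta P) * kappa_fcd P * e / (4 * model_err \<mu>)"
    using small by (auto simp: radius_threshold_def D_def)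
  have kf: "0 < kappa_fcd P" by (rule param_bounds)
  have hb: "1 \<le> hess_bound" by (rule hess_bound_ge)
  have H: "H \<le> hess_bound" "0 \<le> H" using opnorm_Hbar_le[OF acc(1,2)] opnorm_nonneg by (auto simp: H_def)
  have gerr: "norm (gbar ?I - grad f x) \<le> grad_err * D"
    using grad_error_le[OF acc(2)] by (simp add: D_def x_def)
  have "e \<le> L + norm (grad f x - gbar ?I)"
    using e(2) grad_lagr_gradient_error[OF regular_iterate, of k "grad f x" "gbar ?I"]
    by (simp add: kkt_residual_def L_def Lbar_def x_def)
  moreover have "grad_err * D \<le> e / 2"
    using D1 grad_err_pos by (simp add: field_simps)
  ultimately have L: "e / 2 \<le> L" using gerr by (simp add: norm_minus_commute)
  have De: "D * hess_bound \<le> e / 2" using D2 hb by (simp add: field_simps)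
  have trial: "has_trial P c ?I"
  proof -
    have "eta P * D * max 1 H \<le> 1 * D * hess_bound"
      using param_bounds D H hb by (intro mult_mono) auto
    then have "eta P * D * max 1 H \<le> L" using De L by simp
    then have "eta P * D \<le> L / max 1 H" by (simp add: pos_le_divide_eq)
    then show ?thesis by (simp add: has_trial_def D_def L_def H_def le_max_iff_disj)
  qed
  have Hpos: "0 < H"
    using trial_pred(2)[OF trial] H(2) opnorm_eq_0_iff[of "Hbar ?I"] by (simp add: H_def)
  have "D * H \<le> D * hess_bound" using D H by (intro mult_left_mono) auto
  then have DH: "D \<le> L / H" using De L Hpos by (simp add: pos_le_divide_eq)
  have "e / 2 * D \<le> L * D" using L D by (intro mult_right_mono) auto
  also have "\<dots> = first_order_term c ?I"
    using DH by (simp add: first_order_term_def L_def D_def H_def)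
  finally have "kappa_fcd P / 2 * (e / 2 * D) \<le> kappa_fcd P / 2 * max (first_order_term c ?I) (second_order_term P c ?I)"
    using kf by (intro mult_left_mono) auto
  then have p: "kappa_fcd P * e / 4 * D \<le> p" using trial_pred(1)[OF trial] by (simp add: p_def mult_ac)
  then show "kappa_fcd P * e / 4 * Delta ?I \<le> - Pred P c ?I" by (simp add: p_def D_def)
  have xs: "x_trial P c ?I = x + dx'" by (simp add: x_trial_def x_def dx'_def)
  have dom: "x \<in> \<Omega>" "x + dx' \<in> \<Omega>"
    using iterate_dom x_trial_dom[OF trial] xs by (auto simp: x_def)
  have n: "norm dx' \<le> 2 * D" and n2: "(norm dx')\<^sup>2 \<le> 4 * D\<^sup>2"
    using norm_dx_le norm_dx_sq_le by (auto simp: dx'_def D_def)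
  define a1 where "a1 = f (x + dx') - f x - grad f x \<bullet> dx'"
  define a2 where "a2 = (grad f x - gbar ?I) \<bullet> dx'"
  define a3 where "a3 = dx' \<bullet> (Hbar ?I *v dx')"
  define a4 where "a4 = norm (c (x + dx')) - norm (c x + Jac c x *v dx')"
  have diff: "Ared P c ?I - Pred P c ?I =
      (fbar_s ?I - f (x + dx')) - (fbar ?I - f x) + a1 + a2 - a3 / 2 + mu ?I * a4"
    unfolding a1_def a2_def a3_def a4_def
    by (simp add: Ared_def Pred_def pred_at_def xs inner_diff_left algebra_simps flip: x_def dx'_def)
  have b0: "\<bar>fbar_s ?I - f (x + dx')\<bar> \<le> kappa_f P * (max 1 (Delta_max P) * D\<^sup>2)"
    "\<bar>fbar ?I - f x\<bar> \<le> kappa_f P * (max 1 (Delta_max P) * D\<^sup>2)"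
  proof -
    have "kappa_f P * D ^ (alpha P + 2) \<le> kappa_f P * (max 1 (Delta_max P) * D\<^sup>2)"
      unfolding D_def using param_bounds by (intro mult_left_mono Delta_power_le) auto
    then show "\<bar>fbar_s ?I - f (x + dx')\<bar> \<le> kappa_f P * (max 1 (Delta_max P) * D\<^sup>2)"
      "\<bar>fbar ?I - f x\<bar> \<le> kappa_f P * (max 1 (Delta_max P) * D\<^sup>2)"
      using acc(3) trial by (auto simp: acc_C_def err_f_def err_s_def D_def x_def xs[unfolded x_def])
  qed
  have "\<bar>a1\<bar> \<le> L_grad K * (norm dx')\<^sup>2"
    using f_remainder[OF dom] by (simp add: a1_def)
  also have "\<dots> \<le> L_grad K * (4 * D\<^sup>2)" using n2 L_grad_nonneg by (rule mult_left_mono)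
  finally have b1: "\<bar>a1\<bar> \<le> L_grad K * (4 * D\<^sup>2)" .
  have "\<bar>a2\<bar> \<le> norm (grad f x - gbar ?I) * norm dx'" unfolding a2_def by (rule Cauchy_Schwarz_ineq2)
  also have "\<dots> \<le> (grad_err * D) * (2 * D)"
    using gerr n D grad_err_pos by (intro mult_mono) (auto simp: norm_minus_commute)
  finally have b2: "\<bar>a2\<bar> \<le> grad_err * (2 * D\<^sup>2)" by (simp add: power2_eq_square mult_ac)
  have "\<bar>a3\<bar> \<le> norm dx' * norm (Hbar ?I *v dx')" unfolding a3_def by (rule Cauchy_Schwarz_ineq2)
  also have "\<dots> \<le> norm dx' * (H * norm dx')"
    unfolding H_def by (intro mult_left_mono opnorm_bound) auto
  also have "\<dots> = H * (norm dx')\<^sup>2" by (simp add: power2_eq_square)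
  also have "\<dots> \<le> hess_bound * (4 * D\<^sup>2)" using H n2 by (intro mult_mono) auto
  finally have b3: "\<bar>a3\<bar> \<le> hess_bound * (4 * D\<^sup>2)" .
  have "\<bar>a4\<bar> \<le> norm (c (x + dx') - (c x + Jac c x *v dx'))" unfolding a4_def by (rule norm_triangle_ineq3)
  also have "\<dots> \<le> L_G K * (norm dx')\<^sup>2"
    using c_remainder[OF dom] by (simp add: algebra_simps)
  also have "\<dots> \<le> L_G K * (4 * D\<^sup>2)" using n2 L_G_nonneg by (rule mult_left_mono)
  finally have "\<bar>mu ?I * a4\<bar> \<le> \<mu> * (L_G K * (4 * D\<^sup>2))"
    using mu mu_pos[of k] mu0 by (simp add: abs_mult mult_mono)
  with b0 b1 b2 b3 have "Ared P c ?I - Pred P c ?I \<le> model_err \<mu> * D\<^sup>2"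
    unfolding diff model_err_def by (simp add: algebra_simps)
  also have "\<dots> = model_err \<mu> * D * D" by (simp add: power2_eq_square)
  also have "\<dots> \<le> ((1 - eta P) * kappa_fcd P * e / 4) * D"
    using D3 model_err_pos[OF mu0] D by (intro mult_right_mono) (auto simp: field_simps)
  also have "\<dots> = (1 - eta P) * (kappa_fcd P * e / 4 * D)" by simp
  also have "\<dots> \<le> (1 - eta P) * p" using p param_bounds by (intro mult_left_mono) auto
  finally have "Ared P c ?I \<le> eta P * Pred P c ?I" by (simp add: p_def algebra_simps)
  then show "accepted_plain P c ?I"
    using pred_neg[OF trial] trial by (simp add: accepted_plain_def neg_le_divide_eq)
qed

lemma accurate_step_expands:
  assumes mu: "mu (S k) \<le> \<mu>" and e: "0 < e" "e \<le> kkt_residual f c (xk (S k))"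
    and small: "Delta (S k) \<le> radius_threshold \<mu> e"
    and acc: "acc_A P f (S k)" "acc_B P f (S k)" "acc_C P c f (S k)"
  shows "Delta (S (Suc k)) = gamma P * Delta (S k)"
proof -
  have "Delta (S k) \<le> Delta_max P / gamma P" using small by (simp add: radius_threshold_def)
  then have "gamma P * Delta (S k) \<le> Delta_max P"
    using param_bounds(12) by (simp add: pos_le_divide_eq mult.commute)
  then show ?thesis
    using Delta_Suc_success accurate_step_accepted(1)[OF assms] by auto
qed

end

section \<open>Conditional accuracy in expectation\<close>

lemma cond_prob_complement_le:
  fixes Y :: "'w \<Rightarrow> real"
  assumes M: "prob_space M" and sub: "subalgebra M \<G>" and Q: "cond_prob_ge M \<G> Q (1 - p)"
    and Y: "Y \<in> borel_measurable \<G>" and bd: "\<And>\<omega>. \<omega> \<in> space M \<Longrightarrow> 0 \<le> Y \<omega> \<and> Y \<omega> \<le> B"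
  shows "(LINT \<omega>|M. Y \<omega> * indicator {\<omega> \<in> space M. \<not> Q \<omega>} \<omega>) \<le> p * (LINT \<omega>|M. Y \<omega>)"
proof -
  interpret prob_space M by (rule M)
  interpret finite_measure_subalgebra M \<G> by unfold_locales (rule sub)
  let ?A = "{\<omega> \<in> space M. Q \<omega>}"
  have A: "?A \<in> sets M" using Q by (simp add: cond_prob_ge_def)
  have YM[measurable]: "Y \<in> borel_measurable M" by (rule measurable_from_subalg[OF sub Y])
  have iY: "integrable M Y"
    by (rule integrable_const_bound[of _ B]) (use bd in auto)
  have iYA: "integrable M (\<lambda>\<omega>. Y \<omega> * indicator ?A \<omega>)"
    using integrable_mult_indicator[OF A iY] by (simp add: mult.commute)
  note ce = real_cond_exp_intg[OF iYA Y borel_measurable_indicator[OF A]]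
  have "(1 - p) * (LINT \<omega>|M. Y \<omega>) = (LINT \<omega>|M. Y \<omega> * (1 - p))" by simp
  also have "\<dots> \<le> (LINT \<omega>|M. Y \<omega> * real_cond_exp M \<G> (indicator ?A) \<omega>)"
  proof (rule integral_mono_AE)
    show "integrable M (\<lambda>\<omega>. Y \<omega> * (1 - p))" using iY by simp
    show "AE \<omega> in M. Y \<omega> * (1 - p) \<le> Y \<omega> * real_cond_exp M \<G> (indicator ?A) \<omega>"
    proof -
      have "AE \<omega> in M. 1 - p \<le> real_cond_exp M \<G> (indicator ?A) \<omega>"
        using Q by (simp add: cond_prob_ge_def)
      then show ?thesis
        using AE_space by eventually_elim (use bd in \<open>auto intro!: mult_left_mono\<close>)
    qed
  qed (rule ce(1))
  also have "\<dots> = (LINT \<omega>|M. Y \<omega> * indicator ?A \<omega>)" by (rule ce(2))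
  finally have lower: "(1 - p) * (LINT \<omega>|M. Y \<omega>) \<le> (LINT \<omega>|M. Y \<omega> * indicator ?A \<omega>)" .
  have "(LINT \<omega>|M. Y \<omega> * indicator {\<omega> \<in> space M. \<not> Q \<omega>} \<omega>)
      = (LINT \<omega>|M. Y \<omega> - Y \<omega> * indicator ?A \<omega>)"
    by (rule Bochner_Integration.integral_cong) (auto simp: indicator_def)
  also have "\<dots> = (LINT \<omega>|M. Y \<omega>) - (LINT \<omega>|M. Y \<omega> * indicator ?A \<omega>)"
    by (rule Bochner_Integration.integral_diff[OF iY iYA])
  finally show ?thesis using lower by (simp add: algebra_simps)
qed

text \<open>
  A conditional Cauchy--Schwarz inequality. On the exceptional event the error is split by
  Young's inequality \<open>X \<le> t e / 2 + X\<^sup>2 / (2 t e)\<close> with \<open>t = 1 / sqrt p\<close>; the first term is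
  controlled by the conditional probability, the second by the conditional second moment.
\<close>
lemma cond_error_expectation:
  fixes X e :: "'w \<Rightarrow> real"
  assumes M: "prob_space M" and sub: "subalgebra M \<G>"
    and Q: "cond_prob_ge M \<G> Q (1 - p)" and p: "0 < p"
    and X: "cond_sq_le M \<G> X e" and X0: "\<And>\<omega>. 0 \<le> X \<omega>"
    and e: "e \<in> borel_measurable \<G>" and bd: "\<And>\<omega>. \<omega> \<in> space M \<Longrightarrow> 0 < e \<omega> \<and> e \<omega> \<le> B"
  shows "integrable M (\<lambda>\<omega>. X \<omega> * indicator {\<omega> \<in> space M. \<not> Q \<omega>} \<omega>)"
    and "(LINT \<omega>|M. X \<omega> * indicator {\<omega> \<in> space M. \<not> Q \<omega>} \<omega>) \<le> sqrt p * (LINT \<omega>|M. e \<omega>)"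
proof -
  interpret prob_space M by (rule M)
  interpret finite_measure_subalgebra M \<G> by unfold_locales (rule sub)
  let ?A = "{\<omega> \<in> space M. \<not> Q \<omega>}"
  have A: "?A \<in> sets M"
  proof -
    have "{\<omega> \<in> space M. Q \<omega>} \<in> sets M" using Q by (simp add: cond_prob_ge_def)
    then show ?thesis by (rule sets.sets_Collect_neg)
  qed
  have Xm[measurable]: "X \<in> borel_measurable M" using X by (simp add: cond_sq_le_def)
  have em[measurable]: "e \<in> borel_measurable M" by (rule measurable_from_subalg[OF sub e])
  have ie: "integrable M e" by (rule integrable_const_bound[of _ B]) (use bd in \<open>fastforce intro: AE_I2\<close>, simp)
  define V where "V \<omega> = (X \<omega>)\<^sup>2 / e \<omega>" for \<omega>
  have Vm[measurable]: "V \<in> borel_measurable M" unfolding V_def by measurable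
  have V0: "0 \<le> V \<omega>" if "\<omega> \<in> space M" for \<omega> using bd[OF that] by (simp add: V_def)
  have "(\<integral>\<^sup>+\<omega>. ennreal (V \<omega>) \<partial>M) = (\<integral>\<^sup>+\<omega>. ennreal (1 / e \<omega>) * ennreal ((X \<omega>)\<^sup>2) \<partial>M)"
    by (rule nn_integral_cong) (use bd in \<open>auto simp: V_def ennreal_mult[symmetric] less_imp_le\<close>)
  also have "\<dots> = (\<integral>\<^sup>+\<omega>. ennreal (1 / e \<omega>) * nn_cond_exp M \<G> (\<lambda>\<omega>. ennreal ((X \<omega>)\<^sup>2)) \<omega> \<partial>M)"
  proof (rule nn_cond_exp_intg[symmetric])
    show "(\<lambda>\<omega>. ennreal (1 / e \<omega>)) \<in> borel_measurable \<G>"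
      by (rule measurable_compose[OF e]) measurable
  qed measurable
  also have "\<dots> \<le> (\<integral>\<^sup>+\<omega>. ennreal (e \<omega>) \<partial>M)"
  proof (rule nn_integral_mono_AE)
    have "AE \<omega> in M. nn_cond_exp M \<G> (\<lambda>\<omega>. ennreal ((X \<omega>)\<^sup>2)) \<omega> \<le> ennreal ((e \<omega>)\<^sup>2)"
      using X by (simp add: cond_sq_le_def)
    then show "AE \<omega> in M. ennreal (1 / e \<omega>) * nn_cond_exp M \<G> (\<lambda>\<omega>. ennreal ((X \<omega>)\<^sup>2)) \<omega> \<le> ennreal (e \<omega>)"
    proof (rule AE_mp, intro AE_I2 impI)
      fix \<omega> assume w: "\<omega> \<in> space M"
        and le: "nn_cond_exp M \<G> (\<lambda>\<omega>. ennreal ((X \<omega>)\<^sup>2)) \<omega> \<le> ennreal ((e \<omega>)\<^sup>2)"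
      have "ennreal (1 / e \<omega>) * nn_cond_exp M \<G> (\<lambda>\<omega>. ennreal ((X \<omega>)\<^sup>2)) \<omega>
          \<le> ennreal (1 / e \<omega>) * ennreal ((e \<omega>)\<^sup>2)"
        by (rule mult_left_mono[OF le]) simp
      also have "\<dots> = ennreal (e \<omega>)"
        using bd[OF w] by (simp add: ennreal_mult[symmetric] power2_eq_square)
      finally show "ennreal (1 / e \<omega>) * nn_cond_exp M \<G> (\<lambda>\<omega>. ennreal ((X \<omega>)\<^sup>2)) \<omega> \<le> ennreal (e \<omega>)" .
    qed
  qed
  also have "\<dots> = ennreal (LINT \<omega>|M. e \<omega>)"
    using ie bd by (intro nn_integral_eq_integral) (auto intro: less_imp_le)
  finally have nnV: "(\<integral>\<^sup>+\<omega>. ennreal (V \<omega>) \<partial>M) \<le> ennreal (LINT \<omega>|M. e \<omega>)" .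
  have iV: "integrable M V"
    using nnV V0 by (intro integrableI_nonneg) (auto intro: le_less_trans)
  have e0: "0 \<le> (LINT \<omega>|M. e \<omega>)" using bd by (intro integral_nonneg_AE) (auto intro: less_imp_le)
  have EV: "(LINT \<omega>|M. V \<omega>) \<le> (LINT \<omega>|M. e \<omega>)"
    using nnV V0 e0 nn_integral_eq_integral[OF iV] by simp
  define s where "s = sqrt p"
  have s: "0 < s" "s * s = p" using p by (auto simp: s_def)
  have young: "X \<omega> \<le> e \<omega> / (2 * s) + s * V \<omega> / 2" if "\<omega> \<in> space M" for \<omega>
  proof -
    have "0 \<le> (s * X \<omega> - e \<omega>)\<^sup>2" by simp
    then have "2 * s * X \<omega> * e \<omega> \<le> (e \<omega>)\<^sup>2 + s * s * (X \<omega>)\<^sup>2"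
      by (simp add: power2_diff power_mult_distrib power2_eq_square algebra_simps)
    then show ?thesis using bd[OF that] s(1)
      by (simp add: V_def power2_eq_square field_simps)
  qed
  let ?u = "\<lambda>\<omega>. (1 / (2 * s)) * (e \<omega> * indicator ?A \<omega>)" and ?v = "\<lambda>\<omega>. s / 2 * V \<omega>"
  have ieA: "integrable M (\<lambda>\<omega>. e \<omega> * indicator ?A \<omega>)"
    using integrable_mult_indicator[OF A ie] by (simp add: mult.commute)
  have bound: "X \<omega> * indicator ?A \<omega> \<le> ?u \<omega> + ?v \<omega>" if "\<omega> \<in> space M" for \<omega>
    using young[OF that] V0[OF that] s by (auto simp: indicator_def)
  have iuv: "integrable M (\<lambda>\<omega>. ?u \<omega> + ?v \<omega>)" using ieA iV by simp
  show iXA: "integrable M (\<lambda>\<omega>. X \<omega> * indicator ?A \<omega>)"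
  proof (rule Bochner_Integration.integrable_bound[OF iuv])
    show "(\<lambda>\<omega>. X \<omega> * indicator ?A \<omega>) \<in> borel_measurable M" using A by measurable
    show "AE \<omega> in M. norm (X \<omega> * indicator ?A \<omega>) \<le> norm (?u \<omega> + ?v \<omega>)"
      using bound X0 by (intro AE_I2) (fastforce simp: abs_mult)
  qed
  have "(LINT \<omega>|M. X \<omega> * indicator ?A \<omega>) \<le> (LINT \<omega>|M. ?u \<omega> + ?v \<omega>)"
    using bound by (intro integral_mono iXA iuv) auto
  also have "\<dots> = (1 / (2 * s)) * (LINT \<omega>|M. e \<omega> * indicator ?A \<omega>) + s / 2 * (LINT \<omega>|M. V \<omega>)"
    using ieA iV by simp
  also have "\<dots> \<le> (1 / (2 * s)) * (p * (LINT \<omega>|M. e \<omega>)) + s / 2 * (LINT \<omega>|M. e \<omega>)"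
    using cond_prob_complement_le[OF M sub Q e, of B] bd EV s
    by (intro add_mono mult_left_mono) (auto intro: less_imp_le)
  also have "\<dots> = sqrt p * (LINT \<omega>|M. e \<omega>)"
    unfolding s(2)[symmetric] using s(1) by (simp add: s_def[symmetric] real_sqrt_mult field_simps)
  finally show "(LINT \<omega>|M. X \<omega> * indicator ?A \<omega>) \<le> sqrt p * (LINT \<omega>|M. e \<omega>)" .
qed

lemma AE_summable_of_bounded_expectations:
  fixes X :: "nat \<Rightarrow> 'w \<Rightarrow> real"
  assumes int: "\<And>k. integrable M (X k)" and nonneg: "\<And>k. AE \<omega> in M. 0 \<le> X k \<omega>"
    and bd: "\<And>n. (\<Sum>k<n. LINT \<omega>|M. X k \<omega>) \<le> C"
  shows "AE \<omega> in M. summable (\<lambda>k. X k \<omega>)"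
proof -
  have [measurable]: "X k \<in> borel_measurable M" for k using int by auto
  have E0: "0 \<le> (LINT \<omega>|M. X k \<omega>)" for k using nonneg by (intro integral_nonneg_AE)
  have "(\<integral>\<^sup>+\<omega>. (\<Sum>k. ennreal (X k \<omega>)) \<partial>M) = (\<Sum>k. \<integral>\<^sup>+\<omega>. ennreal (X k \<omega>) \<partial>M)"
    by (rule nn_integral_suminf) measurable
  also have "\<dots> = (\<Sum>k. ennreal (LINT \<omega>|M. X k \<omega>))"
    using nn_integral_eq_integral[OF int nonneg] by simp
  also have "\<dots> \<le> ennreal C"
  proof (rule suminf_le_const)
    fix n show "(\<Sum>k<n. ennreal (LINT \<omega>|M. X k \<omega>)) \<le> ennreal C"
      using bd[of n] E0 by (simp add: sum_ennreal ennreal_leI)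
  qed simp
  finally have "(\<integral>\<^sup>+\<omega>. (\<Sum>k. ennreal (X k \<omega>)) \<partial>M) \<noteq> \<infinity>" by (auto simp: top_unique)
  then have "AE \<omega> in M. (\<Sum>k. ennreal (X k \<omega>)) \<noteq> \<infinity>"
    by (intro nn_integral_PInf_AE) measurable
  moreover have "AE \<omega> in M. \<forall>k. 0 \<le> X k \<omega>" using nonneg by (simp add: AE_all_countable)
  ultimately show ?thesis
    by eventually_elim (simp add: summable_suminf_not_top)
qed

section \<open>A deterministic convergence criterion\<close>

text \<open>
  A sequence that returns below every positive level, and whose increments are controlled by a
  quantity that is summable above every positive level, cannot climb back.
\<close>
lemma recurrent_controlled_tendsto_zero:
  fixes a d :: "nat \<Rightarrow> real"
  assumes a0: "\<And>k. 0 \<le> a k" and d0: "\<And>k. 0 \<le> d k" and C: "0 \<le> C"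
    and step: "\<And>k. a (Suc k) \<le> a k + C * d k"
    and d: "d \<longlonglongrightarrow> 0"
    and sm: "\<And>n. summable (\<lambda>k. if 1 / real (Suc n) \<le> a k then d k else 0)"
    and rec: "\<And>n m. \<exists>j\<ge>m. a j < 1 / real (Suc n)"
  shows "a \<longlonglongrightarrow> 0"
proof (rule LIMSEQ_I)
  fix r :: real assume r: "0 < r"
  obtain n where n: "1 / real (Suc n) < r / 3" using r by (metis nat_approx_posE zero_less_divide_iff zero_less_numeral)
  define e where "e = 1 / real (Suc n)"
  \<comment> \<open>One multiple of \<open>e\<close> for the starting level, one for the step that leaves it, one for
    the climb above it.\<close>
  have e: "0 < e" "3 * e < r" using n by (auto simp: e_def field_simps)
  define z where "z k = (if e \<le> a k then d k else 0)" for k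
  have z: "summable z" using sm[of n] by (simp add: z_def[abs_def] e_def)
  have z0: "0 \<le> z k" for k using d0 by (simp add: z_def)
  have Cp: "0 < C + 1" using C by simp
  have ec: "0 < e / (C + 1)" using e Cp by simp
  obtain m1 where m1: "\<And>m n. m1 \<le> m \<Longrightarrow> norm (sum z {m..<n}) < e / (C + 1)"
    using z ec unfolding summable_Cauchy by meson
  obtain m2 where m2: "\<And>k. m2 \<le> k \<Longrightarrow> norm (d k) < e / (C + 1)"
    using LIMSEQ_D[OF d ec] by auto
  have small: "C * x \<le> e" if "x < e / (C + 1)" "0 \<le> x" for x
  proof -
    have "C * x \<le> (C + 1) * x" using that by (simp add: mult_right_mono)
    also have "\<dots> \<le> e" using that(1) Cp by (simp add: pos_less_divide_eq mult.commute less_imp_le)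
    finally show ?thesis .
  qed
  obtain j where j: "max m1 m2 \<le> j" "a j < e" using rec[of "max m1 m2" n] by (auto simp: e_def)
  have bound: "a k \<le> 2 * e + C * sum z {j..<k}" if "j \<le> k" for k
    using that
  proof (induction k rule: dec_induct)
    case base
    show ?case using j e by simp
  next
    case (step k)
    have S: "C * sum z {j..<Suc k} = C * sum z {j..<k} + C * z k"
      using step by (simp add: algebra_simps)
    have nn: "0 \<le> C * sum z {j..<Suc k}" using C z0 by (simp add: sum_nonneg)
    show ?case
    proof (cases "e \<le> a k")
      case True
      then show ?thesis using step.IH assms(4)[of k] S by (simp add: z_def)
    next
      case False
      have "C * d k \<le> e" using m2[of k] step j d0[of k] by (intro small) auto
      then show ?thesis using False assms(4)[of k] nn by linarith
    qed
  qed
  show "\<exists>no. \<forall>k\<ge>no. norm (a k - 0) < r"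
  proof (intro exI allI impI)
    fix k assume k: "j \<le> k"
    have "C * sum z {j..<k} \<le> e"
      using m1[of j k] j z0 by (intro small) (auto simp: sum_nonneg)
    then have "a k \<le> 3 * e" using bound[OF k] by simp
    then show "norm (a k - 0) < r" using e a0[of k] by simp
  qed
qed

section \<open>The random run\<close>

locale storm_process = storm_problem f c \<Omega> K P \<nu> + prob_space M
  for f :: "real^'d \<Rightarrow> real" and c :: "real^'d \<Rightarrow> real^'m" and \<Omega> K
    and P :: "'d params" and \<nu> and M :: "'w measure" +
  fixes \<F> \<H> :: "nat \<Rightarrow> 'w measure" and S :: "nat \<Rightarrow> 'w \<Rightarrow> ('d, 'n::finite) iter" and mu_hat :: real
  assumes algorithm: "\<And>\<omega>. \<omega> \<in> space M \<Longrightarrow> storm_run P c (\<lambda>k. S k \<omega>)"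
    and adapted: "adapted_run M \<F> \<H> P c S"
    and regular_run: "\<And>\<omega>. \<omega> \<in> space M \<Longrightarrow> iterates_regular P f c \<Omega> K (\<lambda>k. S k \<omega>)"
    and merit_bounded: "AE \<omega> in M. \<forall>k. mu (S k \<omega>) \<le> mu_hat"
    and accuracy: "probabilistic_accuracy M \<F> \<H> P f c S"
    and failure_small: "p_h P + p_g P + 2 * p_f P \<le> (1 - \<nu>)\<^sup>2 / (16 * \<nu>\<^sup>2) * (1 - 1 / gamma P)\<^sup>2"
begin

lemma path: "\<omega> \<in> space M \<Longrightarrow> storm_path f c \<Omega> K P \<nu> (\<lambda>k. S k \<omega>)"
  by unfold_locales (auto intro: algorithm regular_run)

definition p_fail :: real where "p_fail = p_h P + p_g P + 2 * p_f P"

lemma prob_params: "0 < p_h P" "0 < p_g P" "0 < p_f P"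
  using params by (auto simp: valid_params_def)

text \<open>
  With \<open>s = (1 - \<nu>) / (4 \<nu>) (1 - 1 / \<gamma>)\<close> the failure probability is at most
  \<open>s\<^sup>2\<close>, and the lower bound on \<open>\<nu>\<close> gives \<open>s \<le> (1 - 1 / \<gamma>) / (8 \<gamma>)\<close>. The
  last two inequalities are what the recurrence and the Lyapunov argument use, respectively.
\<close>
lemma failure_bounds:
  shows "0 < p_fail" "p_fail \<le> 1 / 2" "1 / gamma P + p_fail * gamma P < 1"
    "4 * \<nu> * sqrt (p_f P) \<le> (1 - \<nu>) * (1 - 1 / gamma P)"
proof -
  define g where "g = gamma P"
  define s where "s = (1 - \<nu>) / (4 * \<nu>) * (1 - 1 / g)"
  have g: "1 < g" using param_bounds by (simp add: g_def)
  have gi: "0 < 1 - 1 / g" "1 - 1 / g < 1" using g by auto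
  have s0: "0 < s" using nu01 gi by (simp add: s_def)
  have ps: "p_fail \<le> s\<^sup>2"
    using failure_small by (simp add: p_fail_def s_def g_def power_mult_distrib power_divide)
  have "\<nu> * eta P \<le> \<nu>" using param_bounds(3) nu01 by (simp add: mult_left_le)
  then have "2 * g * (1 - \<nu>) \<le> \<nu>" unfolding g_def by (rule order_trans[OF nu_eps])
  then have "(1 - \<nu>) / (4 * \<nu>) \<le> 1 / (8 * g)" using nu01 g by (simp add: field_simps)
  then have sg: "s \<le> 1 / (8 * g) * (1 - 1 / g)"
    unfolding s_def using gi by (intro mult_right_mono) auto
  have g8: "1 / (8 * g) \<le> 1 / 8" using g by (simp add: field_simps)
  have "1 / (8 * g) * (1 - 1 / g) \<le> 1 / 8 * 1"
    using g8 gi g by (intro mult_mono) auto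
  then have s8: "s \<le> 1 / 8" using sg by linarith
  show "0 < p_fail" using prob_params by (simp add: p_fail_def)
  have "s\<^sup>2 \<le> (1 / 8)\<^sup>2" using s0 s8 by (intro power_mono) auto
  also have "\<dots> \<le> (1 / 2 :: real)" by (simp add: power2_eq_square)
  finally show "p_fail \<le> 1 / 2" using ps by simp
  have "p_fail * g \<le> (s * s) * g" using ps g by (intro mult_right_mono) (auto simp: power2_eq_square)
  also have "\<dots> \<le> (1 / 8 * (1 / (8 * g) * (1 - 1 / g))) * g"
    using s0 s8 sg g by (intro mult_right_mono mult_mono) auto
  also have "\<dots> = (1 - 1 / g) / 64" using g by simp
  also have "\<dots> < 1 - 1 / g"
  proof -
    have "x / 64 < x" if "0 < x" for x :: real using that by simp
    from this[OF gi(1)] show ?thesis .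
  qed
  finally show "1 / gamma P + p_fail * gamma P < 1" by (simp add: g_def)
  have "p_f P \<le> s\<^sup>2" using ps prob_params by (simp add: p_fail_def)
  then have "sqrt (p_f P) \<le> s" using s0 by (simp add: real_le_lsqrt)
  then have "4 * \<nu> * sqrt (p_f P) \<le> 4 * \<nu> * s" using nu01 by (intro mult_left_mono) auto
  also have "\<dots> = (1 - \<nu>) * (1 - 1 / g)" using nu01 by (simp add: s_def)
  finally show "4 * \<nu> * sqrt (p_f P) \<le> (1 - \<nu>) * (1 - 1 / gamma P)" by (simp add: g_def)
qed

lemma mu_hat_nonneg: "0 \<le> mu_hat"
proof -
  have "AE \<omega> in M. 0 \<le> mu_hat"
    using merit_bounded AE_space
  proof eventually_elim
    case (elim \<omega>)
    interpret storm_path f c \<Omega> K P \<nu> "\<lambda>k. S k \<omega>" using elim by (simp add: path)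
    show ?case using elim(1) mu_pos[of 0] by (auto intro: order_trans less_imp_le)
  qed
  then show ?thesis by simp
qed

subsection \<open>Measurability\<close>

lemma subalgebras: "subalgebra M (\<F> k)" "subalgebra M (\<H> k)" "subalgebra (\<H> k) (\<F> k)"
    "subalgebra (\<F> (Suc k)) (\<H> k)"
  using adapted by (auto simp: adapted_run_def)

lemma spaces: "space (\<F> k) = space M" "space (\<H> k) = space M"
  using subalgebras[of k] by (auto simp: subalgebra_def)

lemma past_mono: "j \<le> k \<Longrightarrow> subalgebra (\<F> k) (\<F> j)"
proof (induction k rule: dec_induct)
  case (step n)
  then show ?case
    using subalgebras[of n] spaces by (auto simp: subalgebra_def)
qed (simp add: subalgebra_def)

lemma past_imp_M: "X \<in> borel_measurable (\<F> k) \<Longrightarrow> X \<in> borel_measurable M"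
  and past_imp_half: "X \<in> borel_measurable (\<F> k) \<Longrightarrow> X \<in> borel_measurable (\<H> k)"
  and half_imp_M: "X \<in> borel_measurable (\<H> k) \<Longrightarrow> X \<in> borel_measurable M"
  by (rule measurable_from_subalg[OF subalgebras(1)] measurable_from_subalg[OF subalgebras(3)]
      measurable_from_subalg[OF subalgebras(2)]; assumption)+

lemma adapted_measurable:
  "(\<lambda>\<omega>. xk (S k \<omega>)) \<in> borel_measurable (\<F> k)"
  "(\<lambda>\<omega>. Delta (S k \<omega>)) \<in> borel_measurable (\<F> k)"
  "(\<lambda>\<omega>. eps (S k \<omega>)) \<in> borel_measurable (\<F> k)"
  "(\<lambda>\<omega>. mu (S k \<omega>)) \<in> borel_measurable (\<H> k)"
  using adapted by (auto simp: adapted_run_def)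

text \<open>
  Every iterate is a regular point, so continuity on the set of regular points, which is all that
  is available for the residual, suffices.
\<close>
lemma iterate_function_measurable:
  fixes h :: "real^'d \<Rightarrow> 'b :: topological_space"
  assumes h: "continuous_on (regular_points f c \<Omega> K) h"
  shows "(\<lambda>\<omega>. h (xk (S k \<omega>))) \<in> borel_measurable (\<F> k)"
proof -
  have "(\<lambda>\<omega>. xk (S k \<omega>)) \<in> \<F> k \<rightarrow>\<^sub>M restrict_space borel (regular_points f c \<Omega> K)"
    using adapted_measurable(1)
    by (rule measurable_restrict_space2[rotated])
      (auto simp: spaces intro: storm_path.regular_iterate[OF path])
  from measurable_compose[OF this borel_measurable_continuous_on_restrict[OF h]]
  show ?thesis .
qed

lemma regular_points_subset: "regular_points f c \<Omega> K \<subseteq> \<Omega>"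
  by (auto simp: regular_points_def)

lemma residual_measurable: "(\<lambda>\<omega>. kkt_residual f c (xk (S k \<omega>))) \<in> borel_measurable (\<F> k)"
  by (rule iterate_function_measurable[OF continuous_kkt_residual])

lemma mu_measurable: "(\<lambda>\<omega>. mu (S k \<omega>)) \<in> borel_measurable M"
  by (rule half_imp_M[OF adapted_measurable(4)])

lemma mu_in_measurable: "(\<lambda>\<omega>. mu_in (S k \<omega>)) \<in> borel_measurable M"
proof (cases k)
  case 0
  have "(\<lambda>\<omega>. mu_in (S k \<omega>)) \<in> borel_measurable M \<longleftrightarrow> (\<lambda>\<omega>. mu_init P) \<in> borel_measurable M"
    by (rule measurable_cong) (simp add: 0 storm_path.start[OF path])
  then show ?thesis by simp
next
  case (Suc j)
  have "(\<lambda>\<omega>. mu_in (S k \<omega>)) \<in> borel_measurable M \<longleftrightarrow> (\<lambda>\<omega>. mu (S j \<omega>)) \<in> borel_measurable M"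
    by (rule measurable_cong) (simp add: Suc storm_path.mu_in_Suc[OF path])
  then show ?thesis using mu_measurable by simp
qed

lemma lyap_measurable: "(\<lambda>\<omega>. lyap (S k \<omega>)) \<in> borel_measurable M"
proof -
  have [measurable]: "(\<lambda>\<omega>. f (xk (S k \<omega>))) \<in> borel_measurable M"
    "(\<lambda>\<omega>. c (xk (S k \<omega>))) \<in> borel_measurable M"
    by (rule past_imp_M, rule iterate_function_measurable, rule continuous_on_subset,
        (rule continuous_f continuous_c), rule regular_points_subset)+
  have [measurable]: "(\<lambda>\<omega>. Delta (S k \<omega>)) \<in> borel_measurable M" "(\<lambda>\<omega>. eps (S k \<omega>)) \<in> borel_measurable M"
    by (rule past_imp_M, rule adapted_measurable)+
  note mu_in_measurable[measurable]
  show ?thesis unfolding lyap_def by measurable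
qed

subsection \<open>Accurate iterations\<close>

definition accurate :: "nat \<Rightarrow> 'w \<Rightarrow> bool" where
  "accurate k \<omega> \<longleftrightarrow> acc_A P f (S k \<omega>) \<and> acc_B P f (S k \<omega>) \<and>
     acc_C P c f (S k \<omega>) \<and> acc_C' P c f (S k \<omega>)"

lemma event_conditions:
  "cond_prob_ge M (\<F> k) (\<lambda>\<omega>. acc_B P f (S k \<omega>)) (1 - p_g P)"
  "cond_prob_ge M (\<H> k) (\<lambda>\<omega>. acc_C P c f (S k \<omega>)) (1 - p_f P)"
  "cond_prob_ge M (\<H> k) (\<lambda>\<omega>. acc_C' P c f (S k \<omega>)) (1 - p_f P)"
  "alpha P = 1 \<Longrightarrow> cond_prob_ge M (\<F> k) (\<lambda>\<omega>. acc_A P f (S k \<omega>)) (1 - p_h P)"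
  using accuracy by (auto simp: probabilistic_accuracy_def)

lemma acc_A_event: "{\<omega> \<in> space M. acc_A P f (S k \<omega>)} \<in> sets M"
proof (cases "alpha P = 1")
  case False
  then show ?thesis using param_bounds(1) by (auto simp: acc_A_def)
qed (use event_conditions(4) in \<open>simp add: cond_prob_ge_def\<close>)

lemma accurate_event: "{\<omega> \<in> space M. accurate k \<omega>} \<in> sets M"
proof -
  have "{\<omega> \<in> space M. acc_B P f (S k \<omega>)} \<in> sets M" "{\<omega> \<in> space M. acc_C P c f (S k \<omega>)} \<in> sets M"
    "{\<omega> \<in> space M. acc_C' P c f (S k \<omega>)} \<in> sets M"
    using event_conditions[of k] by (auto simp: cond_prob_ge_def)
  with acc_A_event[of k] show ?thesis
    unfolding accurate_def by (intro sets.sets_Collect_conj)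
qed

lemma inaccurate_expectation_le:
  fixes Y :: "'w \<Rightarrow> real"
  assumes Y: "Y \<in> borel_measurable (\<F> k)"
    and bd: "\<And>\<omega>. \<omega> \<in> space M \<Longrightarrow> 0 \<le> Y \<omega> \<and> Y \<omega> \<le> B"
  shows "(LINT \<omega>|M. Y \<omega> * indicator {\<omega> \<in> space M. \<not> accurate k \<omega>} \<omega>) \<le> p_fail * (LINT \<omega>|M. Y \<omega>)"
proof -
  have YM[measurable]: "Y \<in> borel_measurable M" by (rule past_imp_M[OF Y])
  have iY: "integrable M Y" by (rule integrable_const_bound[of _ B]) (use bd in \<open>auto intro: AE_I2\<close>)
  let ?ind = "\<lambda>Q \<omega>. indicator {\<omega> \<in> space M. \<not> Q \<omega>} \<omega> :: real"
  let ?A = "\<lambda>\<omega>. acc_A P f (S k \<omega>)" and ?B = "\<lambda>\<omega>. acc_B P f (S k \<omega>)"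
    and ?C = "\<lambda>\<omega>. acc_C P c f (S k \<omega>)" and ?C' = "\<lambda>\<omega>. acc_C' P c f (S k \<omega>)"
  have int: "integrable M (\<lambda>\<omega>. Y \<omega> * ?ind Q \<omega>)" if "{\<omega> \<in> space M. Q \<omega>} \<in> sets M" for Q
  proof -
    have "{\<omega> \<in> space M. \<not> Q \<omega>} \<in> sets M" using that by (rule sets.sets_Collect_neg)
    from integrable_mult_indicator[OF this iY] show ?thesis by (simp add: mult.commute)
  qed
  have ev: "{\<omega> \<in> space M. ?B \<omega>} \<in> sets M" "{\<omega> \<in> space M. ?C \<omega>} \<in> sets M"
    "{\<omega> \<in> space M. ?C' \<omega>} \<in> sets M"
    using event_conditions[of k] by (auto simp: cond_prob_ge_def)
  note ints = int[OF acc_A_event[of k]] int[OF ev(1)] int[OF ev(2)] int[OF ev(3)]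
  have EY: "0 \<le> (LINT \<omega>|M. Y \<omega>)" using bd by (intro integral_nonneg_AE) (auto intro: AE_I2)
  have A: "(LINT \<omega>|M. Y \<omega> * ?ind ?A \<omega>) \<le> p_h P * (LINT \<omega>|M. Y \<omega>)"
  proof (cases "alpha P = 1")
    case True
    show ?thesis by (rule cond_prob_complement_le[OF prob_space_axioms subalgebras(1) event_conditions(4)[OF True] Y bd])
  next
    case False
    then have "?A \<omega>" for \<omega> using param_bounds(1) by (simp add: acc_A_def)
    then have "(LINT \<omega>|M. Y \<omega> * ?ind ?A \<omega>) = 0" by simp
    then show ?thesis using EY prob_params by simp
  qed
  note B = cond_prob_complement_le[OF prob_space_axioms subalgebras(1) event_conditions(1) Y bd]
  note C = cond_prob_complement_le[OF prob_space_axioms subalgebras(2) event_conditions(2) past_imp_half[OF Y] bd]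
  note C' = cond_prob_complement_le[OF prob_space_axioms subalgebras(2) event_conditions(3) past_imp_half[OF Y] bd]
  have "(LINT \<omega>|M. Y \<omega> * ?ind (accurate k) \<omega>)
      \<le> (LINT \<omega>|M. Y \<omega> * ?ind ?A \<omega> + (Y \<omega> * ?ind ?B \<omega> + (Y \<omega> * ?ind ?C \<omega> + Y \<omega> * ?ind ?C' \<omega>)))"
    using bd by (intro integral_mono int[OF accurate_event] Bochner_Integration.integrable_add ints)
      (auto simp: indicator_def accurate_def)
  also have "\<dots> = (LINT \<omega>|M. Y \<omega> * ?ind ?A \<omega>) + ((LINT \<omega>|M. Y \<omega> * ?ind ?B \<omega>)
      + ((LINT \<omega>|M. Y \<omega> * ?ind ?C \<omega>) + (LINT \<omega>|M. Y \<omega> * ?ind ?C' \<omega>)))"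
    by (simp only: Bochner_Integration.integral_add Bochner_Integration.integrable_add ints)
  also have "\<dots> \<le> p_fail * (LINT \<omega>|M. Y \<omega>)"
    using A B C C' by (simp add: p_fail_def algebra_simps)
  finally show ?thesis .
qed

text \<open>
  Each of the four products of an error with the indicator of a failing event contributes at
  most \<open>sqrt p_f\<close> times the expectation of \<open>eps\<close>.
\<close>
lemma excess_error_expectation:
  "integrable M (\<lambda>\<omega>. excess_error (S k \<omega>))"
  "(LINT \<omega>|M. excess_error (S k \<omega>)) \<le> 4 * sqrt (p_f P) * (LINT \<omega>|M. eps (S k \<omega>))"
proof -
  let ?C = "{\<omega> \<in> space M. \<not> acc_C P c f (S k \<omega>)}" and ?C' = "{\<omega> \<in> space M. \<not> acc_C' P c f (S k \<omega>)}"
  let ?e = "\<lambda>\<omega>. eps (S k \<omega>)"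
  have sq: "cond_sq_le M (\<H> k) (\<lambda>\<omega>. err_f P c f (S k \<omega>)) ?e"
    "cond_sq_le M (\<H> k) (\<lambda>\<omega>. err_s P c f (S k \<omega>)) ?e"
    "cond_sq_le M (\<H> k) (\<lambda>\<omega>. err_soc P c f (S k \<omega>)) ?e"
    using accuracy by (auto simp: probabilistic_accuracy_def)
  have em: "?e \<in> borel_measurable (\<H> k)" by (rule past_imp_half[OF adapted_measurable(3)])
  have bd: "0 < ?e \<omega> \<and> ?e \<omega> \<le> eps_init P * gamma P ^ k" if "\<omega> \<in> space M" for \<omega>
    by (rule storm_path.eps_bounds[OF path[OF that]])
  note rule = cond_error_expectation[OF prob_space_axioms subalgebras(2) _ prob_params(3) _ _ em bd]
  note fC = rule[OF event_conditions(2) sq(1) err_nonneg(1)]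
  note sC = rule[OF event_conditions(2) sq(2) err_nonneg(2)]
  note fC' = rule[OF event_conditions(3) sq(1) err_nonneg(1)]
  note oC' = rule[OF event_conditions(3) sq(3) err_nonneg(3)]
  let ?sum = "\<lambda>\<omega>. (err_f P c f (S k \<omega>) * indicator ?C \<omega> + err_s P c f (S k \<omega>) * indicator ?C \<omega>) +
    (err_f P c f (S k \<omega>) * indicator ?C' \<omega> + err_soc P c f (S k \<omega>) * indicator ?C' \<omega>)"
  have eq: "excess_error (S k \<omega>) = ?sum \<omega>" if "\<omega> \<in> space M" for \<omega>
    using that by (simp add: excess_error_def indicator_def)
  have i: "integrable M ?sum"
    by (intro Bochner_Integration.integrable_add fC(1) sC(1) fC'(1) oC'(1))
  have "integrable M (\<lambda>\<omega>. excess_error (S k \<omega>)) \<longleftrightarrow> integrable M ?sum"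
    by (rule Bochner_Integration.integrable_cong[OF refl eq])
  then show "integrable M (\<lambda>\<omega>. excess_error (S k \<omega>))" using i by simp
  have "(LINT \<omega>|M. excess_error (S k \<omega>)) = (LINT \<omega>|M. ?sum \<omega>)"
    by (rule Bochner_Integration.integral_cong[OF refl eq])
  also have "\<dots> = ((LINT \<omega>|M. err_f P c f (S k \<omega>) * indicator ?C \<omega>)
      + (LINT \<omega>|M. err_s P c f (S k \<omega>) * indicator ?C \<omega>)) +
      ((LINT \<omega>|M. err_f P c f (S k \<omega>) * indicator ?C' \<omega>)
      + (LINT \<omega>|M. err_soc P c f (S k \<omega>) * indicator ?C' \<omega>))"
    by (simp only: Bochner_Integration.integral_add Bochner_Integration.integrable_add
        fC(1) sC(1) fC'(1) oC'(1))
  also have "\<dots> \<le> 4 * sqrt (p_f P) * (LINT \<omega>|M. ?e \<omega>)"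
    using fC(2) sC(2) fC'(2) oC'(2) by (simp add: algebra_simps)
  finally show "(LINT \<omega>|M. excess_error (S k \<omega>)) \<le> 4 * sqrt (p_f P) * (LINT \<omega>|M. ?e \<omega>)" .
qed

section \<open>Summability of the radii\<close>

text \<open>
  Nonzero only where accuracy alone guarantees acceptance. The condition involves the past of the
  iteration only, so that the conditional accuracy can be applied.
\<close>
definition active_radius :: "real \<Rightarrow> nat \<Rightarrow> 'w \<Rightarrow> real" where
  "active_radius e k \<omega> =
     (if e \<le> kkt_residual f c (xk (S k \<omega>)) \<and> Delta (S k \<omega>) \<le> radius_threshold mu_hat e
      then Delta (S k \<omega>) else 0)"

lemma active_radius_measurable: "active_radius e k \<in> borel_measurable (\<F> k)"
proof -
  note [measurable] = residual_measurable[of k] adapted_measurable(2)[of k]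
  show ?thesis unfolding active_radius_def by measurable
qed

lemma active_radius_bounds:
  "\<omega> \<in> space M \<Longrightarrow> 0 \<le> active_radius e k \<omega> \<and> active_radius e k \<omega> \<le> Delta_max P"
  using storm_path.Delta_pos[OF path, of \<omega> k] storm_path.Delta_le_max[OF path, of \<omega> k] param_bounds
  by (auto simp: active_radius_def)

definition radius_gain :: real where
  "radius_gain = (1 - \<nu>) / 4 * (1 - 1 / gamma P)"

definition active_gain :: "real \<Rightarrow> real" where
  "active_gain e = \<nu> * eta P / 8 * (kappa_fcd P * e / 4)"

lemma gains_pos: "0 < radius_gain" "0 < e \<Longrightarrow> 0 < active_gain e"
  using nu01 param_bounds by (auto simp: radius_gain_def active_gain_def)

lemma lyapunov_decrease_active:
  assumes e: "0 < e"
  shows "AE \<omega> in M. lyap (S (Suc k) \<omega>) + (1 - \<nu>) * (1 - 1 / gamma P) * eps (S k \<omega>)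
      + radius_gain * Delta (S k \<omega>) ^ (alpha P + 2)
      + active_gain e * (active_radius e k \<omega> - active_radius e k \<omega> * indicator {\<omega> \<in> space M. \<not> accurate k \<omega>} \<omega>)
    \<le> lyap (S k \<omega>) + \<nu> * excess_error (S k \<omega>) + \<nu> * kappa_c K * (mu (S k \<omega>) - mu_in (S k \<omega>))"
  using merit_bounded AE_space
proof eventually_elim
  case (elim \<omega>)
  interpret storm_path f c \<Omega> K P \<nu> "\<lambda>k. S k \<omega>" using elim by (simp add: path)
  let ?ind = "indicator {\<omega> \<in> space M. \<not> accurate k \<omega>} \<omega> :: real"
  have "active_gain e * (active_radius e k \<omega> - active_radius e k \<omega> * ?ind)
      \<le> (if success k then \<nu> * eta P / 8 * - Pred P c (S k \<omega>) else 0)"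
  proof (cases "accurate k \<omega> \<and> e \<le> kkt_residual f c (xk (S k \<omega>)) \<and>
        Delta (S k \<omega>) \<le> radius_threshold mu_hat e")
    case True
    then have acc: "accepted_plain P c (S k \<omega>)"
        "kappa_fcd P * e / 4 * Delta (S k \<omega>) \<le> - Pred P c (S k \<omega>)"
      using accurate_step_accepted[of k mu_hat e] e elim by (auto simp: accurate_def)
    have "\<nu> * eta P / 8 * (kappa_fcd P * e / 4 * Delta (S k \<omega>)) \<le> \<nu> * eta P / 8 * - Pred P c (S k \<omega>)"
      using acc(2) nu01 param_bounds by (intro mult_left_mono) auto
    then show ?thesis using True acc(1) by (simp add: active_radius_def active_gain_def mult.assoc)
  next
    case False
    then have z: "active_radius e k \<omega> - active_radius e k \<omega> * ?ind = 0"
      using elim(2) by (auto simp: active_radius_def)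
    have "0 \<le> \<nu> * eta P / 8 * - Pred P c (S k \<omega>)" if "success k"
      using pred_neg[OF success_trial[OF that]] nu01 param_bounds
      by (intro mult_nonneg_nonneg) auto
    then show ?thesis unfolding z mult_zero_right by simp
  qed
  then show ?case using lyapunov_decrease[of k] by (simp add: radius_gain_def)
qed

lemma integrable_mu: "integrable M (\<lambda>\<omega>. mu (S k \<omega>))" "integrable M (\<lambda>\<omega>. mu_in (S k \<omega>))"
proof -
  have "AE \<omega> in M. norm (mu (S k \<omega>)) \<le> mu_hat \<and> norm (mu_in (S k \<omega>)) \<le> mu_hat"
    using merit_bounded AE_space
  proof eventually_elim
    case (elim \<omega>)
    interpret storm_path f c \<Omega> K P \<nu> "\<lambda>k. S k \<omega>" using elim by (simp add: path)
    show ?case using mu_in_pos[of k] mu_ge[of k] elim(1)[rule_format, of k] by auto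
  qed
  then show "integrable M (\<lambda>\<omega>. mu (S k \<omega>))" "integrable M (\<lambda>\<omega>. mu_in (S k \<omega>))"
    by (auto intro!: integrable_const_bound[of _ mu_hat] mu_measurable mu_in_measurable elim: eventually_mono)
qed

lemma integrable_eps: "integrable M (\<lambda>\<omega>. eps (S k \<omega>))"
proof (rule integrable_const_bound[of _ "eps_init P * gamma P ^ k"])
  show "AE \<omega> in M. norm (eps (S k \<omega>)) \<le> eps_init P * gamma P ^ k"
    using storm_path.eps_bounds[OF path, of _ k] by (intro AE_I2) (auto simp: less_imp_le)
qed (rule past_imp_M[OF adapted_measurable(3)])

lemma integrable_radius_power: "integrable M (\<lambda>\<omega>. Delta (S k \<omega>) ^ n)"
proof (rule integrable_const_bound[of _ "Delta_max P ^ n"])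
  show "AE \<omega> in M. norm (Delta (S k \<omega>) ^ n) \<le> Delta_max P ^ n"
    using storm_path.Delta_bounds[OF path, of _ k]
    by (intro AE_I2) (auto simp: less_imp_le norm_power intro!: power_mono)
  show "(\<lambda>\<omega>. Delta (S k \<omega>) ^ n) \<in> borel_measurable M"
    using past_imp_M[OF adapted_measurable(2), of k] by measurable
qed

lemma integrable_lyap: "integrable M (\<lambda>\<omega>. lyap (S k \<omega>))"
proof (induction k)
  case 0
  have "integrable M (\<lambda>\<omega>. lyap (S 0 \<omega>)) \<longleftrightarrow> integrable M (\<lambda>\<omega>.
      \<nu> * (f (x_init P) - f_inf K + mu_init P * norm (c (x_init P)))
       + (1 - \<nu>) / 4 * Delta_init P ^ (alpha P + 2) + (1 - \<nu>) * eps_init P)"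
    by (rule Bochner_Integration.integrable_cong) (auto simp: lyap_def storm_path.start[OF path])
  then show ?case by simp
next
  case (Suc k)
  let ?r = "\<lambda>\<omega>. lyap (S k \<omega>) + \<nu> * excess_error (S k \<omega>) + \<nu> * kappa_c K * (mu (S k \<omega>) - mu_in (S k \<omega>))"
  show ?case
  proof (rule Bochner_Integration.integrable_bound[where f = ?r])
    show "integrable M ?r"
      using Suc excess_error_expectation(1) integrable_mu
      by (intro Bochner_Integration.integrable_add integrable_mult_right Bochner_Integration.integrable_diff)
    show "AE \<omega> in M. norm (lyap (S (Suc k) \<omega>)) \<le> norm (?r \<omega>)"
      using lyapunov_decrease_active[OF zero_less_one, of k] AE_space
    proof eventually_elim
      case (elim \<omega>)
      interpret storm_path f c \<Omega> K P \<nu> "\<lambda>k. S k \<omega>" using elim by (simp add: path)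
      have "0 \<le> active_gain 1 * (active_radius 1 k \<omega> - active_radius 1 k \<omega> * indicator {\<omega> \<in> space M. \<not> accurate k \<omega>} \<omega>)"
        using active_radius_bounds[OF elim(2), of 1 k] gains_pos(2)[of 1]
        by (intro mult_nonneg_nonneg) (auto simp: indicator_def)
      moreover have "0 \<le> (1 - \<nu>) * (1 - 1 / gamma P) * eps (S k \<omega>)"
        using eps_pos[of k] nu01 param_bounds(12) by simp
      moreover have "0 \<le> radius_gain * Delta (S k \<omega>) ^ (alpha P + 2)"
        using gains_pos(1) Delta_pos[of k] by simp
      ultimately show ?case using elim(1) lyap_nonneg[of "Suc k"] by simp
    qed
  qed (rule lyap_measurable)
qed

lemma integrable_active_radius:
  "integrable M (active_radius e k)"
  "integrable M (\<lambda>\<omega>. active_radius e k \<omega> * indicator {\<omega> \<in> space M. \<not> accurate k \<omega>} \<omega>)"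
proof -
  show i: "integrable M (active_radius e k)"
    by (rule integrable_const_bound[of _ "Delta_max P"])
      (use active_radius_bounds past_imp_M[OF active_radius_measurable] in \<open>auto intro!: AE_I2\<close>)
  have "{\<omega> \<in> space M. \<not> accurate k \<omega>} \<in> sets M" using accurate_event by (rule sets.sets_Collect_neg)
  from integrable_mult_indicator[OF this i]
  show "integrable M (\<lambda>\<omega>. active_radius e k \<omega> * indicator {\<omega> \<in> space M. \<not> accurate k \<omega>} \<omega>)"
    by (simp add: mult.commute)
qed

text \<open>
  The expected excess error is absorbed by the term in \<open>eps\<close>. The event in \<open>active_radius\<close>
  belongs to the past, so at least half of its expectation is carried by accurate iterations.
\<close>
lemma expected_decrease:
  assumes e: "0 < e"
  shows "(LINT \<omega>|M. lyap (S (Suc k) \<omega>)) + radius_gain * (LINT \<omega>|M. Delta (S k \<omega>) ^ (alpha P + 2))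
      + active_gain e / 2 * (LINT \<omega>|M. active_radius e k \<omega>)
    \<le> (LINT \<omega>|M. lyap (S k \<omega>))
      + \<nu> * kappa_c K * ((LINT \<omega>|M. mu (S k \<omega>)) - (LINT \<omega>|M. mu_in (S k \<omega>)))"
proof -
  let ?bad = "\<lambda>\<omega>. active_radius e k \<omega> * indicator {\<omega> \<in> space M. \<not> accurate k \<omega>} \<omega>"
  note ints = integrable_lyap integrable_mu integrable_eps integrable_radius_power
    excess_error_expectation(1) integrable_active_radius
  have "(LINT \<omega>|M. lyap (S (Suc k) \<omega>) + (1 - \<nu>) * (1 - 1 / gamma P) * eps (S k \<omega>)
      + radius_gain * Delta (S k \<omega>) ^ (alpha P + 2) + active_gain e * (active_radius e k \<omega> - ?bad \<omega>))
    \<le> (LINT \<omega>|M. lyap (S k \<omega>) + \<nu> * excess_error (S k \<omega>) + \<nu> * kappa_c K * (mu (S k \<omega>) - mu_in (S k \<omega>)))"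
    by (intro integral_mono_AE lyapunov_decrease_active e Bochner_Integration.integrable_add
        integrable_mult_right Bochner_Integration.integrable_diff ints)
  then have main: "(LINT \<omega>|M. lyap (S (Suc k) \<omega>))
      + (1 - \<nu>) * (1 - 1 / gamma P) * (LINT \<omega>|M. eps (S k \<omega>))
      + radius_gain * (LINT \<omega>|M. Delta (S k \<omega>) ^ (alpha P + 2))
      + active_gain e * ((LINT \<omega>|M. active_radius e k \<omega>) - (LINT \<omega>|M. ?bad \<omega>))
    \<le> (LINT \<omega>|M. lyap (S k \<omega>)) + \<nu> * (LINT \<omega>|M. excess_error (S k \<omega>))
      + \<nu> * kappa_c K * ((LINT \<omega>|M. mu (S k \<omega>)) - (LINT \<omega>|M. mu_in (S k \<omega>)))"
    by (simp only: Bochner_Integration.integral_add Bochner_Integration.integral_diff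
        integral_mult_right_zero Bochner_Integration.integrable_add
        integrable_mult_right Bochner_Integration.integrable_diff ints)
  have Ee: "0 \<le> (LINT \<omega>|M. eps (S k \<omega>))"
    using storm_path.eps_pos[OF path, of _ k] by (intro integral_nonneg_AE AE_I2) (simp add: less_imp_le)
  have Ea: "0 \<le> (LINT \<omega>|M. active_radius e k \<omega>)"
    using active_radius_bounds by (intro integral_nonneg_AE AE_I2) simp
  have "\<nu> * (LINT \<omega>|M. excess_error (S k \<omega>)) \<le> \<nu> * (4 * sqrt (p_f P) * (LINT \<omega>|M. eps (S k \<omega>)))"
    using nu01 by (intro mult_left_mono excess_error_expectation(2)) auto
  also have "\<dots> = (4 * \<nu> * sqrt (p_f P)) * (LINT \<omega>|M. eps (S k \<omega>))" by simp
  also have "\<dots> \<le> ((1 - \<nu>) * (1 - 1 / gamma P)) * (LINT \<omega>|M. eps (S k \<omega>))"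
    by (intro mult_right_mono failure_bounds Ee)
  finally have noise: "\<nu> * (LINT \<omega>|M. excess_error (S k \<omega>))
    \<le> (1 - \<nu>) * (1 - 1 / gamma P) * (LINT \<omega>|M. eps (S k \<omega>))" .
  have "(LINT \<omega>|M. ?bad \<omega>) \<le> p_fail * (LINT \<omega>|M. active_radius e k \<omega>)"
    by (rule inaccurate_expectation_le[OF active_radius_measurable active_radius_bounds])
  also have "\<dots> \<le> 1 / 2 * (LINT \<omega>|M. active_radius e k \<omega>)"
    by (intro mult_right_mono failure_bounds Ea)
  finally have "active_gain e * (1 / 2 * (LINT \<omega>|M. active_radius e k \<omega>))
      \<le> active_gain e * ((LINT \<omega>|M. active_radius e k \<omega>) - (LINT \<omega>|M. ?bad \<omega>))"
    using gains_pos(2)[OF e] by (intro mult_left_mono) auto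
  with main noise show ?thesis by simp
qed

text \<open>
  The increments of the merit parameter telescope to at most \<open>mu_hat\<close> over the whole run. This
  permits summation from the first iteration on, whereas the random stabilization index need not
  be a stopping time.
\<close>
lemma expected_sum_bound:
  assumes e: "0 < e"
  shows "\<exists>C. \<forall>n. (\<Sum>k<n. radius_gain * (LINT \<omega>|M. Delta (S k \<omega>) ^ (alpha P + 2))
      + active_gain e / 2 * (LINT \<omega>|M. active_radius e k \<omega>)) \<le> C"
proof (intro exI allI)
  fix n
  let ?t = "\<lambda>k. radius_gain * (LINT \<omega>|M. Delta (S k \<omega>) ^ (alpha P + 2))
      + active_gain e / 2 * (LINT \<omega>|M. active_radius e k \<omega>)"
  let ?L = "\<lambda>k. LINT \<omega>|M. lyap (S k \<omega>)" and ?m = "\<lambda>k. LINT \<omega>|M. mu_in (S k \<omega>)"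
  have mSuc: "(LINT \<omega>|M. mu (S k \<omega>)) = ?m (Suc k)" for k
    by (rule Bochner_Integration.integral_cong) (simp_all add: storm_path.mu_in_Suc[OF path])
  have "?L n + (\<Sum>k<n. ?t k) \<le> ?L 0 + \<nu> * kappa_c K * (?m n - ?m 0)"
  proof (induction n)
    case (Suc n)
    then show ?case using expected_decrease[OF e, of n] unfolding mSuc by (simp add: algebra_simps)
  qed simp
  moreover have "0 \<le> ?L n"
    using storm_path.lyap_nonneg[OF path, of _ n] by (intro integral_nonneg_AE AE_I2)
  moreover have "?m n - ?m 0 \<le> mu_hat"
  proof -
    have "AE \<omega> in M. mu_in (S n \<omega>) \<le> mu_hat"
      using merit_bounded AE_space
    proof eventually_elim
      case (elim \<omega>)
      interpret storm_path f c \<Omega> K P \<nu> "\<lambda>k. S k \<omega>" using elim by (simp add: path)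
      show ?case using mu_ge[of n] elim(1) by (meson order_trans)
    qed
    then have "?m n \<le> (LINT \<omega>|M. mu_hat)"
      by (intro integral_mono_AE integrable_mu) auto
    moreover have "0 \<le> ?m 0"
      using storm_path.mu_in_pos[OF path, of _ 0] by (intro integral_nonneg_AE AE_I2) (simp add: less_imp_le)
    ultimately show ?thesis by (simp add: prob_space)
  qed
  then have "\<nu> * kappa_c K * (?m n - ?m 0) \<le> \<nu> * kappa_c K * mu_hat"
    using nu01 consts_pos by (intro mult_left_mono) auto
  ultimately show "(\<Sum>k<n. ?t k) \<le> ?L 0 + \<nu> * kappa_c K * mu_hat" by linarith
qed

lemma AE_summable_active_radius:
  assumes e: "0 < e"
  shows "AE \<omega> in M. summable (\<lambda>k. active_radius e k \<omega>)"
    and "AE \<omega> in M. summable (\<lambda>k. Delta (S k \<omega>) ^ (alpha P + 2))"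
proof -
  let ?R = "\<lambda>k. LINT \<omega>|M. Delta (S k \<omega>) ^ (alpha P + 2)" and ?A = "\<lambda>k. LINT \<omega>|M. active_radius e k \<omega>"
  obtain C where C: "\<And>n. (\<Sum>k<n. radius_gain * ?R k + active_gain e / 2 * ?A k) \<le> C"
    using expected_sum_bound[OF e] by auto
  have g: "0 < radius_gain" "0 < active_gain e" using gains_pos e by auto
  have R0: "0 \<le> ?R k" for k
    using storm_path.Delta_pos[OF path, of _ k] by (intro integral_nonneg_AE AE_I2) (simp add: less_imp_le)
  have A0: "0 \<le> ?A k" for k
    using active_radius_bounds by (intro integral_nonneg_AE AE_I2) simp
  have split: "(\<Sum>k<n. radius_gain * ?R k + active_gain e / 2 * ?A k)
      = radius_gain * (\<Sum>k<n. ?R k) + active_gain e / 2 * (\<Sum>k<n. ?A k)" for n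
    by (simp add: sum.distrib sum_distrib_left)
  have nn: "0 \<le> radius_gain * (\<Sum>k<n. ?R k)" "0 \<le> active_gain e / 2 * (\<Sum>k<n. ?A k)" for n
    using g R0 A0 by (auto intro!: mult_nonneg_nonneg sum_nonneg)
  show "AE \<omega> in M. summable (\<lambda>k. active_radius e k \<omega>)"
  proof (rule AE_summable_of_bounded_expectations[OF integrable_active_radius(1)])
    show "(\<Sum>k<n. ?A k) \<le> C / (active_gain e / 2)" for n
    proof -
      have "active_gain e / 2 * (\<Sum>k<n. ?A k) \<le> C" using C[of n] split[of n] nn(1)[of n] by linarith
      then show ?thesis using g by (simp add: pos_le_divide_eq mult.commute)
    qed
  qed (use active_radius_bounds in \<open>auto intro!: AE_I2\<close>)
  show "AE \<omega> in M. summable (\<lambda>k. Delta (S k \<omega>) ^ (alpha P + 2))"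
  proof (rule AE_summable_of_bounded_expectations[OF integrable_radius_power])
    show "(\<Sum>k<n. ?R k) \<le> C / radius_gain" for n
    proof -
      have "radius_gain * (\<Sum>k<n. ?R k) \<le> C" using C[of n] split[of n] nn(2)[of n] by linarith
      then show ?thesis using g by (simp add: pos_le_divide_eq mult.commute)
    qed
  qed (use storm_path.Delta_pos[OF path] in \<open>auto intro!: AE_I2 simp: less_imp_le\<close>)
qed

lemma AE_radius_tendsto_zero: "AE \<omega> in M. (\<lambda>k. Delta (S k \<omega>)) \<longlonglongrightarrow> 0"
  using AE_summable_active_radius(2)[OF zero_less_one] AE_space
proof eventually_elim
  case (elim \<omega>)
  let ?n = "alpha P + 2"
  have "(\<lambda>k. root ?n (Delta (S k \<omega>) ^ ?n)) \<longlonglongrightarrow> root ?n 0"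
    by (rule tendsto_real_root[OF summable_LIMSEQ_zero[OF elim(1)]])
  then show ?case
    using storm_path.Delta_pos[OF path[OF elim(2)]] by (simp only: real_root_power_cancel less_imp_le) simp
qed

section \<open>Recurrence\<close>

definition stays_active :: "real \<Rightarrow> nat \<Rightarrow> nat \<Rightarrow> 'w \<Rightarrow> bool" where
  "stays_active e m k \<omega> \<longleftrightarrow> (\<forall>j\<in>{m..<k}. e \<le> kkt_residual f c (xk (S j \<omega>)) \<and>
      Delta (S j \<omega>) \<le> radius_threshold mu_hat e)"

text \<open>
  Whether the run is active is known before each iteration. The process killed when this fails is
  therefore adapted, and the conditional accuracy applies to it.
\<close>
definition stopped_inverse_radius :: "real \<Rightarrow> nat \<Rightarrow> nat \<Rightarrow> 'w \<Rightarrow> real" where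
  "stopped_inverse_radius e m k \<omega> = (if stays_active e m k \<omega> then 1 / Delta (S k \<omega>) else 0)"

lemma stopped_inverse_radius_measurable: "stopped_inverse_radius e m k \<in> borel_measurable (\<F> k)"
proof -
  have [measurable]: "(\<lambda>\<omega>. kkt_residual f c (xk (S j \<omega>))) \<in> borel_measurable (\<F> k)"
      "(\<lambda>\<omega>. Delta (S j \<omega>)) \<in> borel_measurable (\<F> k)" if "j \<le> k" for j
    using measurable_from_subalg[OF past_mono[OF that]] residual_measurable adapted_measurable(2)
    by blast+
  have [measurable]: "Measurable.pred (\<F> k) (stays_active e m k)"
    unfolding stays_active_def
  proof (rule pred_intros_finite(3))
    fix j assume "j \<in> {m..<k}"
    then have [simp]: "j \<le> k" by simp
    show "Measurable.pred (\<F> k) (\<lambda>\<omega>. e \<le> kkt_residual f c (xk (S j \<omega>)) \<and> Delta (S j \<omega>) \<le> radius_threshold mu_hat e)"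
      by measurable
  qed simp
  have [measurable]: "(\<lambda>\<omega>. Delta (S k \<omega>)) \<in> borel_measurable (\<F> k)" by (rule adapted_measurable)
  show ?thesis unfolding stopped_inverse_radius_def by measurable
qed

lemma stopped_inverse_radius_bounds:
  assumes "\<omega> \<in> space M"
  shows "0 \<le> stopped_inverse_radius e m k \<omega> \<and> stopped_inverse_radius e m k \<omega> \<le> gamma P ^ k / Delta_init P"
proof -
  interpret storm_path f c \<Omega> K P \<nu> "\<lambda>k. S k \<omega>" using assms by (rule path)
  have "0 < Delta_init P / gamma P ^ k" using param_bounds by simp
  then have "1 / Delta (S k \<omega>) \<le> 1 / (Delta_init P / gamma P ^ k)"
    using Delta_ge[of k] by (intro frac_le) auto
  moreover have "0 \<le> gamma P ^ k / Delta_init P" using param_bounds by simp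
  ultimately show ?thesis using Delta_pos[of k] by (simp add: stopped_inverse_radius_def)
qed

lemma integrable_stopped: "integrable M (stopped_inverse_radius e m k)"
  by (rule integrable_const_bound[of _ "gamma P ^ k / Delta_init P"])
    (use stopped_inverse_radius_bounds past_imp_M[OF stopped_inverse_radius_measurable] in \<open>auto intro!: AE_I2\<close>)

text \<open>
  While the run stays active, accurate iterations expand the radius by the factor \<open>\<gamma>\<close>, and the
  rare inaccurate ones shrink it by at most this factor. The inverse radius therefore contracts
  in expectation, although it is bounded below.
\<close>
lemma stopped_inverse_radius_contracts:
  assumes e: "0 < e" and mk: "m \<le> k"
  shows "(LINT \<omega>|M. stopped_inverse_radius e m (Suc k) \<omega>)
    \<le> (1 / gamma P + p_fail * gamma P) * (LINT \<omega>|M. stopped_inverse_radius e m k \<omega>)"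
proof -
  let ?Y = "stopped_inverse_radius e m" and ?N = "{\<omega> \<in> space M. \<not> accurate k \<omega>}"
  have g: "1 < gamma P" by (rule param_bounds)
  have "?N \<in> sets M" using accurate_event by (rule sets.sets_Collect_neg)
  from integrable_mult_indicator[OF this integrable_stopped[of e m k]]
  have iN: "integrable M (\<lambda>\<omega>. ?Y k \<omega> * indicator ?N \<omega>)" by (simp add: mult.commute)
  have "AE \<omega> in M. ?Y (Suc k) \<omega> \<le> 1 / gamma P * ?Y k \<omega> + gamma P * (?Y k \<omega> * indicator ?N \<omega>)"
    using merit_bounded AE_space
  proof eventually_elim
    case (elim \<omega>)
    interpret storm_path f c \<Omega> K P \<nu> "\<lambda>k. S k \<omega>" using elim by (simp add: path)
    have D: "0 < Delta (S k \<omega>)" "0 < Delta (S (Suc k) \<omega>)" by (rule Delta_pos)+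
    have Y0: "0 \<le> ?Y k \<omega>" using stopped_inverse_radius_bounds[OF elim(2)] by simp
    show ?case
    proof (cases "stays_active e m (Suc k) \<omega>")
      case False
      then show ?thesis using Y0 g by (simp add: stopped_inverse_radius_def[of e m "Suc k"])
    next
      case True
      then have st: "stays_active e m k \<omega>" and act: "e \<le> kkt_residual f c (xk (S k \<omega>))"
          "Delta (S k \<omega>) \<le> radius_threshold mu_hat e"
        using mk by (auto simp: stays_active_def)
      have Y: "?Y (Suc k) \<omega> = 1 / Delta (S (Suc k) \<omega>)" "?Y k \<omega> = 1 / Delta (S k \<omega>)"
        using True st by (simp_all add: stopped_inverse_radius_def)
      show ?thesis
      proof (cases "accurate k \<omega>")
        case True
        then have "Delta (S (Suc k) \<omega>) = gamma P * Delta (S k \<omega>)"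
          using accurate_step_expands[of k mu_hat e] e act elim(1) by (auto simp: accurate_def)
        then show ?thesis using True by (simp add: Y)
      next
        case False
        have "1 / Delta (S (Suc k) \<omega>) \<le> 1 / (Delta (S k \<omega>) / gamma P)"
          using Delta_Suc_ge[of k] D g by (intro frac_le) auto
        then have "?Y (Suc k) \<omega> \<le> gamma P * (?Y k \<omega> * indicator ?N \<omega>)"
          using False elim(2) by (simp add: Y)
        moreover have "0 \<le> 1 / gamma P * ?Y k \<omega>" using Y0 g by simp
        ultimately show ?thesis by linarith
      qed
    qed
  qed
  then have "(LINT \<omega>|M. ?Y (Suc k) \<omega>)
      \<le> (LINT \<omega>|M. 1 / gamma P * ?Y k \<omega> + gamma P * (?Y k \<omega> * indicator ?N \<omega>))"
    by (intro integral_mono_AE integrable_stopped Bochner_Integration.integrable_add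
        integrable_mult_right iN)
  also have "\<dots> = 1 / gamma P * (LINT \<omega>|M. ?Y k \<omega>) + gamma P * (LINT \<omega>|M. ?Y k \<omega> * indicator ?N \<omega>)"
    by (simp only: Bochner_Integration.integral_add integral_mult_right_zero integrable_stopped
        integrable_mult_right iN)
  also have "\<dots> \<le> 1 / gamma P * (LINT \<omega>|M. ?Y k \<omega>) + gamma P * (p_fail * (LINT \<omega>|M. ?Y k \<omega>))"
    using g by (intro add_left_mono mult_left_mono
        inaccurate_expectation_le[OF stopped_inverse_radius_measurable stopped_inverse_radius_bounds]) auto
  finally show ?thesis by (simp add: algebra_simps)
qed

text \<open>
  Geometric decay of the expectations makes the stopped inverse radii summable almost surely.
  On a run that stays active forever they are at least \<open>1 / Delta_max P\<close>, which is
  contradictory.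
\<close>
lemma AE_not_always_active:
  assumes e: "0 < e"
  shows "AE \<omega> in M. \<exists>j\<ge>m. kkt_residual f c (xk (S j \<omega>)) < e \<or> radius_threshold mu_hat e < Delta (S j \<omega>)"
proof -
  define q where "q = 1 / gamma P + p_fail * gamma P"
  let ?Y = "\<lambda>n. stopped_inverse_radius e m (m + n)"
  define y where "y = (LINT \<omega>|M. ?Y 0 \<omega>)"
  have q: "0 \<le> q" "q < 1" using failure_bounds param_bounds(12) by (auto simp: q_def)
  have y0: "0 \<le> y"
    unfolding y_def using stopped_inverse_radius_bounds by (intro integral_nonneg_AE AE_I2) simp
  have geo: "(LINT \<omega>|M. ?Y n \<omega>) \<le> q ^ n * y" for n
  proof (induction n)
    case (Suc n)
    have "(LINT \<omega>|M. ?Y (Suc n) \<omega>) \<le> q * (LINT \<omega>|M. ?Y n \<omega>)"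
      using stopped_inverse_radius_contracts[OF e, of m "m + n"] by (simp add: q_def)
    also have "\<dots> \<le> q * (q ^ n * y)" using Suc q by (intro mult_left_mono)
    finally show ?case by simp
  qed (simp add: y_def)
  have "AE \<omega> in M. summable (\<lambda>n. ?Y n \<omega>)"
  proof (rule AE_summable_of_bounded_expectations[OF integrable_stopped])
    show "(\<Sum>k<n. LINT \<omega>|M. ?Y k \<omega>) \<le> (\<Sum>k. q ^ k * y)" for n
    proof -
      have "(\<Sum>k<n. LINT \<omega>|M. ?Y k \<omega>) \<le> (\<Sum>k<n. q ^ k * y)" by (intro sum_mono geo)
      also have "\<dots> \<le> (\<Sum>k. q ^ k * y)"
        using q y0 by (intro sum_le_suminf summable_mult2 summable_geometric) auto
      finally show ?thesis .
    qed
  qed (use stopped_inverse_radius_bounds in \<open>auto intro!: AE_I2\<close>)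
  then show ?thesis using AE_space
  proof eventually_elim
    case (elim \<omega>)
    interpret storm_path f c \<Omega> K P \<nu> "\<lambda>k. S k \<omega>" using elim by (simp add: path)
    show ?case
    proof (rule ccontr)
      assume "\<not> ?thesis"
      then have "stays_active e m k \<omega>" for k by (auto simp: stays_active_def not_less)
      then have "?Y n \<omega> = 1 / Delta (S (m + n) \<omega>)" for n by (simp add: stopped_inverse_radius_def)
      then have "1 / Delta_max P \<le> ?Y n \<omega>" for n
        using Delta_pos[of "m + n"] Delta_le_max[of "m + n"] by (simp add: divide_left_mono)
      then have "1 / Delta_max P \<le> 0"
        using summable_LIMSEQ_zero[OF elim(1)] by (intro LIMSEQ_le_const) auto
      then show False using param_bounds(6) by simp
    qed
  qed
qed

lemma AE_residual_tendsto_zero: "AE \<omega> in M. (\<lambda>k. kkt_residual f c (xk (S k \<omega>))) \<longlonglongrightarrow> 0"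
proof -
  let ?e = "\<lambda>n. 1 / real (Suc n)"
  have "AE \<omega> in M. \<forall>n. summable (\<lambda>k. active_radius (?e n) k \<omega>)"
    unfolding AE_all_countable by (intro allI AE_summable_active_radius) simp
  moreover have "AE \<omega> in M. \<forall>n m. \<exists>j\<ge>m. kkt_residual f c (xk (S j \<omega>)) < ?e n \<or>
      radius_threshold mu_hat (?e n) < Delta (S j \<omega>)"
    unfolding AE_all_countable by (intro allI AE_not_always_active) simp
  ultimately show ?thesis
    using AE_radius_tendsto_zero AE_space
  proof eventually_elim
    case (elim \<omega>)
    interpret storm_path f c \<Omega> K P \<nu> "\<lambda>k. S k \<omega>" using elim by (simp add: path)
    have small: "\<exists>m0. \<forall>k\<ge>m0. Delta (S k \<omega>) < radius_threshold mu_hat (?e n)" for n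
    proof -
      have "0 < radius_threshold mu_hat (?e n)" by (rule radius_threshold_pos[OF mu_hat_nonneg]) simp
      from order_tendstoD(2)[OF elim(3) this] show ?thesis by (simp add: eventually_sequentially)
    qed
    show ?case
    proof (rule recurrent_controlled_tendsto_zero[OF _ _ residual_const_nonneg residual_step elim(3)])
      fix n
      obtain m0 where m0: "\<And>k. m0 \<le> k \<Longrightarrow> Delta (S k \<omega>) < radius_threshold mu_hat (?e n)"
        using small by blast
      have "\<forall>\<^sub>F k in sequentially. active_radius (?e n) k \<omega>
          = (if ?e n \<le> kkt_residual f c (xk (S k \<omega>)) then Delta (S k \<omega>) else 0)"
        unfolding eventually_sequentially using m0 by (force simp: active_radius_def less_imp_le)
      then show "summable (\<lambda>k. if ?e n \<le> kkt_residual f c (xk (S k \<omega>)) then Delta (S k \<omega>) else 0)"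
        using elim(1) summable_cong by fastforce
      fix m
      obtain j where j: "max m m0 \<le> j" "kkt_residual f c (xk (S j \<omega>)) < ?e n \<or>
          radius_threshold mu_hat (?e n) < Delta (S j \<omega>)"
        using elim(2) by blast
      then show "\<exists>j\<ge>m. kkt_residual f c (xk (S j \<omega>)) < ?e n"
        using m0[of j] by (intro exI[of _ j]) auto
    qed (use Delta_pos in \<open>auto simp: kkt_residual_def less_imp_le\<close>)
  qed
qed

end

section \<open>Almost sure first-order convergence\<close>

lemma Upsilon3_pos:
  assumes "valid_params P" "kappa_B_ok m P K"
  shows "0 < Upsilon3 P K mu_hat"
proof -
  have "1 \<le> kappa_B K"
    using assms by (auto simp: valid_params_def kappa_B_ok_def)
  moreover have "0 < kappa_g P * max 1 (Delta_max P)" "0 < kappa_fcd P"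
    using assms by (auto simp: valid_params_def)
  ultimately have "0 < kappa_B K / (kappa_g P * max 1 (Delta_max P) + kappa_B K)"
    by (intro divide_pos_pos add_pos_pos) linarith+
  then have "0 < max (kappa_B K / (kappa_g P * max 1 (Delta_max P) + kappa_B K)) x" for x
    by (rule less_le_trans[OF _ max.cobounded1])
  then show ?thesis
    unfolding Upsilon3_def using \<open>0 < kappa_fcd P\<close> by (intro mult_pos_pos divide_pos_pos) simp_all
qed

text \<open>
  The merit parameter never decreases, so its final value bounds the earlier ones as well.
\<close>
lemma merit_stabilizes_bounded:
  assumes "merit_stabilizes M S Kbar mu_hat"
    and mono: "\<And>\<omega> j k. \<omega> \<in> space M \<Longrightarrow> j \<le> k \<Longrightarrow> mu (S j \<omega>) \<le> mu (S k \<omega>)"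
  shows "AE \<omega> in M. \<forall>k. mu (S k \<omega>) \<le> mu_hat"
  using assms(1)[unfolded merit_stabilizes_def] AE_space
proof eventually_elim
  case (elim \<omega>)
  show ?case
  proof
    fix k
    have "mu (S k \<omega>) \<le> mu (S (max k (Kbar \<omega>)) \<omega>)" by (rule mono[OF elim(2)]) simp
    also have "\<dots> \<le> mu_hat" by (metis elim(1) max.cobounded2)
    finally show "mu (S k \<omega>) \<le> mu_hat" .
  qed
qed

theorem theorem4p17:
  fixes N :: "'s measure" and F :: "real^'d \<Rightarrow> 's \<Rightarrow> real"
    and f :: "real^'d \<Rightarrow> real" and c :: "real^'d \<Rightarrow> real^'m"
    and M :: "'w measure" and \<F> \<H> :: "nat \<Rightarrow> 'w measure"
    and P :: "'d params" and S :: "nat \<Rightarrow> 'w \<Rightarrow> ('d, 'n::finite) iter"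
    and \<Omega> :: "(real^'d) set" and K :: reg_consts
    and Kbar :: "'w \<Rightarrow> nat" and mu_hat \<nu> :: real
  assumes dims: "CARD('n) = max 1 (CARD('d) - CARD('m))"
    and objective: "prob_space N" "\<And>x. integrable N (F x)" "\<And>x. f x = (LINT \<xi>|N. F x \<xi>)"
    and prob: "prob_space M"
    and params: "valid_params P"
    and algorithm: "\<And>\<omega>. \<omega> \<in> space M \<Longrightarrow> storm_run P c (\<lambda>k. S k \<omega>)"
    and adapted: "adapted_run M \<F> \<H> P c S"
    and regular: "problem_regular f c \<Omega> K" "kappa_B_ok CARD('m) P K"
      "\<And>\<omega>. \<omega> \<in> space M \<Longrightarrow> iterates_regular P f c \<Omega> K (\<lambda>k. S k \<omega>)"
    and stabilization: "merit_stabilizes M S Kbar mu_hat"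
    and accuracy: "probabilistic_accuracy M \<F> \<H> P f c S"
    and nu: "\<nu> \<in> {0<..<1}"
      "\<nu> / (1 - \<nu>) \<ge>
         max (4 * gamma P ^ 3 * max 1 (Delta_max P)
                / min (eta P ^ 3 * kappa_fcd P) (Upsilon3 P K mu_hat))
             (2 * gamma P / eta P)"
    and probabilities:
      "p_h P + p_g P + 2 * p_f P \<le> (1 - \<nu>)\<^sup>2 / (16 * \<nu>\<^sup>2) * (1 - 1 / gamma P)\<^sup>2"
  shows "AE \<omega> in M. (\<lambda>k. norm (grad_lagr c (xk (S k \<omega>)) (grad f (xk (S k \<omega>))))) \<longlonglongrightarrow> 0"
proof -
  have n01: "0 < \<nu>" "\<nu> < 1" using nu(1) by auto
  have par: "0 < eta P" "0 < kappa_fcd P" "1 < gamma P"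
    using params by (auto simp: valid_params_def)
  let ?a = "eta P ^ 3 * kappa_fcd P" and ?g = "4 * gamma P ^ 3 * max 1 (Delta_max P)"
  have a: "0 < ?a" using par by simp
  \<comment> \<open>If \<open>Upsilon3\<close> were not positive, the quotient by the minimum would not bound the one by \<open>?a\<close>.\<close>
  have "?g / ?a \<le> ?g / min ?a (Upsilon3 P K mu_hat)"
    using a Upsilon3_pos[OF params regular(2)] par by (intro divide_left_mono) auto
  then have "?g / ?a \<le> \<nu> / (1 - \<nu>)" "2 * gamma P / eta P \<le> \<nu> / (1 - \<nu>)"
    using nu(2) unfolding max.bounded_iff by (meson order_trans)+
  then have rad: "?g * (1 - \<nu>) \<le> \<nu> * ?a" and eps: "2 * gamma P * (1 - \<nu>) \<le> \<nu> * eta P"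
    using a par n01 by (simp_all only: pos_divide_le_eq pos_le_divide_eq diff_gt_0_iff_gt
        times_divide_eq_left mult.commute[of _ \<nu>])
  interpret problem: storm_problem f c \<Omega> K P \<nu>
  proof
    show "problem_regular f c \<Omega> K" by (rule regular(1))
    show "valid_params P" by (rule params)
    show "0 < \<nu>" "\<nu> < 1" by (rule n01)+
  qed (rule rad eps)+
  have path: "storm_path f c \<Omega> K P \<nu> (\<lambda>k. S k \<omega>)" if "\<omega> \<in> space M" for \<omega>
    by (intro storm_path.intro storm_path_axioms.intro problem.storm_problem_axioms
        algorithm[OF that] regular(3)[OF that])
  have "AE \<omega> in M. \<forall>k. mu (S k \<omega>) \<le> mu_hat"
    by (rule merit_stabilizes_bounded[OF stabilization storm_path.mu_mono[OF path]])
  then have "storm_process f c \<Omega> K P \<nu> M \<F> \<H> S mu_hat"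
    by (intro storm_process.intro storm_process_axioms.intro problem.storm_problem_axioms prob
        algorithm adapted regular(3) accuracy probabilities)
  then show ?thesis
    unfolding kkt_residual_def[symmetric] by (rule storm_process.AE_residual_tendsto_zero)
qed

end
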